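(* Let $\alpha$ and $d$ be positive constants with $\alpha\le 1$ and $d<\pi$, and let $\mathscr{D}=\psi(\mathscr{D}_d)$. Let $g$ be continuous on $[a,b]$ and $k$ continuous on $[a,b]\times[a,b]$. Assume that $g$, $k(z,\cdot)$ and $k(\cdot,w)$ belong to $\mathbf{H}^\infty(\mathscr{D})$ for all $z,w\in\mathscr{D}$, and that $g$, $k(t,\cdot)$ and $k(\cdot,s)$ belong to $C([a,b])$ for all $t,s\in[a,b]$. Furthermore, assume that $g\in\mathbf{M}_\alpha(\mathscr{D})$ and that $k(\cdot,w)$ belongs to $\mathbf{M}_\alpha(\mathscr{D})$ uniformly with respect to $w\in\mathscr{D}$. For each positive integer $N$ let $h=\sqrt{\pi d/(\alpha N)}$ and $n=2N+1$. Let $u$ be the solution of $$u(t)-\int_a^t k(t,s)u(s)\,ds=g(t),\qquad a\le t\le b.$$ Then there exists a positive integer $N_0$ such that for all $N\ge N_0$ the matrix $E_n^{RZ}-V_n^{RZ}$ is invertible. Furthermore, there exists a constant $C$ independent of $N$ such that for all $N\ge N_0$, $$\|u-w_N^{RZ}\|_{C([a,b])}\le C\sqrt{N}\,e^{-\sqrt{\pi d\alpha N}},$$ where $w_N^{RZ}$ is the approximate solution of the Rashidinia--Zarebnia Sinc-collocation method (defined in the context).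
   Context: $a<b$ are real; $\|\cdot\|_{C([a,b])}$ is the uniform norm. Transformation: $\psi(x)=\frac{b-a}{2}\tanh\left(\frac{x}{2}\right)+\frac{b+a}{2}$, $\phi=\psi^{-1}:(a,b)\to\mathbb{R}$, $t_j=\psi(jh)$. Strip: $\mathscr{D}_d=\{\zeta\in\mathbb{C}:|\mathrm{Im}\,\zeta|<d\}$, and $\psi(\mathscr{D}_d)=\{\psi(\zeta):\zeta\in\mathscr{D}_d\}$, a simply connected domain containing $(a,b)$. Function spaces: $\mathbf{H}^\infty(\mathscr{D})$ is the family of analytic functions $f$ on $\mathscr{D}$ with $\sup_{z\in\mathscr{D}}|f(z)|<\infty$. $\mathbf{M}_\alpha(\mathscr{D})$ is the family of $f\in\mathbf{H}^\infty(\mathscr{D})$ for which there is a constant $L$ with $|f(z)-f(a)|\le L|z-a|^\alpha$ and $|f(b)-f(z)|\le L|b-z|^\alpha$ for all $z\in\mathscr{D}$ ($f(a),f(b)$ being the values of $f$ at the endpoints, which are boundary points of $\mathscr{D}$). For a two-variable function $k$, "$k(\cdot,w)$ belongs to $\mathbf{M}_\alpha(\mathscr{D})$ uniformly with respect to $w\in\mathscr{D}$" means there is a constant $L_k$ independent of $w$ with $|k(z,w)-k(a,w)|\le L_k|z-a|^\alpha$ and $|k(b,w)-k(z,w)|\le L_k|b-z|^\alpha$ for all $z,w\in\mathscr{D}$. Method: $S(j,h)(x)=\frac{\sin(\pi(x-jh)/h)}{\pi(x-jh)/h}$ for $x\neq jh$, $S(j,h)(jh)=1$; $J(j,h)(x)=h\left\{\frac12+\frac1\pi\mathrm{Si}\left[\frac{\pi(x-jh)}{h}\right]\right\}$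 with $\mathrm{Si}(x)=\int_0^x\frac{\sin t}{t}dt$ (compositions with $\phi$ are extended to $t=a,b$ by limits); $\delta_m^{(-1)}=\frac12+\frac1\pi\mathrm{Si}(\pi m)$; $\omega_a(t)=\frac{b-t}{b-a}$, $\omega_b(t)=\frac{t-a}{b-a}$; $\mathcal{V}_N[f](t)=\sum_{j=-N}^N k(t,t_j)f(t_j)\psi'(jh)J(j,h)(\phi(t))$. With rows and columns indexed by $i,j=-N,\dots,N$: $E_n^{RZ}$ has column $j=-N$ equal to $(\omega_a(t_i))_i$, column $j=N$ equal to $(\omega_b(t_i))_i$, and entries $\delta_{ij}$ (Kronecker delta) in columns $-N+1\le j\le N-1$; $V_n^{RZ}$ has column $j=-N$ equal to $(\mathcal{V}_N[\omega_a](t_i))_i$, column $j=N$ equal to $(\mathcal{V}_N[\omega_b](t_i))_i$, and entries $k(t_i,t_j)\psi'(jh)\,h\,\delta^{(-1)}_{i-j}$ in columns $-N+1\le j\le N-1$. Let $(c_{-N},\dots,c_N)^{\mathrm T}$ be the solution of $(E_n^{RZ}-V_n^{RZ})\mathbf{c}_n=(g(t_{-N}),\dots,g(t_N))^{\mathrm T}$. Then $$w_N^{RZ}(t)=c_{-N}\omega_a(t)+\sum_{j=-N+1}^{N-1}c_jS(j,h)(\phi(t))+c_N\omega_b(t).$$ *)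

theory Defs
  imports "HOL-Complex_Analysis.Complex_Analysis" "HOL-Probability.Sinc_Integral"
    "Jordan_Normal_Form.Matrix"
begin

text \<open>
  The kernel and the right-hand side are total functions on the complex numbers, of which only
  the values on \<open>\<D> \<union> [a,b]\<close> matter. In this way the function on the strip image \<open>\<D>\<close>, its
  restriction to \<open>[a,b]\<close> and its values at the boundary points \<open>a\<close>, \<open>b\<close> of \<open>\<D>\<close> are
  automatically those of the same function. Functions on \<open>[a,b]\<close> may be complex-valued.
\<close>

subsection \<open>The tanh transformation and the function spaces\<close>

text \<open>Used both on the reals and on the complex strip.\<close>

definition psi :: "real \<Rightarrow> real \<Rightarrow> 'a \<Rightarrow> 'a::{banach, real_normed_field}" where
  "psi a b z = of_real ((b - a) / 2) * tanh (z / 2) + of_real ((b + a) / 2)"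

definition phi :: "real \<Rightarrow> real \<Rightarrow> real \<Rightarrow> real" where
  "phi a b = inv_into UNIV (psi a b)"

definition strip :: "real \<Rightarrow> complex set" where
  "strip d = {\<zeta>. \<bar>Im \<zeta>\<bar> < d}"

definition Hinf :: "complex set \<Rightarrow> (complex \<Rightarrow> complex) set" where
  "Hinf D = {f. f analytic_on D \<and> bounded (f ` D)}"

definition Malpha :: "real \<Rightarrow> real \<Rightarrow> real \<Rightarrow> complex set \<Rightarrow> (complex \<Rightarrow> complex) set" where
  "Malpha a b \<alpha> D = {f \<in> Hinf D. \<exists>L. \<forall>z\<in>D.
      norm (f z - f (of_real a)) \<le> L * norm (z - of_real a) powr \<alpha> \<and>
      norm (f (of_real b) - f z) \<le> L * norm (of_real b - z) powr \<alpha>}"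

definition uniformly_Malpha ::
  "real \<Rightarrow> real \<Rightarrow> real \<Rightarrow> complex set \<Rightarrow> (complex \<Rightarrow> complex \<Rightarrow> complex) \<Rightarrow> bool" where
  "uniformly_Malpha a b \<alpha> D k \<longleftrightarrow> (\<exists>L. \<forall>z\<in>D. \<forall>w\<in>D.
      norm (k z w - k (of_real a) w) \<le> L * norm (z - of_real a) powr \<alpha> \<and>
      norm (k (of_real b) w - k z w) \<le> L * norm (of_real b - z) powr \<alpha>)"

text \<open>The norm of \<open>C([a,b])\<close>. The supremum is meaningful for functions bounded on \<open>[a,b]\<close>, in
  particular for continuous ones.\<close>

definition unif_norm :: "real \<Rightarrow> real \<Rightarrow> (real \<Rightarrow> complex) \<Rightarrow> real" where
  "unif_norm a b f = (SUP t\<in>{a..b}. norm (f t))"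

subsection \<open>Sinc approximation\<close>

definition sincS :: "int \<Rightarrow> real \<Rightarrow> real \<Rightarrow> real" where
  "sincS j h x = (if x = of_int j * h then 1
     else sin (pi * (x - of_int j * h) / h) / (pi * (x - of_int j * h) / h))"

definition sincJ :: "int \<Rightarrow> real \<Rightarrow> real \<Rightarrow> real" where
  "sincJ j h x = h * (1/2 + 1/pi * Si (pi * (x - of_int j * h) / h))"

definition delta_m1 :: "int \<Rightarrow> real" where
  "delta_m1 m = 1/2 + 1/pi * Si (pi * of_int m)"

text \<open>The composition \<open>F \<circ> \<phi>\<close>, extended from \<open>(a,b)\<close> to the endpoints by its limits.\<close>

definition comp_phi :: "real \<Rightarrow> real \<Rightarrow> (real \<Rightarrow> real) \<Rightarrow> real \<Rightarrow> real" where
  "comp_phi a b F t = (if t \<in> {a<..<b} then F (phi a b t)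
     else Lim (at t within {a<..<b}) (\<lambda>s. F (phi a b s)))"

definition omega_a :: "real \<Rightarrow> real \<Rightarrow> real \<Rightarrow> real" where
  "omega_a a b t = (b - t) / (b - a)"

definition omega_b :: "real \<Rightarrow> real \<Rightarrow> real \<Rightarrow> real" where
  "omega_b a b t = (t - a) / (b - a)"

definition node :: "real \<Rightarrow> real \<Rightarrow> real \<Rightarrow> int \<Rightarrow> real" where
  "node a b h j = psi a b (of_int j * h)"

definition VN :: "real \<Rightarrow> real \<Rightarrow> (complex \<Rightarrow> complex \<Rightarrow> complex) \<Rightarrow> real \<Rightarrow> nat
    \<Rightarrow> (real \<Rightarrow> real) \<Rightarrow> real \<Rightarrow> complex" where
  "VN a b k h N f t = (\<Sum>j = - int N..int N.
     k (of_real t) (of_real (node a b h j)) *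
     of_real (f (node a b h j) * deriv (psi a b) (of_int j * h) * comp_phi a b (sincJ j h) t))"

subsection \<open>The Rashidinia--Zarebnia collocation method\<close>

text \<open>The library's matrices and vectors are indexed from \<open>0\<close>, so position \<open>p\<close> stands for the
  index \<open>p - N\<close> in \<open>{-N..N}\<close>.\<close>

definition E_RZ :: "real \<Rightarrow> real \<Rightarrow> real \<Rightarrow> nat \<Rightarrow> complex mat" where
  "E_RZ a b h N = mat (2 * N + 1) (2 * N + 1) (\<lambda>(p, q).
     let i = int p - int N; j = int q - int N in
       if j = - int N then of_real (omega_a a b (node a b h i))
       else if j = int N then of_real (omega_b a b (node a b h i))
       else if i = j then 1 else 0)"

definition V_RZ :: "real \<Rightarrow> real \<Rightarrow> (complex \<Rightarrow> complex \<Rightarrow> complex) \<Rightarrow> real \<Rightarrow> nat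
    \<Rightarrow> complex mat" where
  "V_RZ a b k h N = mat (2 * N + 1) (2 * N + 1) (\<lambda>(p, q).
     let i = int p - int N; j = int q - int N in
       if j = - int N then VN a b k h N (omega_a a b) (node a b h i)
       else if j = int N then VN a b k h N (omega_b a b) (node a b h i)
       else k (of_real (node a b h i)) (of_real (node a b h j)) *
            of_real (deriv (psi a b) (of_int j * h) * h * delta_m1 (i - j)))"

definition g_RZ :: "real \<Rightarrow> real \<Rightarrow> (complex \<Rightarrow> complex) \<Rightarrow> real \<Rightarrow> nat \<Rightarrow> complex Matrix.vec" where
  "g_RZ a b g h N = Matrix.vec (2 * N + 1) (\<lambda>p. g (of_real (node a b h (int p - int N))))"

text \<open>Meaningful when the collocation matrix is invertible.\<close>

definition c_RZ :: "real \<Rightarrow> real \<Rightarrow> (complex \<Rightarrow> complex) \<Rightarrow> (complex \<Rightarrow> complex \<Rightarrow> complex)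
    \<Rightarrow> real \<Rightarrow> nat \<Rightarrow> complex Matrix.vec" where
  "c_RZ a b g k h N = (THE c. c \<in> carrier_vec (2 * N + 1) \<and>
     (E_RZ a b h N - V_RZ a b k h N) *\<^sub>v c = g_RZ a b g h N)"

definition w_RZ :: "real \<Rightarrow> real \<Rightarrow> (complex \<Rightarrow> complex) \<Rightarrow> (complex \<Rightarrow> complex \<Rightarrow> complex)
    \<Rightarrow> real \<Rightarrow> nat \<Rightarrow> real \<Rightarrow> complex" where
  "w_RZ a b g k h N t =
     (let c = (\<lambda>j. vec_index (c_RZ a b g k h N) (nat (j + int N))) in
       c (- int N) * of_real (omega_a a b t)
       + (\<Sum>j = - int N + 1..int N - 1. c j * of_real (comp_phi a b (sincS j h) t))
       + c (int N) * of_real (omega_b a b t))"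

definition mesh :: "real \<Rightarrow> real \<Rightarrow> nat \<Rightarrow> real" where
  "mesh d \<alpha> N = sqrt (pi * d / (\<alpha> * real N))"

end

theory Submission
  imports Defs "HOL-Real_Asymp.Real_Asymp" "Jordan_Normal_Form.Determinant"
begin

text \<open>
  The collocation method is a Nystroem method in disguise. If \<open>x\<^sub>i = w(t\<^sub>i)\<close> denotes the nodal values of the
  approximation with coefficients \<open>c\<close>, then \<open>x = E c\<close>, and \<open>V = A E\<close> for the matrix \<open>A\<close> with entries
  \<open>k(t\<^sub>i,t\<^sub>j) \<psi>'(j h) h \<delta>\<^sub>i\<^sub>-\<^sub>j\<close> that discretizes the Volterra integral at \<open>t\<^sub>i\<close> by Sinc indefinite integration.
  So \<open>E - V = (I - A) E\<close>, and it suffices to treat \<open>I - A\<close>, the interpolation matrix \<open>E\<close>, and the two Sinc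
  formulas separately.

  Stability. As \<open>\<delta>\<^sub>m \<rightarrow> 0\<close> for \<open>m \<rightarrow> -\<infinity>\<close>, the row sums of \<open>A\<close> on and above the diagonal tend to \<open>0\<close> with \<open>h\<close>, while
  the entries below the diagonal are dominated by weights whose sum stays bounded. A discrete Gronwall
  inequality (\<open>almost_lower_triangular_stability\<close>) therefore bounds the solutions of \<open>(I - A) x = f\<close>
  by the maximum norm of \<open>f\<close>, uniformly in \<open>N\<close>; in particular the matrix is invertible. The coefficients
  depend stably on the nodal values (\<open>coefficient_bound\<close>), because the interior columns of \<open>E\<close> are unit
  vectors and the end columns interact through a nearly diagonal two-by-two matrix.

  Consistency. Since \<open>D\<close> is star-shaped with respect to \<open>a\<close>, the Volterra equation can be solved along
  segments from \<open>a\<close> by Picard iteration among bounded holomorphic functions, and uniqueness on the interval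
  shows that the solution continues \<open>u\<close> (\<open>solution_extension\<close>). Removing the linear interpolant of the end
  values leaves a function that decays like \<open>exp (- \<alpha> \<bar>Re \<zeta>\<bar>)\<close> on the strip (\<open>end_remainder_decay\<close>).

  Sinc formulas. By the residue theorem on growing rectangles, the error of the cardinal series of \<open>F\<close> is
  \<open>sin (\<pi> x / h)\<close> times a Cauchy integral of \<open>F(z) / sin (\<pi> z / h)\<close>, and on the lines \<open>\<bar>Im z\<bar> = y\<close> the denominator
  is at least \<open>sinh (\<pi> y / h)\<close>. Letting \<open>y\<close> tend to \<open>d\<close> gives \<open>sinc_interpolation_error\<close>, and an integration by
  parts gives \<open>sinc_indefinite_integration_error\<close>. With the chosen mesh all exponential factors are at most
  of the order \<open>exp (- \<surd>(\<pi> d \<alpha> N))\<close>, and the factor \<open>\<surd>N\<close> accounts for the tail of the cardinal series and for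
  the amplification of the nodal errors by the Sinc basis.
\<close>

section \<open>The tanh transformation and the image of the strip\<close>

text \<open>
  In this form \<open>\<psi>\<close> is the exponential followed by a Moebius map, so all estimates on the strip become
  estimates on the sector \<open>exp (- \<zeta>)\<close> runs through.
\<close>

lemma psi_logistic:
  fixes z :: "'a::{banach, real_normed_field}"
  assumes "1 + exp (- z) \<noteq> 0"
  shows "psi a b z = of_real a + of_real (b - a) / (1 + exp (- z))"
proof -
  define p where "p = exp (z / 2)"
  have p0: "p \<noteq> 0" by (simp add: p_def)
  have em: "exp (- (z / 2)) = 1 / p" by (simp add: p_def exp_minus inverse_eq_divide)
  have "exp (- z) = exp (- (z / 2)) * exp (- (z / 2))" by (simp flip: exp_add)
  then have e: "exp (- z) = 1 / (p * p)" by (simp add: em)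
  have n: "p * p + 1 \<noteq> 0" using assms p0 by (simp add: e field_simps)
  have "tanh (z / 2) = (p - 1 / p) / (p + 1 / p)" by (simp add: tanh_altdef em flip: p_def)
  also have "\<dots> = ((p * p - 1) / p) / ((p * p + 1) / p)"
    using p0 by (simp add: diff_divide_distrib add_divide_distrib)
  also have "\<dots> = (p * p - 1) / (p * p + 1)" using p0 by simp
  finally have t: "tanh (z / 2) = (p * p - 1) / (p * p + 1)" .
  define B A where "B = (of_real ((b - a) / 2) :: 'a)" and "A = (of_real ((b + a) / 2) :: 'a)"
  have "a = (b + a) / 2 - (b - a) / 2" "b - a = (b - a) / 2 + (b - a) / 2" by (simp_all add: field_simps)
  then have ab: "of_real a = A - B" "of_real (b - a) = 2 * B"
    unfolding A_def B_def mult_2 by (metis of_real_diff, metis of_real_add)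
  have "1 + 1 / (p * p) = (p * p + 1) / (p * p)" using p0 by (simp add: add_divide_distrib)
  then have "of_real a + of_real (b - a) / (1 + exp (- z)) = A - B + 2 * B * (p * p) / (p * p + 1)"
    unfolding ab e by simp
  also have "\<dots> = B * ((p * p - 1) / (p * p + 1)) + A" using n by (simp add: field_simps)
  finally show ?thesis unfolding psi_def t A_def B_def by simp
qed

lemma psi_real: "psi a b (x::real) = a + (b - a) / (1 + exp (- x))"
  using psi_logistic[of x a b] add_pos_pos[of 1 "exp (- x)"] by simp

lemma psi_of_real: "psi a b (complex_of_real x) = of_real (psi a b x)"
proof -
  have p: "1 + exp (- x) \<noteq> 0" using add_pos_pos[of 1 "exp (- x)"] by simp
  have e: "1 + exp (- complex_of_real x) = of_real (1 + exp (- x))"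
    unfolding of_real_add of_real_1 exp_of_real[symmetric] of_real_minus ..
  have "1 + exp (- complex_of_real x) \<noteq> 0" unfolding e of_real_eq_0_iff using p .
  from psi_logistic[OF this] show ?thesis unfolding psi_real e by simp
qed

text \<open>
  The open sector \<open>\<bar>Arg q\<bar> < d\<close> for \<open>0 < d < \<pi>\<close>. Written as an inequality between \<open>Re q\<close> and \<open>\<bar>q\<bar>\<close> it
  excludes \<open>0\<close>, is visibly open, and is easy to check after adding a real number.
\<close>

definition sector :: "real \<Rightarrow> complex set" where
  "sector d = {q. norm q * cos d < Re q}"

lemma exp_strip_sector:
  assumes "0 < d" "d < pi"
  shows "(\<lambda>\<zeta>. exp (- \<zeta>)) ` strip d = sector d"
proof
  show "(\<lambda>\<zeta>. exp (- \<zeta>)) ` strip d \<subseteq> sector d"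
  proof clarify
    fix z assume "z \<in> strip d"
    then have "cos d < cos \<bar>Im z\<bar>" using assms by (intro cos_monotone_0_pi) (auto simp: strip_def)
    then have "cos d < cos (Im z)" by (simp add: cos_abs_real)
    then show "exp (- z) \<in> sector d" by (simp add: sector_def Re_exp)
  qed
  show "sector d \<subseteq> (\<lambda>\<zeta>. exp (- \<zeta>)) ` strip d"
  proof
    fix q assume q: "q \<in> sector d"
    then have q0: "q \<noteq> 0" by (auto simp: sector_def)
    define z where "z = - Ln q"
    have e: "q = exp (- z)" using q0 by (simp add: z_def)
    have "norm q * cos d < norm q * cos (Im z)"
      using q by (simp add: sector_def Re_exp e)
    then have "cos d < cos \<bar>Im z\<bar>" using q0 by (simp add: cos_abs_real)
    moreover have "\<bar>Im z\<bar> \<le> pi" using mpi_less_Im_Ln[OF q0] Im_Ln_le_pi[OF q0] by (simp add: z_def)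
    ultimately have "\<bar>Im z\<bar> < d" using assms cos_monotone_0_pi_le[of d "\<bar>Im z\<bar>"] by force
    then show "q \<in> (\<lambda>\<zeta>. exp (- \<zeta>)) ` strip d" using e by (auto simp: strip_def)
  qed
qed

text \<open>
  Moving right by \<open>c\<close> raises the real part by \<open>c\<close> and changes the modulus by at most \<open>c\<close>; since
  \<open>\<bar>cos d\<bar> \<le> 1\<close>, the defining inequality survives.
\<close>

lemma sector_add:
  assumes "q \<in> sector d" "0 \<le> c"
  shows "q + of_real c \<in> sector d"
proof -
  have 1: "\<bar>norm (q + of_real c) - norm q\<bar> \<le> c"
    using norm_triangle_ineq3[of "q + of_real c" q] assms(2) by simp
  have "(norm (q + of_real c) - norm q) * cos d \<le> \<bar>norm (q + of_real c) - norm q\<bar> * \<bar>cos d\<bar>"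
    by (metis abs_ge_self abs_mult)
  also have "\<dots> \<le> c * 1" using 1 by (intro mult_mono) auto
  finally show ?thesis using assms by (simp add: sector_def algebra_simps)
qed

lemma sector_scale:
  assumes "q \<in> sector d" "0 < c"
  shows "of_real c * q \<in> sector d"
  using assms by (simp add: sector_def norm_mult mult.assoc)

text \<open>
  The strip stays away from the poles \<open>\<plusminus>i\<pi>\<close> of \<open>\<psi>\<close> because \<open>d < \<pi>\<close>. After squaring, the claim reduces to
  \<open>(1 - cos d) (1 - r)\<^sup>2 \<ge> 0\<close> with \<open>r = exp (- Re \<zeta>)\<close>.
\<close>

lemma norm_one_add_exp_ge:
  assumes "0 < d" "d < pi" "\<zeta> \<in> strip d"
  shows "cos (d / 2) * (1 + exp (- Re \<zeta>)) \<le> norm (1 + exp (- \<zeta>))"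
proof -
  define r where "r = exp (- Re \<zeta>)"
  have "exp (- \<zeta>) \<in> sector d" using exp_strip_sector assms by auto
  then have 1: "r * cos d \<le> Re (exp (- \<zeta>))" by (simp add: sector_def r_def)
  have n: "(Re (exp (- \<zeta>)))\<^sup>2 + (Im (exp (- \<zeta>)))\<^sup>2 = r\<^sup>2"
    using cmod_power2[of "exp (- \<zeta>)"] by (simp add: r_def)
  have 2: "(norm (1 + exp (- \<zeta>)))\<^sup>2 = 1 + 2 * Re (exp (- \<zeta>)) + r\<^sup>2"
    unfolding cmod_power2 n[symmetric] by (simp add: power2_eq_square algebra_simps)
  have "cos d = 2 * (cos (d / 2))\<^sup>2 - 1" using cos_double_cos[of "d / 2"] by simp
  then have 3: "(cos (d / 2) * (1 + r))\<^sup>2 = (1 + cos d) / 2 * (1 + r)\<^sup>2"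
    by (simp add: power_mult_distrib)
  have "0 \<le> (1 - cos d) / 2 * (1 - r)\<^sup>2" by simp
  then have "(cos (d / 2) * (1 + r))\<^sup>2 \<le> 1 + 2 * (r * cos d) + r\<^sup>2"
    unfolding 3 by (simp add: power2_eq_square field_simps)
  also have "\<dots> \<le> (norm (1 + exp (- \<zeta>)))\<^sup>2" using 1 2 by simp
  finally show ?thesis unfolding r_def by (rule power2_le_imp_le) simp
qed

locale strip_image =
  fixes a b d :: real
  assumes ab: "a < b" and d0: "0 < d" and dpi: "d < pi"
begin

definition D :: "complex set" where "D = psi a b ` strip d"

definition \<kappa> :: real where "\<kappa> = cos (d / 2)"

lemma kappa_pos: "0 < \<kappa>"
  unfolding \<kappa>_def using d0 dpi by (intro cos_gt_zero) auto

lemma norm_one_plus_exp_ge: "\<zeta> \<in> strip d \<Longrightarrow> \<kappa> * (1 + exp (- Re \<zeta>)) \<le> norm (1 + exp (- \<zeta>))"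
  unfolding \<kappa>_def using norm_one_add_exp_ge d0 dpi by blast

lemma one_plus_exp_nonzero:
  assumes "\<zeta> \<in> strip d" shows "1 + exp (- \<zeta>) \<noteq> 0"
proof -
  have "0 < \<kappa> * (1 + exp (- Re \<zeta>))" using kappa_pos by (simp add: add_pos_pos)
  then show ?thesis using norm_one_plus_exp_ge[OF assms] by auto
qed

lemma psi_minus_a: "\<zeta> \<in> strip d \<Longrightarrow> psi a b \<zeta> - of_real a = of_real (b - a) / (1 + exp (- \<zeta>))"
  using psi_logistic[OF one_plus_exp_nonzero] by simp

lemma b_minus_psi:
  assumes "\<zeta> \<in> strip d"
  shows "of_real b - psi a b \<zeta> = of_real (b - a) * exp (- \<zeta>) / (1 + exp (- \<zeta>))"
  using psi_logistic[OF one_plus_exp_nonzero[OF assms], of a b] one_plus_exp_nonzero[OF assms] by (simp add: field_simps)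

lemma D_iff: "z \<in> D \<longleftrightarrow> z \<noteq> of_real a \<and> (of_real b - z) / (z - of_real a) \<in> sector d"
proof
  assume "z \<in> D"
  then obtain \<zeta> where z: "\<zeta> \<in> strip d" "z = psi a b \<zeta>" by (auto simp: D_def)
  have 1: "exp (- \<zeta>) \<in> sector d" using exp_strip_sector[OF d0 dpi] z by auto
  have 2: "complex_of_real (b - a) \<noteq> 0" using ab by simp
  then have "z \<noteq> of_real a" using psi_minus_a[OF z(1)] one_plus_exp_nonzero[OF z(1)] z(2) by auto
  moreover have "(of_real b - z) / (z - of_real a) = exp (- \<zeta>)"
    unfolding z(2) psi_minus_a[OF z(1)] b_minus_psi[OF z(1)] using 2 one_plus_exp_nonzero[OF z(1)] by simp
  ultimately show "z \<noteq> of_real a \<and> (of_real b - z) / (z - of_real a) \<in> sector d"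
    using 1 by simp
next
  assume z: "z \<noteq> of_real a \<and> (of_real b - z) / (z - of_real a) \<in> sector d"
  then obtain \<zeta> where \<zeta>: "\<zeta> \<in> strip d" "(of_real b - z) / (z - of_real a) = exp (- \<zeta>)"
    using exp_strip_sector[OF d0 dpi] by (auto simp: image_iff set_eq_iff)
  have "1 + (of_real b - z) / (z - of_real a) = of_real (b - a) / (z - of_real a)"
    using z by (simp add: field_simps)
  then have "psi a b \<zeta> = z"
    using psi_logistic[OF one_plus_exp_nonzero[OF \<zeta>(1)], of a b] z ab unfolding \<zeta>(2)[symmetric]
    by (simp del: of_real_diff)
  then show "z \<in> D" using \<zeta> by (auto simp: D_def)
qed

lemma open_D: "open D"
proof -
  have "open ((- {of_real a}) \<inter> (\<lambda>z. (of_real b - z) / (z - of_real a)) -` sector d)"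
  proof (rule continuous_open_preimage)
    show "continuous_on (- {of_real a}) (\<lambda>z. (of_real b - z) / (z - complex_of_real a))"
      by (intro continuous_intros) auto
    show "open (sector d)" unfolding sector_def by (intro open_Collect_less continuous_intros)
  qed auto
  moreover have "D = (- {of_real a}) \<inter> (\<lambda>z. (of_real b - z) / (z - of_real a)) -` sector d"
    using D_iff by auto
  ultimately show ?thesis by simp
qed

text \<open>
  Shrinking towards \<open>a\<close> by the factor \<open>s\<close> replaces \<open>q = (b - z) / (z - a)\<close> by \<open>q / s + (1 / s - 1)\<close>, and a
  sector is closed under positive scaling and under adding nonnegative reals.
\<close>

lemma star_D:
  assumes z: "z \<in> D" and s: "0 < s" "s \<le> 1"
  shows "of_real a + of_real s * (z - of_real a) \<in> D"
proof -
  define q where "q = (of_real b - z) / (z - of_real a)"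
  have q: "q \<in> sector d" and za: "z \<noteq> of_real a" using z D_iff by (auto simp: q_def)
  have e: "(of_real b - (of_real a + of_real s * (z - of_real a))) / (of_real a + of_real s * (z - of_real a) - of_real a)
      = of_real (1 / s) * q + of_real (1 / s - 1)"
    using za s by (simp add: q_def field_simps)
  have "of_real (1 / s) * q + of_real (1 / s - 1) \<in> sector d"
    by (intro sector_add sector_scale q) (use s in auto)
  then show ?thesis using za s D_iff e by auto
qed

lemma real_in_D: "t \<in> {a<..<b} \<Longrightarrow> of_real t \<in> D"
proof -
  assume t: "t \<in> {a<..<b}"
  have e: "(complex_of_real b - of_real t) / (of_real t - of_real a) = of_real ((b - t) / (t - a))" by simp
  have "cos d < 1" using cos_monotone_0_pi[of 0 d] d0 dpi by simp
  then have "complex_of_real ((b - t) / (t - a)) \<in> sector d"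
    unfolding sector_def mem_Collect_eq norm_of_real
    using t mult_strict_left_mono[of "cos d" 1 "(b - t) / (t - a)"] by simp
  then show ?thesis unfolding D_iff e using t by auto
qed

lemma psi_in_interval: "psi a b x \<in> {a<..<b}"
proof -
  have e: "1 < 1 + exp (- x)" "0 < 1 + exp (- x)" using add_pos_pos[of 1 "exp (- x)"] by simp_all
  then have "(b - a) / (1 + exp (- x)) < (b - a) / 1" using ab e by (intro divide_strict_left_mono) auto
  moreover have "0 < (b - a) / (1 + exp (- x))" using ab e by (intro divide_pos_pos) auto
  ultimately show ?thesis unfolding psi_real by simp
qed

lemma real_in_strip: "complex_of_real x \<in> strip d" using d0 by (simp add: strip_def)

lemma psi_in_D: "\<zeta> \<in> strip d \<Longrightarrow> psi a b \<zeta> \<in> D" by (auto simp: D_def)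

lemma norm_minus_a_le:
  assumes "\<zeta> \<in> strip d"
  shows "norm (psi a b \<zeta> - of_real a) \<le> (b - a) / \<kappa> * min 1 (exp (Re \<zeta>))"
proof -
  have p: "0 < 1 + exp (- Re \<zeta>)" by (simp add: add_pos_pos)
  have "norm (psi a b \<zeta> - of_real a) = (b - a) / norm (1 + exp (- \<zeta>))"
    using psi_minus_a[OF assms] ab by (simp add: norm_divide del: of_real_diff)
  also have "\<dots> \<le> (b - a) / (\<kappa> * (1 + exp (- Re \<zeta>)))"
    using norm_one_plus_exp_ge[OF assms] ab kappa_pos p by (intro divide_left_mono mult_pos_pos) (auto simp: one_plus_exp_nonzero[OF assms])
  also have "\<dots> = (b - a) / \<kappa> * (1 / (1 + exp (- Re \<zeta>)))" by simp
  also have "\<dots> \<le> (b - a) / \<kappa> * min 1 (exp (Re \<zeta>))"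
  proof (intro mult_left_mono)
    have "1 / (1 + exp (- Re \<zeta>)) \<le> 1 / exp (- Re \<zeta>)" using p by (intro divide_left_mono) auto
    moreover have "1 / exp (- Re \<zeta>) = exp (Re \<zeta>)" by (simp add: exp_minus field_simps)
    ultimately show "1 / (1 + exp (- Re \<zeta>)) \<le> min 1 (exp (Re \<zeta>))" using p by simp
  qed (use ab kappa_pos in auto)
  finally show ?thesis .
qed

lemma norm_b_minus_le:
  assumes "\<zeta> \<in> strip d"
  shows "norm (of_real b - psi a b \<zeta>) \<le> (b - a) / \<kappa> * min 1 (exp (- Re \<zeta>))"
proof -
  have p: "0 < 1 + exp (- Re \<zeta>)" by (simp add: add_pos_pos)
  have "norm (of_real b - psi a b \<zeta>) = (b - a) * exp (- Re \<zeta>) / norm (1 + exp (- \<zeta>))"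
    using b_minus_psi[OF assms] ab by (simp add: norm_divide norm_mult del: of_real_diff)
  also have "\<dots> \<le> (b - a) * exp (- Re \<zeta>) / (\<kappa> * (1 + exp (- Re \<zeta>)))"
    using norm_one_plus_exp_ge[OF assms] ab kappa_pos p by (intro divide_left_mono mult_pos_pos) (auto simp: one_plus_exp_nonzero[OF assms])
  also have "\<dots> = (b - a) / \<kappa> * (exp (- Re \<zeta>) / (1 + exp (- Re \<zeta>)))" by simp
  also have "\<dots> \<le> (b - a) / \<kappa> * min 1 (exp (- Re \<zeta>))"
    using ab kappa_pos p by (intro mult_left_mono) (auto simp: field_simps min_def)
  finally show ?thesis .
qed

definition psi' :: "complex \<Rightarrow> complex" where
  "psi' \<zeta> = of_real (b - a) * exp (- \<zeta>) / (1 + exp (- \<zeta>))\<^sup>2"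

lemma open_strip: "open (strip d)"
proof -
  have "strip d = {\<zeta>. Im \<zeta> < d} \<inter> {\<zeta>. - d < Im \<zeta>}" by (auto simp: strip_def)
  then show ?thesis by (simp add: open_halfspace_Im_lt open_halfspace_Im_gt open_Int)
qed

lemma psi_has_derivative:
  assumes "\<zeta> \<in> strip d"
  shows "(psi a b has_field_derivative psi' \<zeta>) (at \<zeta>)"
proof -
  have "((\<lambda>z. of_real a + of_real (b - a) / (1 + exp (- z))) has_field_derivative psi' \<zeta>) (at \<zeta>)"
    using one_plus_exp_nonzero[OF assms] by (auto intro!: derivative_eq_intros simp: psi'_def power2_eq_square)
  then show ?thesis
    by (rule has_field_derivative_transform_within_open[OF _ open_strip assms])
       (simp add: psi_logistic[OF one_plus_exp_nonzero])
qed

lemma norm_psi'_le: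
  assumes "\<zeta> \<in> strip d"
  shows "norm (psi' \<zeta>) \<le> (b - a) / \<kappa>\<^sup>2 * exp (- \<bar>Re \<zeta>\<bar>)"
proof -
  have p: "0 < 1 + exp (- Re \<zeta>)" by (simp add: add_pos_pos)
  have "norm (psi' \<zeta>) = (b - a) * exp (- Re \<zeta>) / (norm (1 + exp (- \<zeta>)))\<^sup>2"
    using ab by (simp add: psi'_def norm_divide norm_mult norm_power del: of_real_diff)
  also have "\<dots> \<le> (b - a) * exp (- Re \<zeta>) / (\<kappa> * (1 + exp (- Re \<zeta>)))\<^sup>2"
    using norm_one_plus_exp_ge[OF assms] ab kappa_pos p by (intro divide_left_mono mult_pos_pos power_mono) (auto simp: one_plus_exp_nonzero[OF assms])
  also have "\<dots> = (b - a) / \<kappa>\<^sup>2 * (exp (- Re \<zeta>) / (1 + exp (- Re \<zeta>))\<^sup>2)" by (simp add: power_mult_distrib)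
  also have "\<dots> \<le> (b - a) / \<kappa>\<^sup>2 * exp (- \<bar>Re \<zeta>\<bar>)"
  proof (intro mult_left_mono)
    define r where "r = exp (- Re \<zeta>)"
    have r: "0 < r" by (simp add: r_def)
    have "exp (- \<bar>Re \<zeta>\<bar>) = min r (1 / r)"
    proof -
      have "1 / r = exp (Re \<zeta>)" by (simp add: r_def exp_minus field_simps)
      then show ?thesis by (auto simp: r_def min_def abs_if)
    qed
    moreover have "r / (1 + r)\<^sup>2 \<le> r / 1" using r by (intro divide_left_mono) auto
    moreover have "r / (1 + r)\<^sup>2 \<le> r / r\<^sup>2" using r by (intro divide_left_mono power_mono) auto
    ultimately show "exp (- Re \<zeta>) / (1 + exp (- Re \<zeta>))\<^sup>2 \<le> exp (- \<bar>Re \<zeta>\<bar>)"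
      using r by (simp add: r_def[symmetric] power2_eq_square)
  qed (use ab in auto)
  finally show ?thesis .
qed

lemma holomorphic_psi: "psi a b holomorphic_on strip d"
  using psi_has_derivative open_strip holomorphic_on_open by blast

lemma holomorphic_psi': "psi' holomorphic_on strip d"
  unfolding psi'_def[abs_def] using one_plus_exp_nonzero by (intro holomorphic_intros) auto

end

section \<open>Holomorphic dependence on parameters\<close>

text \<open>
  Cauchy's estimates make the remainder of the first-order Taylor expansion uniform over all functions
  with a common bound. This uniformity is what allows differentiation with a parameter held in the
  background, in the next two results.
\<close>

lemma holomorphic_second_order_bound:
  assumes r: "0 < r"
  shows "\<exists>c\<ge>0. \<forall>f. f holomorphic_on ball z r \<longrightarrow> (\<forall>w\<in>ball z r. norm (f w) \<le> B) \<longrightarrow>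
    norm (deriv f z) \<le> c \<and>
    (\<forall>h. norm h \<le> r / 4 \<longrightarrow> norm (f (z + h) - f z - deriv f z * h) \<le> c * (norm h)\<^sup>2)"
proof -
  define c1 where "c1 = fact 1 * (\<bar>B\<bar> + 1) / (r / 2) ^ 1"
  define c2 where "c2 = fact 2 * (\<bar>B\<bar> + 1) / (r / 2) ^ 2"
  have c: "0 \<le> c1" "0 \<le> c2" using r by (auto simp: c1_def c2_def)
  have "norm (deriv f z) \<le> c1 + c2 \<and>
    (\<forall>h. norm h \<le> r / 4 \<longrightarrow> norm (f (z + h) - f z - deriv f z * h) \<le> (c1 + c2) * (norm h)\<^sup>2)"
    if f: "f holomorphic_on ball z r" "\<forall>w\<in>ball z r. norm (f w) \<le> B" for f
  proof -
    have bd: "norm ((deriv ^^ n) f x) \<le> fact n * (\<bar>B\<bar> + 1) / (r / 2) ^ n"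
      if x: "x \<in> cball z (r / 4)" and n: "0 < n" for n x
    proof (rule Cauchy_higher_deriv_bound[where y = 0])
      have *: "cball x (r / 2) \<subseteq> ball z r"
      proof
        fix y assume "y \<in> cball x (r / 2)"
        then show "y \<in> ball z r" using x r dist_triangle[of z y x] by (simp add: dist_commute)
      qed
      then show "f holomorphic_on ball x (r / 2)" using f(1) ball_subset_cball holomorphic_on_subset by blast
      show "continuous_on (cball x (r / 2)) f"
        using * f(1) holomorphic_on_imp_continuous_on holomorphic_on_subset by blast
      show "f w \<in> ball 0 (\<bar>B\<bar> + 1)" if "w \<in> ball x (r / 2)" for w
      proof -
        have "norm (f w) \<le> B" using * that f(2) by (metis ball_subset_cball subsetD)
        then show ?thesis by simp
      qed
    qed (use r n in auto)
    have der: "((deriv ^^ i) f has_field_derivative (deriv ^^ Suc i) f x) (at x within cball z (r / 4))"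
      if "x \<in> cball z (r / 4)" for i x
    proof -
      have "x \<in> ball z r" using that r by auto
      then have "((deriv ^^ i) f has_field_derivative deriv ((deriv ^^ i) f) x) (at x)"
        using holomorphic_higher_deriv[OF f(1) open_ball] holomorphic_derivI open_ball by blast
      then show ?thesis by (simp add: has_field_derivative_at_within)
    qed
    have "norm (deriv f z) \<le> c1" using bd[of z 1] r by (simp add: c1_def)
    moreover have "norm (f (z + h) - f z - deriv f z * h) \<le> (c1 + c2) * (norm h)\<^sup>2" if h: "norm h \<le> r / 4" for h
    proof -
      have "norm ((deriv ^^ 0) f (z + h) - (\<Sum>i\<le>1. (deriv ^^ i) f z * (z + h - z) ^ i / fact i))
          \<le> c2 * norm (z + h - z) ^ Suc 1 / fact 1"
      proof (rule complex_Taylor[where S = "cball z (r / 4)"])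
        show "norm ((deriv ^^ Suc 1) f x) \<le> c2" if "x \<in> cball z (r / 4)" for x
          using bd[OF that, of 2] by (simp add: c2_def numeral_2_eq_2)
        show "z + h \<in> cball z (r / 4)" using h by (simp add: dist_norm)
      qed (use der r in auto)
      then have "norm (f (z + h) - f z - deriv f z * h) \<le> c2 * (norm h)\<^sup>2"
        by (simp add: power2_eq_square diff_diff_eq)
      also have "\<dots> \<le> (c1 + c2) * (norm h)\<^sup>2" using c by (intro mult_right_mono) auto
      finally show ?thesis .
    qed
    ultimately show ?thesis using c by auto
  qed
  then show ?thesis using c by (intro exI[of _ "c1 + c2"]) auto
qed

lemma tendsto_zero_if_le_linear:
  fixes f :: "complex \<Rightarrow> complex"
  assumes "0 < r" "\<And>h. h \<noteq> 0 \<Longrightarrow> norm h \<le> r \<Longrightarrow> norm (f h) \<le> c * norm h"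
  shows "(f \<longlongrightarrow> 0) (at 0)"
proof (rule Lim_null_comparison[where g = "\<lambda>h. c * norm h"])
  show "\<forall>\<^sub>F h in at 0. norm (f h) \<le> c * norm h"
    unfolding eventually_at using assms by (intro exI[of _ r]) auto
  show "((\<lambda>h. c * norm h) \<longlongrightarrow> 0) (at (0::complex))" by (auto intro!: tendsto_eq_intros)
qed

text \<open>
  A bounded, separately holomorphic \<open>K\<close> is holomorphic along the diagonal. Splitting the increment as
  \<open>K(z+h,z+h) - K(z,z+h)\<close> plus \<open>K(z,z+h) - K(z,z)\<close>, the first quotient is close to \<open>\<partial>\<^sub>1 K(z,z+h)\<close>, uniformly in
  the second argument; and \<open>\<partial>\<^sub>1 K(z,\<cdot>)\<close> is continuous as a uniform limit of difference quotients.
\<close>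

lemma holomorphic_on_diagonal:
  assumes op: "open S"
    and h1: "\<And>w. w \<in> S \<Longrightarrow> (\<lambda>z. K z w) holomorphic_on S"
    and h2: "\<And>z. z \<in> S \<Longrightarrow> (\<lambda>w. K z w) holomorphic_on S"
    and bd: "\<And>z w. z \<in> S \<Longrightarrow> w \<in> S \<Longrightarrow> norm (K z w) \<le> B"
  shows "(\<lambda>z. K z z) holomorphic_on S"
  unfolding holomorphic_on_open[OF op]
proof
  fix z0 assume z0: "z0 \<in> S"
  then obtain r where r: "0 < r" "ball z0 r \<subseteq> S" using op open_contains_ball by blast
  obtain c where c: "0 \<le> c" "\<And>f h. f holomorphic_on ball z0 r \<Longrightarrow> (\<forall>w\<in>ball z0 r. norm (f w) \<le> B) \<Longrightarrow>
      norm h \<le> r / 4 \<Longrightarrow> norm (f (z0 + h) - f z0 - deriv f z0 * h) \<le> c * (norm h)\<^sup>2"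
    using holomorphic_second_order_bound[OF r(1), of z0 B] by blast
  define K1 where "K1 w = deriv (\<lambda>z. K z w) z0" for w
  have q: "norm (K (z0 + h) w - K z0 w - K1 w * h) \<le> c * (norm h)\<^sup>2"
    if "w \<in> S" "norm h \<le> r / 4" for w h
    unfolding K1_def
    by (rule c(2)[where f = "\<lambda>z. K z w"]) (use holomorphic_on_subset[OF h1[OF that(1)] r(2)] that bd r(2) in auto)
  have q': "norm ((K (z0 + h) w - K z0 w) / h - K1 w) \<le> c * norm h"
    if "w \<in> S" "norm h \<le> r / 4" "h \<noteq> 0" for w h
  proof -
    have "(K (z0 + h) w - K z0 w) / h - K1 w = (K (z0 + h) w - K z0 w - K1 w * h) / h"
      using that by (simp add: field_simps)
    then have "norm ((K (z0 + h) w - K z0 w) / h - K1 w) \<le> c * (norm h)\<^sup>2 / norm h"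
      using q[OF that(1,2)] by (simp add: norm_divide divide_right_mono)
    then show ?thesis using that by (simp add: power2_eq_square)
  qed
  have ball_in: "z0 + h \<in> S" if "norm h \<le> r / 4" for h using that r by (auto simp: subset_iff dist_norm)
  have "continuous_on S K1"
  proof (rule uniform_limit_theorem)
    define e where "e n = complex_of_real (r / 4 / real (Suc n))" for n
    have e1: "norm (e n) = r / 4 / real (Suc n)" for n
      using r unfolding e_def norm_of_real by auto
    have "0 < norm (e n)" for n unfolding e1 using r by simp
    then have e2: "e n \<noteq> 0" for n using zero_less_norm_iff by blast
    note e = e1 e2
    have e4: "norm (e n) \<le> r / 4" for n unfolding e using r by (simp add: field_simps)
    show "\<forall>\<^sub>F n in sequentially. continuous_on S (\<lambda>w. (K (z0 + e n) w - K z0 w) / e n)"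
    proof (intro always_eventually allI continuous_intros)
      fix n show "continuous_on S (K (z0 + e n))" "continuous_on S (K z0)"
        using h2[OF ball_in[OF e4]] h2[OF z0] holomorphic_on_imp_continuous_on by auto
    qed (use e in auto)
    have "(\<lambda>n. c * (r / 4 / real (Suc n))) \<longlonglongrightarrow> c * 0"
      by (intro tendsto_mult tendsto_const LIMSEQ_Suc lim_const_over_n)
    then show "uniform_limit S (\<lambda>n w. (K (z0 + e n) w - K z0 w) / e n) K1 sequentially"
      unfolding uniform_limit_iff dist_norm
    proof (intro allI impI)
      fix \<epsilon> :: real assume l: "(\<lambda>n. c * (r / 4 / real (Suc n))) \<longlonglongrightarrow> c * 0" and "0 < \<epsilon>"
      then have "\<forall>\<^sub>F n in sequentially. c * (r / 4 / real (Suc n)) < \<epsilon>"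
        by (intro order_tendstoD(2)[OF l]) auto
      then show "\<forall>\<^sub>F n in sequentially. \<forall>w\<in>S. norm ((K (z0 + e n) w - K z0 w) / e n - K1 w) < \<epsilon>"
      proof eventually_elim
        case (elim n)
        show ?case
        proof
          fix w assume "w \<in> S"
          from q'[OF this e4 e(2), of n] elim
          show "norm ((K (z0 + e n) w - K z0 w) / e n - K1 w) < \<epsilon>" unfolding e(1) by linarith
        qed
      qed
    qed
  qed auto
  then have K1c: "isCont K1 z0" using z0 op continuous_on_eq_continuous_at by blast
  obtain k2 where k2: "((\<lambda>w. K z0 w) has_field_derivative k2) (at z0)"
    using h2[OF z0] z0 op holomorphic_on_open by blast
  have 1: "((\<lambda>h. (K (z0 + h) (z0 + h) - K z0 (z0 + h)) / h - K1 (z0 + h)) \<longlongrightarrow> 0) (at 0)"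
    by (rule tendsto_zero_if_le_linear[of "r / 4" _ c]) (use r q' ball_in in auto)
  have 2: "((\<lambda>h. K1 (z0 + h)) \<longlongrightarrow> K1 z0) (at 0)"
    using K1c by (simp add: isCont_iff)
  have 3: "((\<lambda>h. (K z0 (z0 + h) - K z0 z0) / h) \<longlongrightarrow> k2) (at 0)"
    using k2 by (simp add: DERIV_def)
  have "((\<lambda>h. ((K (z0 + h) (z0 + h) - K z0 (z0 + h)) / h - K1 (z0 + h)) + K1 (z0 + h)
      + (K z0 (z0 + h) - K z0 z0) / h) \<longlongrightarrow> 0 + K1 z0 + k2) (at 0)"
    by (intro tendsto_add 1 2 3)
  then have "((\<lambda>h. (K (z0 + h) (z0 + h) - K z0 z0) / h) \<longlongrightarrow> 0 + K1 z0 + k2) (at 0)"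
    by (simp add: diff_divide_distrib)
  then show "\<exists>f'. ((\<lambda>z. K z z) has_field_derivative f') (at z0)"
    unfolding DERIV_def by blast
qed

text \<open>
  By the second-order bound the difference quotients converge uniformly in the parameter \<open>s\<close>, so the limit
  may be taken under the integral. The dependence on \<open>s\<close> enters through integrability alone: the integrands
  below need not have a limit as \<open>s \<rightarrow> 0\<close>, where the path reaches the boundary point \<open>a\<close>.
\<close>

lemma has_field_derivative_integral_bounded:
  fixes \<phi> :: "complex \<Rightarrow> real \<Rightarrow> complex"
  assumes op: "open S" and one: "(\<lambda>_. 1 :: real) integrable_on T"
    and hol: "\<And>s. s \<in> T \<Longrightarrow> (\<lambda>z. \<phi> z s) holomorphic_on S"
    and int: "\<And>z. z \<in> S \<Longrightarrow> \<phi> z integrable_on T"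
    and bd: "\<And>z s. z \<in> S \<Longrightarrow> s \<in> T \<Longrightarrow> norm (\<phi> z s) \<le> B"
    and z0: "z0 \<in> S"
  shows "((\<lambda>z. integral T (\<phi> z)) has_field_derivative integral T (\<lambda>s. deriv (\<lambda>z. \<phi> z s) z0)) (at z0)"
proof -
  obtain r where r: "0 < r" "ball z0 r \<subseteq> S" using op z0 open_contains_ball by blast
  obtain c where c: "0 \<le> c" "\<And>f. f holomorphic_on ball z0 r \<Longrightarrow> (\<forall>w\<in>ball z0 r. norm (f w) \<le> B) \<Longrightarrow>
      norm (deriv f z0) \<le> c \<and>
      (\<forall>h. norm h \<le> r / 4 \<longrightarrow> norm (f (z0 + h) - f z0 - deriv f z0 * h) \<le> c * (norm h)\<^sup>2)"
    using holomorphic_second_order_bound[OF r(1), of z0 B] by blast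
  have cint: "(\<lambda>_. C :: real) integrable_on T" for C using integrable_on_cmult_left[OF one, of C] by simp
  define \<phi>1 where "\<phi>1 s = deriv (\<lambda>z. \<phi> z s) z0" for s
  have q: "norm (\<phi>1 s) \<le> c \<and> (\<forall>h. norm h \<le> r / 4 \<longrightarrow> norm (\<phi> (z0 + h) s - \<phi> z0 s - \<phi>1 s * h) \<le> c * (norm h)\<^sup>2)"
    if "s \<in> T" for s
    unfolding \<phi>1_def
    by (rule c(2)[where f = "\<lambda>z. \<phi> z s"]) (use holomorphic_on_subset[OF hol[OF that] r(2)] that bd r(2) in auto)
  have q': "norm ((\<phi> (z0 + h) s - \<phi> z0 s) / h - \<phi>1 s) \<le> c * norm h"
    if "s \<in> T" "norm h \<le> r / 4" "h \<noteq> 0" for s h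
  proof -
    have "(\<phi> (z0 + h) s - \<phi> z0 s) / h - \<phi>1 s = (\<phi> (z0 + h) s - \<phi> z0 s - \<phi>1 s * h) / h"
      using that by (simp add: field_simps)
    then have "norm ((\<phi> (z0 + h) s - \<phi> z0 s) / h - \<phi>1 s) \<le> c * (norm h)\<^sup>2 / norm h"
      using q[OF that(1)] that by (simp add: norm_divide divide_right_mono)
    then show ?thesis using that by (simp add: power2_eq_square)
  qed
  have ball_in: "z0 + h \<in> S" if "norm h \<le> r / 4" for h using that r by (auto simp: subset_iff dist_norm)
  have int1: "\<phi>1 integrable_on T"
  proof (rule dominated_convergence(1))
    define e where "e n = complex_of_real (r / 4 / real (Suc n))" for n
    have e1: "norm (e n) = r / 4 / real (Suc n)" for n
      using r unfolding e_def norm_of_real by auto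
    have "0 < norm (e n)" for n unfolding e1 using r by simp
    then have e2: "e n \<noteq> 0" for n using zero_less_norm_iff by blast
    note e = e1 e2
    have e4: "norm (e n) \<le> r / 4" for n unfolding e using r by (simp add: field_simps)
    show "(\<lambda>s. (\<phi> (z0 + e n) s - \<phi> z0 s) / e n) integrable_on T" for n
      using integrable_on_divide[OF integrable_diff[OF int[OF ball_in[OF e4]] int[OF z0]], of n "e n"] .
    show "(\<lambda>_. c + c * (r / 4)) integrable_on T" by (rule cint)
    show "norm ((\<phi> (z0 + e n) s - \<phi> z0 s) / e n) \<le> c + c * (r / 4)" if "s \<in> T" for n s
    proof -
      have "norm ((\<phi> (z0 + e n) s - \<phi> z0 s) / e n) \<le> norm ((\<phi> (z0 + e n) s - \<phi> z0 s) / e n - \<phi>1 s) + norm (\<phi>1 s)"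
        using norm_triangle_ineq[of "(\<phi> (z0 + e n) s - \<phi> z0 s) / e n - \<phi>1 s" "\<phi>1 s"] by simp
      also have "\<dots> \<le> c * norm (e n) + c" using q'[OF that e4 e(2)] q[OF that] by (intro add_mono) auto
      also have "\<dots> \<le> c + c * (r / 4)" using c(1) e4[of n] mult_left_mono[OF e4[of n] c(1)] by simp
      finally show ?thesis .
    qed
    show "(\<lambda>n. (\<phi> (z0 + e n) s - \<phi> z0 s) / e n) \<longlonglongrightarrow> \<phi>1 s" if "s \<in> T" for s
    proof (rule LIM_zero_cancel, rule Lim_null_comparison)
      show "\<forall>\<^sub>F n in sequentially. norm ((\<phi> (z0 + e n) s - \<phi> z0 s) / e n - \<phi>1 s) \<le> c * (r / 4 / real (Suc n))"
        using q'[OF that e4 e(2)] e(1) by (intro always_eventually) auto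
      have "(\<lambda>n. c * (r / 4 / real (Suc n))) \<longlonglongrightarrow> c * 0"
        by (intro tendsto_mult tendsto_const LIMSEQ_Suc lim_const_over_n)
      then show "(\<lambda>n. c * (r / 4 / real (Suc n))) \<longlonglongrightarrow> 0" by simp
    qed
  qed
  have "((\<lambda>h. (integral T (\<phi> (z0 + h)) - integral T (\<phi> z0)) / h - integral T \<phi>1) \<longlongrightarrow> 0) (at 0)"
  proof (rule tendsto_zero_if_le_linear[of "r / 4" _ "c * integral T (\<lambda>_. 1)"])
    fix h :: complex assume h: "h \<noteq> 0" "norm h \<le> r / 4"
    note i = int[OF ball_in[OF h(2)]] int[OF z0]
    note i2 = integrable_on_divide[OF integrable_diff[OF i], of h]
    have "(integral T (\<phi> (z0 + h)) - integral T (\<phi> z0)) / h - integral T \<phi>1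
        = integral T (\<lambda>s. (\<phi> (z0 + h) s - \<phi> z0 s) / h - \<phi>1 s)"
      using integral_diff[OF i2 int1] integral_divide[of T "\<lambda>s. \<phi> (z0 + h) s - \<phi> z0 s" h] integral_diff[OF i] by simp
    also have "norm \<dots> \<le> integral T (\<lambda>_. c * norm h)"
      by (rule integral_norm_bound_integral[OF integrable_diff[OF i2 int1] cint]) (use q' h in auto)
    also have "\<dots> = c * integral T (\<lambda>_. 1) * norm h"
      using integral_mult_left[of T "\<lambda>_. 1 :: real" "c * norm h"] by (simp add: mult_ac)
    finally show "norm ((integral T (\<phi> (z0 + h)) - integral T (\<phi> z0)) / h - integral T \<phi>1)
      \<le> c * integral T (\<lambda>_. 1) * norm h" .
  qed (use r in auto)
  then have "((\<lambda>h. (integral T (\<phi> (z0 + h)) - integral T (\<phi> z0)) / h) \<longlongrightarrow> integral T \<phi>1) (at 0)"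
    by (rule LIM_zero_cancel)
  then show ?thesis unfolding DERIV_def \<phi>1_def .
qed

section \<open>Volterra equations along segments\<close>

abbreviation ray :: "complex \<Rightarrow> complex \<Rightarrow> real \<Rightarrow> complex" where
  "ray a z s \<equiv> a + of_real s * (z - a)"

text \<open>
  The Volterra operator along the segment from \<open>a\<close> to \<open>z\<close>. The interval is open because \<open>a\<close> itself lies
  outside the domain.
\<close>

definition volterra ::
  "complex \<Rightarrow> (complex \<Rightarrow> complex \<Rightarrow> complex) \<Rightarrow> (complex \<Rightarrow> complex) \<Rightarrow> complex \<Rightarrow> complex" where
  "volterra a k f z = integral {0<..<1} (\<lambda>s. k z (ray a z s) * f (ray a z s) * (z - a))"

lemma volterra_of_real:
  assumes "a < t"
  shows "volterra (of_real a) k f (of_real t) = integral {a..t} (\<lambda>s. k (of_real t) (of_real s) * f (of_real s))"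
proof -
  let ?F = "\<lambda>w. k (of_real t) w * f w"
  have l: "complex_of_real a + of_real s * (of_real t - of_real a) = linepath (of_real a) (of_real t) s" for s
    by (simp add: linepath_def scaleR_conv_of_real algebra_simps)
  have "volterra (of_real a) k f (of_real t) = integral {0..1} (\<lambda>s. ?F (linepath (of_real a) (of_real t) s) * (of_real t - of_real a))"
    unfolding volterra_def l by (rule integral_open_interval_real[symmetric])
  also have "\<dots> = contour_integral (linepath (of_real a) (of_real t)) ?F"
    by (simp add: contour_integral_integral)
  also have "\<dots> = integral {a..t} (\<lambda>x. ?F (of_real x))"
    using contour_integral_linepath_Reals_eq[of "of_real a" "of_real t" ?F] assms by simp
  finally show ?thesis .
qed

text \<open>
  The set \<open>X\<close> is star-shaped with respect to \<open>a\<close>. It stands for the complex domain \<open>D\<close> as well as for the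
  real interval \<open>(a,b)\<close> seen as a subset of the plane: uniqueness on the latter identifies the complex
  solution with the given one.
\<close>

locale volterra_kernel =
  fixes a :: complex and X :: "complex set" and k :: "complex \<Rightarrow> complex \<Rightarrow> complex" and K :: real
  assumes star: "\<And>z s. z \<in> X \<Longrightarrow> 0 < s \<Longrightarrow> s < 1 \<Longrightarrow> a + of_real s * (z - a) \<in> X"
    and k_cont: "\<And>z. z \<in> X \<Longrightarrow> continuous_on X (k z)"
    and k_bound: "\<And>z w. z \<in> X \<Longrightarrow> w \<in> X \<Longrightarrow> norm (k z w) \<le> K"
begin

lemma integrand_bound:
  assumes "z \<in> X" "\<And>w. w \<in> X \<Longrightarrow> norm (f w) \<le> B" "s \<in> {0<..<1}"
  shows "norm (k z (ray a z s) * f (ray a z s) * (z - a)) \<le> K * B * norm (z - a)"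
proof -
  have w: "ray a z s \<in> X" using star assms by auto
  have "0 \<le> K" using k_bound[OF assms(1) w] norm_ge_zero order_trans by blast
  then show ?thesis unfolding norm_mult using k_bound[OF assms(1) w] assms(2)[OF w]
    by (intro mult_right_mono mult_mono) auto
qed

lemma integrand_integrable:
  assumes z: "z \<in> X" and f: "continuous_on X f" "\<And>w. w \<in> X \<Longrightarrow> norm (f w) \<le> B"
  shows "(\<lambda>s. k z (ray a z s) * f (ray a z s) * (z - a)) integrable_on {0<..<1}"
proof (rule measurable_bounded_by_integrable_imp_integrable)
  show "(\<lambda>s. k z (ray a z s) * f (ray a z s) * (z - a)) \<in> borel_measurable (lebesgue_on {0<..<1::real})"
  proof (intro continuous_imp_measurable_on_sets_lebesgue continuous_intros)
    have *: "(\<lambda>s. a + of_real s * (z - a)) ` {0<..<1} \<subseteq> X" using star[OF z] by auto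
    show "continuous_on {0<..<1} (\<lambda>s. k z (ray a z s))"
      by (rule continuous_on_compose2[OF k_cont[OF z] _ *]) (intro continuous_intros)
    show "continuous_on {0<..<1} (\<lambda>s. f (ray a z s))"
      by (rule continuous_on_compose2[OF f(1) _ *]) (intro continuous_intros)
  qed auto
  show "(\<lambda>_. K * B * norm (z - a)) integrable_on {0<..<1::real}"
    unfolding integrable_on_Icc_iff_Ioo[symmetric] by (rule integrable_const_ivl)
  show "norm (k z (ray a z s) * f (ray a z s) * (z - a)) \<le> K * B * norm (z - a)"
    if "s \<in> {0<..<1}" for s :: real
    by (rule integrand_bound[OF z f(2) that])
qed simp

text \<open>
  The factorial gain of Picard iteration: along the segment \<open>\<bar>w - a\<bar> = s \<bar>z - a\<bar>\<close>, and integrating \<open>s\<^sup>n\<close>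
  produces the factor \<open>1 / (n + 1)\<close>.
\<close>

lemma volterra_contraction:
  assumes z: "z \<in> X"
    and p: "continuous_on X p" "\<And>w. w \<in> X \<Longrightarrow> norm (p w) \<le> P"
    and q: "continuous_on X q" "\<And>w. w \<in> X \<Longrightarrow> norm (q w) \<le> Q"
    and pq: "\<And>w. w \<in> X \<Longrightarrow> norm (p w - q w) \<le> B * (K * norm (w - a)) ^ n / fact n"
  shows "norm (volterra a k p z - volterra a k q z) \<le> B * (K * norm (z - a)) ^ Suc n / fact (Suc n)"
proof -
  let ?w = "\<lambda>s. a + of_real s * (z - a)"
  let ?C = "B * (K * norm (z - a)) ^ Suc n / fact n"
  note i = integrand_integrable[OF z p] integrand_integrable[OF z q]
  have Cs: "((\<lambda>s. ?C * s ^ n) has_integral ?C * (1 / real (Suc n))) {0<..<1}"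
    unfolding has_integral_Icc_iff_Ioo[symmetric]
  proof (intro has_integral_mult_right)
    have d: "((\<lambda>s. s ^ Suc n / real (Suc n)) has_real_derivative s ^ n) (at s)" for s
      by (intro derivative_eq_intros) auto
    have "((\<lambda>s. s ^ n) has_integral (1 ^ Suc n / real (Suc n) - 0 ^ Suc n / real (Suc n))) {0..1}"
      by (intro fundamental_theorem_of_calculus)
         (auto intro!: has_field_derivative_at_within[OF d] simp: has_real_derivative_iff_has_vector_derivative[symmetric] simp del: power_Suc of_nat_Suc)
    then show "((\<lambda>s. s ^ n) has_integral 1 / real (Suc n)) {0..1}" by simp
  qed
  have eq: "volterra a k p z - volterra a k q z
      = integral {0<..<1} (\<lambda>s. k z (?w s) * p (?w s) * (z - a) - k z (?w s) * q (?w s) * (z - a))"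
    unfolding volterra_def by (rule integral_diff[symmetric, OF i])
  have "norm (volterra a k p z - volterra a k q z) \<le> integral {0<..<1} (\<lambda>s. ?C * s ^ n)"
    unfolding eq
  proof (rule integral_norm_bound_integral)
    fix s :: real assume s: "s \<in> {0<..<1}"
    then have w: "?w s \<in> X" using star[OF z] by auto
    have "0 \<le> K" using k_bound[OF z w] norm_ge_zero order_trans by blast
    have eq: "k z (?w s) * p (?w s) * (z - a) - k z (?w s) * q (?w s) * (z - a) = k z (?w s) * (p (?w s) - q (?w s)) * (z - a)"
      by (simp add: algebra_simps)
    have nw: "norm (?w s - a) = s * norm (z - a)" using s by (simp add: norm_mult)
    have "norm (k z (?w s) * p (?w s) * (z - a) - k z (?w s) * q (?w s) * (z - a))
        \<le> K * (B * (K * norm (?w s - a)) ^ n / fact n) * norm (z - a)"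
      unfolding eq norm_mult using k_bound[OF z w] pq[OF w] \<open>0 \<le> K\<close> by (intro mult_right_mono mult_mono) auto
    also have "\<dots> = ?C * s ^ n"
      unfolding nw by (simp add: power_mult_distrib mult_ac)
    finally show "norm (k z (?w s) * p (?w s) * (z - a) - k z (?w s) * q (?w s) * (z - a)) \<le> ?C * s ^ n" .
  next
    show "(\<lambda>s. ?C * s ^ n) integrable_on {0<..<1}" using Cs by (rule has_integral_integrable)
  qed (rule integrable_diff[OF i])
  also have "\<dots> = ?C * (1 / real (Suc n))" using Cs by (rule integral_unique)
  also have "\<dots> = B * (K * norm (z - a)) ^ Suc n / fact (Suc n)"
    unfolding fact_Suc by (simp only: times_divide_times_eq mult_1_right mult.commute)
  finally show ?thesis .
qed

text \<open>
  The difference of two solutions is a fixed point of the homogeneous operator, so the contraction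
  estimate applies to it any number of times.
\<close>

lemma volterra_unique:
  assumes u: "continuous_on X u" "\<And>w. w \<in> X \<Longrightarrow> norm (u w) \<le> P" "\<And>z. z \<in> X \<Longrightarrow> u z = g z + volterra a k u z"
    and v: "continuous_on X v" "\<And>w. w \<in> X \<Longrightarrow> norm (v w) \<le> Q" "\<And>z. z \<in> X \<Longrightarrow> v z = g z + volterra a k v z"
    and z: "z \<in> X"
  shows "u z = v z"
proof -
  have b: "\<forall>z\<in>X. norm (u z - v z) \<le> (P + Q) * (K * norm (z - a)) ^ n / fact n" for n
  proof (induction n)
    case 0
    show ?case
    proof
      fix w assume "w \<in> X"
      then show "norm (u w - v w) \<le> (P + Q) * (K * norm (w - a)) ^ 0 / fact 0"
        using u(2)[of w] v(2)[of w] norm_triangle_ineq4[of "u w" "v w"] by simp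
    qed
  next
    case (Suc n)
    show ?case
    proof
      fix w assume w: "w \<in> X"
      show "norm (u w - v w) \<le> (P + Q) * (K * norm (w - a)) ^ Suc n / fact (Suc n)"
        using volterra_contraction[OF w u(1,2) v(1,2), of "P + Q" n] Suc u(3)[OF w] v(3)[OF w] by simp
    qed
  qed
  have "(\<lambda>n. (P + Q) * ((K * norm (z - a)) ^ n / fact n)) \<longlonglongrightarrow> (P + Q) * 0"
    using summable_exp[of "K * norm (z - a)"]
    by (intro tendsto_mult tendsto_const summable_LIMSEQ_zero) (simp add: field_simps)
  then have "norm (u z - v z) \<le> (P + Q) * 0"
    by (rule LIMSEQ_le_const) (use b z in auto)
  then show ?thesis by simp
qed

end

locale holomorphic_volterra_kernel = volterra_kernel +
  fixes R :: real
  assumes open_X: "open X"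
    and k_hol1: "\<And>w. w \<in> X \<Longrightarrow> (\<lambda>z. k z w) holomorphic_on X"
    and k_hol2: "\<And>z. z \<in> X \<Longrightarrow> k z holomorphic_on X"
    and X_bound: "\<And>z. z \<in> X \<Longrightarrow> norm (z - a) \<le> R"
begin

lemma volterra_bound:
  assumes "continuous_on X f" "\<And>w. w \<in> X \<Longrightarrow> norm (f w) \<le> B" "z \<in> X"
  shows "norm (volterra a k f z) \<le> K * B * norm (z - a)"
proof -
  have 0: "volterra a k (\<lambda>_. 0) z = 0" by (simp add: volterra_def)
  have "norm (volterra a k f z - volterra a k (\<lambda>_. 0) z) \<le> B * (K * norm (z - a)) ^ Suc 0 / fact (Suc 0)"
    by (rule volterra_contraction[OF assms(3) assms(1,2), where Q = 0]) (use assms(2) in auto)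
  then show ?thesis unfolding 0 by (simp add: mult_ac)
qed

lemma volterra_holomorphic:
  assumes f: "f holomorphic_on X" "\<And>w. w \<in> X \<Longrightarrow> norm (f w) \<le> B"
  shows "volterra a k f holomorphic_on X"
    and "z \<in> X \<Longrightarrow> (volterra a k f has_field_derivative integral {0<..<1} (\<lambda>s. 
      deriv (\<lambda>z. k z (ray a z s) * f (ray a z s) * (z - a)) z)) (at z)"
proof -
  show *: "(volterra a k f has_field_derivative integral {0<..<1} (\<lambda>s. 
      deriv (\<lambda>z. k z (ray a z s) * f (ray a z s) * (z - a)) z)) (at z)" if z: "z \<in> X" for z
    unfolding volterra_def[abs_def]
  proof (rule has_field_derivative_integral_bounded[OF open_X])
    have "(\<lambda>_. 1 :: real) integrable_on {0..1::real}" by (rule integrable_const_ivl)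
    then show "(\<lambda>_. 1 :: real) integrable_on {0<..<1::real}"
      unfolding integrable_on_Icc_iff_Ioo .
    show "(\<lambda>z. k z (ray a z s) * f (ray a z s) * (z - a)) holomorphic_on X"
      if "s \<in> {0<..<1}" for s
    proof (intro holomorphic_intros)
      have *: "(\<lambda>z. a + of_real s * (z - a)) ` X \<subseteq> X" using star that by auto
      have hc: "(\<lambda>z. F (ray a z s)) holomorphic_on X" if "F holomorphic_on X" for F
        using holomorphic_on_compose_gen[OF _ that *, unfolded o_def] by (simp add: holomorphic_intros)
      show "(\<lambda>z. f (ray a z s)) holomorphic_on X" by (rule hc[OF f(1)])
      show "(\<lambda>z. k z (ray a z s)) holomorphic_on X"
        by (rule holomorphic_on_diagonal[OF open_X, where B = K])
           (use hc k_hol1 k_hol2 k_bound * in auto)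
    qed
    show "(\<lambda>s. k z (ray a z s) * f (ray a z s) * (z - a)) integrable_on {0<..<1}"
      if "z \<in> X" for z
      using integrand_integrable[OF that holomorphic_on_imp_continuous_on[OF f(1)] f(2)] .
    show "norm (k z (ray a z s) * f (ray a z s) * (z - a)) \<le> \<bar>K\<bar> * \<bar>B\<bar> * \<bar>R\<bar>"
      if "z \<in> X" "s \<in> {0<..<1}" for z s
    proof -
      have "K * B * norm (z - a) \<le> \<bar>K * B * norm (z - a)\<bar>" by simp
      also have "\<dots> \<le> \<bar>K\<bar> * \<bar>B\<bar> * \<bar>R\<bar>"
        unfolding abs_mult using X_bound[OF that(1)] by (intro mult_left_mono) auto
      finally have le: "K * B * norm (z - a) \<le> \<bar>K\<bar> * \<bar>B\<bar> * \<bar>R\<bar>" .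
      show ?thesis by (rule order_trans[OF integrand_bound[OF that(1) f(2) that(2)] le])
    qed
  qed (rule z)
  then show "volterra a k f holomorphic_on X" using holomorphic_on_open[OF open_X] by blast
qed

text \<open>
  The Picard iterates form a series dominated by the exponential series of \<open>K R\<close>. Their uniform limit is
  holomorphic, and it solves the equation since the operator is continuous for the uniform norm.
\<close>

lemma volterra_solution_exists:
  assumes g: "g holomorphic_on X" "\<And>w. w \<in> X \<Longrightarrow> norm (g w) \<le> B"
  shows "\<exists>U M. U holomorphic_on X \<and> (\<forall>z\<in>X. norm (U z) \<le> M) \<and> (\<forall>z\<in>X. U z = g z + volterra a k U z)"
proof (cases "X = {}")
  case True then show ?thesis by (auto intro!: exI[of _ "\<lambda>_. 0"])
next
  case False
  then obtain z1 where z1: "z1 \<in> X" by auto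
  have K0: "0 \<le> K" using k_bound[OF z1 z1] norm_ge_zero order_trans by blast
  have R0: "0 \<le> R" using X_bound[OF z1] norm_ge_zero order_trans by blast
  have B0: "0 \<le> B" using g(2)[OF z1] norm_ge_zero order_trans by blast
  define p where "p n = ((\<lambda>f z. g z + volterra a k f z) ^^ n) (\<lambda>_. 0)" for n
  have p0: "p 0 = (\<lambda>_. 0)" and pS: "p (Suc n) = (\<lambda>z. g z + volterra a k (p n) z)" for n
    by (simp_all add: p_def)
  have p_hol: "p n holomorphic_on X \<and> (\<exists>M. \<forall>z\<in>X. norm (p n z) \<le> M)" for n
  proof (induction n)
    case 0 show ?case by (auto simp: p0)
  next
    case (Suc n)
    then obtain M where M: "p n holomorphic_on X" "\<And>z. z \<in> X \<Longrightarrow> norm (p n z) \<le> M" by auto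
    have M0: "0 \<le> M" using M(2)[OF z1] norm_ge_zero order_trans by blast
    have "norm (p (Suc n) z) \<le> B + K * M * R" if z: "z \<in> X" for z
    proof -
      have "norm (p (Suc n) z) \<le> B + K * M * norm (z - a)"
        unfolding pS by (rule order_trans[OF norm_triangle_ineq])
          (rule add_mono[OF g(2)[OF z] volterra_bound[OF holomorphic_on_imp_continuous_on[OF M(1)] M(2) z]])
      also have "\<dots> \<le> B + K * M * R" using X_bound[OF z] K0 M0 by (intro add_left_mono mult_left_mono) auto
      finally show ?thesis .
    qed
    moreover have "p (Suc n) holomorphic_on X"
      unfolding pS using volterra_holomorphic(1)[OF M] g(1) by (intro holomorphic_intros)
    ultimately show ?case by blast
  qed
  have p_cont: "continuous_on X (p n)" for n using p_hol holomorphic_on_imp_continuous_on by blast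
  have diff: "\<forall>z\<in>X. norm (p (Suc n) z - p n z) \<le> B * (K * norm (z - a)) ^ n / fact n" for n
  proof (induction n)
    case 0 show ?case using g(2) by (simp add: pS p0 volterra_def)
  next
    case (Suc n)
    show ?case
    proof
      fix z assume z: "z \<in> X"
      obtain M M' where M: "\<And>z. z \<in> X \<Longrightarrow> norm (p (Suc n) z) \<le> M" "\<And>z. z \<in> X \<Longrightarrow> norm (p n z) \<le> M'"
        using p_hol by meson
      have "p (Suc (Suc n)) z - p (Suc n) z = volterra a k (p (Suc n)) z - volterra a k (p n) z"
        by (simp add: pS[of "Suc n"] pS[of n])
      then show "norm (p (Suc (Suc n)) z - p (Suc n) z) \<le> B * (K * norm (z - a)) ^ Suc n / fact (Suc n)"
        using volterra_contraction[OF z p_cont M(1) p_cont M(2)] Suc by simp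
    qed
  qed
  define U where "U z = (\<Sum>n. p (Suc n) z - p n z)" for z
  \<comment> \<open>The partial sums telescope to the iterates because the iteration starts at \<open>0\<close>.\<close>
  have "uniform_limit X (\<lambda>n z. \<Sum>i<n. p (Suc i) z - p i z) U sequentially"
    unfolding U_def
  proof (rule Weierstrass_m_test)
    show "norm (p (Suc n) z - p n z) \<le> B * ((K * R) ^ n / fact n)" if z: "z \<in> X" for n z
    proof -
      have "B * ((K * norm (z - a)) ^ n / fact n) \<le> B * ((K * R) ^ n / fact n)"
        using X_bound[OF z] K0 B0 by (intro mult_left_mono divide_right_mono power_mono) auto
      then show ?thesis using diff[of n] z by fastforce
    qed
    have "summable (\<lambda>n. (K * R) ^ n / fact n)"
      using summable_exp[of "K * R"] by (simp add: field_simps)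
    then show "summable (\<lambda>n. B * ((K * R) ^ n / fact n))" by (rule summable_mult)
  qed
  moreover have "(\<Sum>i<n. p (Suc i) z - p i z) = p n z" for n z
    by (induction n) (simp_all add: p0)
  ultimately have ul: "uniform_limit X p U sequentially" by simp
  have U_hol: "U holomorphic_on X"
  proof (rule holomorphic_uniform_sequence[OF open_X])
    show "p n holomorphic_on X" for n using p_hol by simp
    show "\<exists>r>0. cball x r \<subseteq> X \<and> uniform_limit (cball x r) p U sequentially" if "x \<in> X" for x
      using open_X that open_contains_cball uniform_limit_on_subset[OF ul] by metis
  qed
  have close: "\<exists>N. \<forall>n\<ge>N. \<forall>z\<in>X. norm (p n z - U z) < e" if "0 < e" for e
    using ul that unfolding uniform_limit_iff eventually_sequentially dist_norm by blast
  obtain N where N: "\<forall>n\<ge>N. \<forall>z\<in>X. norm (p n z - U z) < 1" using close[of 1] by auto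
  obtain M where M: "\<forall>z\<in>X. norm (p N z) \<le> M" using p_hol by blast
  have U_bd: "norm (U z) \<le> M + 1" if "z \<in> X" for z
  proof -
    have "norm (U z) \<le> norm (p N z) + norm (p N z - U z)"
      using norm_triangle_ineq4[of "p N z" "p N z - U z"] by simp
    then show ?thesis using N M that by fastforce
  qed
  have "U z = g z + volterra a k U z" if z: "z \<in> X" for z
  proof (rule LIMSEQ_unique)
    show "(\<lambda>n. p (Suc n) z) \<longlonglongrightarrow> U z"
      using tendsto_uniform_limitI[OF ul z] by (rule LIMSEQ_Suc)
    show "(\<lambda>n. p (Suc n) z) \<longlonglongrightarrow> g z + volterra a k U z"
      unfolding LIMSEQ_iff
    proof (intro allI impI)
      fix e :: real assume e: "0 < e"
      define e' where "e' = e / (K * R + 1)"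
      have KR: "0 \<le> K * R" using K0 R0 by simp
      have e': "0 < e'" using e KR by (simp add: e'_def)
      obtain N where N: "\<forall>n\<ge>N. \<forall>z\<in>X. norm (p n z - U z) < e'" using close[OF e'] by auto
      have "norm (p (Suc n) z - (g z + volterra a k U z)) < e" if n: "n \<ge> N" for n
      proof -
        obtain M' where M': "\<And>z. z \<in> X \<Longrightarrow> norm (p n z) \<le> M'" using p_hol by meson
        have "norm (volterra a k (p n) z - volterra a k U z) \<le> e' * (K * norm (z - a)) ^ Suc 0 / fact (Suc 0)"
          by (rule volterra_contraction[OF z p_cont M' holomorphic_on_imp_continuous_on[OF U_hol] U_bd])
             (use N n in \<open>auto intro: less_imp_le\<close>)
        also have "\<dots> \<le> e' * (K * R)" using X_bound[OF z] K0 e' by (auto intro!: mult_left_mono)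
        also have "\<dots> < e' * (K * R + 1)" using e' by simp
        also have "\<dots> = e" using KR by (simp add: e'_def)
        finally show ?thesis by (simp add: pS)
      qed
      then show "\<exists>no. \<forall>n\<ge>no. norm (p (Suc n) z - (g z + volterra a k U z)) < e" by blast
    qed
  qed
  then show ?thesis using U_hol U_bd by blast
qed

end

text \<open>
  For a kernel that ignores \<open>z\<close>, the operator produces a primitive. Differentiating under the integral
  gives the total derivative of \<open>s q(a + s (z - a))\<close> with respect to \<open>s\<close>, which vanishes at \<open>s = 0\<close>
  because \<open>q\<close> is bounded.
\<close>

lemma (in holomorphic_volterra_kernel) volterra_const_kernel_derivative:
  assumes q: "q holomorphic_on X" "\<And>w. w \<in> X \<Longrightarrow> norm (q w) \<le> B" and z: "z \<in> X"
  shows "(volterra a (\<lambda>_. q) (\<lambda>_. 1) has_field_derivative q z) (at z)"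
proof -
  interpret q: holomorphic_volterra_kernel a X "\<lambda>_. q" B R
  proof unfold_locales
    show "continuous_on X q" using q(1) by (rule holomorphic_on_imp_continuous_on)
    show "ray a z s \<in> X" if "z \<in> X" "0 < s" "s < 1" for z s using that by (rule star)
    show "norm (z - a) \<le> R" if "z \<in> X" for z using that by (rule X_bound)
    show "norm (q w) \<le> B" if "w \<in> X" for w using that by (rule q(2))
  qed (use open_X q(1) in simp_all)
  let ?w = "\<lambda>s. a + of_real s * (z - a)"
  have dq: "deriv (\<lambda>z. q (ray a z s) * 1 * (z - a)) z = q (?w s) + of_real s * (z - a) * deriv q (?w s)"
    and dr: "((\<lambda>s. of_real s * q (?w s)) has_vector_derivative (q (?w s) + of_real s * (z - a) * deriv q (?w s))) (at s)"
    if s: "s \<in> {0<..<1}" for s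
  proof -
    have w: "?w s \<in> X" using star z s by auto
    have d: "(q has_field_derivative deriv q (?w s)) (at (?w s))"
      using q(1) open_X w by (rule holomorphic_derivI)
    have "((\<lambda>z. q (ray a z s)) has_field_derivative deriv q (?w s) * of_real s) (at z)"
      by (rule DERIV_chain2[where f = q and g = "\<lambda>z. a + of_real s * (z - a)", OF d]) (auto intro!: derivative_eq_intros)
    then have "((\<lambda>z. q (ray a z s) * 1 * (z - a)) has_field_derivative
        q (?w s) + of_real s * (z - a) * deriv q (?w s)) (at z)"
      by (auto intro!: derivative_eq_intros simp: algebra_simps)
    then show "deriv (\<lambda>z. q (ray a z s) * 1 * (z - a)) z = q (?w s) + of_real s * (z - a) * deriv q (?w s)"
      by (rule DERIV_imp_deriv)
    have "((\<lambda>x. q (a + x * (z - a))) has_field_derivative deriv q (?w s) * (z - a)) (at (of_real s))"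
      by (rule DERIV_chain2[where f = q and g = "\<lambda>x. a + x * (z - a)", OF d]) (auto intro!: derivative_eq_intros)
    then have "((\<lambda>x. x * q (a + x * (z - a))) has_field_derivative
        (q (?w s) + of_real s * (z - a) * deriv q (?w s))) (at (of_real s))"
      by (auto intro!: derivative_eq_intros simp: algebra_simps)
    then show "((\<lambda>s. of_real s * q (?w s)) has_vector_derivative (q (?w s) + of_real s * (z - a) * deriv q (?w s))) (at s)"
      by (rule has_vector_derivative_real_field)
  qed
  have cont: "continuous_on {0..1} (\<lambda>s. of_real s * q (?w s))"
    unfolding continuous_on_eq_continuous_within
  proof
    fix s :: real assume s: "s \<in> {0..1}"
    consider "s = 0" | "s \<in> {0<..1}" using s by force
    then show "continuous (at s within {0..1}) (\<lambda>s. of_real s * q (?w s))"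
    proof cases
      case 1
      have "((\<lambda>s. of_real s * q (?w s)) \<longlongrightarrow> 0) (at 0 within {0..1})"
      proof (rule Lim_null_comparison[where g = "\<lambda>s. s * B"])
        have wX: "?w t \<in> X" if "t \<in> {0..1}" "t \<noteq> 0" for t
          using star[OF z, of t] z that by (cases "t = 1") auto
        show "\<forall>\<^sub>F t in at 0 within {0..1}. norm (of_real t * q (?w t)) \<le> t * B"
          unfolding eventually_at_filter
        proof (intro always_eventually allI impI)
          fix t :: real assume t: "t \<noteq> 0" "t \<in> {0..1}"
          show "norm (of_real t * q (?w t)) \<le> t * B"
            unfolding norm_mult norm_of_real using t q(2)[OF wX[OF t(2,1)]] by (simp add: mult_left_mono)
        qed
        show "((\<lambda>s. s * B) \<longlongrightarrow> 0) (at 0 within {0..1})" by (auto intro!: tendsto_eq_intros)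
      qed
      then show ?thesis unfolding 1 continuous_within by simp
    next
      case 2
      then have w: "?w s \<in> X" using star[OF z, of s] z by (cases "s = 1") auto
      have c: "isCont ?w s" by (intro continuous_intros)
      have "isCont q (?w s)" using q(1) open_X w holomorphic_on_imp_continuous_on continuous_on_eq_continuous_at by blast
      then have "isCont (\<lambda>s. q (?w s)) s" by (rule isCont_o2[OF c])
      then have "isCont (\<lambda>s. of_real s * q (?w s)) s" by (rule isCont_mult[rotated]) (intro continuous_intros)
      then show ?thesis by (rule continuous_at_imp_continuous_within)
    qed
  qed
  have "((\<lambda>s. q (?w s) + of_real s * (z - a) * deriv q (?w s)) has_integral of_real 1 * q (?w 1) - of_real 0 * q (?w 0)) {0..1}"
    by (rule fundamental_theorem_of_calculus_interior) (use cont dr in auto)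
  then have "((\<lambda>s. q (?w s) + of_real s * (z - a) * deriv q (?w s)) has_integral q z) {0<..<1}"
    unfolding has_integral_Icc_iff_Ioo by simp
  then have "((\<lambda>s. deriv (\<lambda>z. q (ray a z s) * 1 * (z - a)) z) has_integral q z) {0<..<1}"
    by (rule has_integral_eq[rotated]) (use dq in auto)
  then have "integral {0<..<1} (\<lambda>s. deriv (\<lambda>z. q (ray a z s) * 1 * (z - a)) z) = q z"
    by (rule integral_unique)
  then show ?thesis
    using q.volterra_holomorphic(2)[of "\<lambda>_. 1" 1 z] z by simp
qed

section \<open>The Sinc interpolation error as a contour integral\<close>

text \<open>
  The boundary of the rectangle \<open>[-L,L] \<times> [-y,y]\<close>. Integrals over it are kept as sums over the four sides,
  since the horizontal sides carry the main term and the vertical ones only an error that vanishes as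
  \<open>L \<rightarrow> \<infinity>\<close>.
\<close>

definition rect_sides :: "real \<Rightarrow> real \<Rightarrow> complex set" where
  "rect_sides y L = {z. \<bar>Re z\<bar> \<le> L \<and> \<bar>Im z\<bar> = y} \<union> {z. \<bar>Re z\<bar> = L \<and> \<bar>Im z\<bar> \<le> y}"

definition rect_integral :: "real \<Rightarrow> real \<Rightarrow> (complex \<Rightarrow> complex) \<Rightarrow> complex" where
  "rect_integral y L f =
    contour_integral (linepath (Complex (- L) (- y)) (Complex L (- y))) f +
    contour_integral (linepath (Complex L (- y)) (Complex L y)) f +
    contour_integral (linepath (Complex L y) (Complex (- L) y)) f +
    contour_integral (linepath (Complex (- L) y) (Complex (- L) (- y))) f"

lemma rect_segments:
  assumes "0 < y" "0 < L"
  shows "closed_segment (Complex (- L) (- y)) (Complex L (- y)) \<subseteq> rect_sides y L"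
    "closed_segment (Complex L (- y)) (Complex L y) \<subseteq> rect_sides y L"
    "closed_segment (Complex L y) (Complex (- L) y) \<subseteq> rect_sides y L"
    "closed_segment (Complex (- L) y) (Complex (- L) (- y)) \<subseteq> rect_sides y L"
  subgoal using assms by (subst closed_segment_same_Im) (auto simp: rect_sides_def closed_segment_eq_real_ivl)
  subgoal using assms by (subst closed_segment_same_Re) (auto simp: rect_sides_def closed_segment_eq_real_ivl)
  subgoal using assms by (subst closed_segment_same_Im) (auto simp: rect_sides_def closed_segment_eq_real_ivl)
  subgoal using assms by (subst closed_segment_same_Re) (auto simp: rect_sides_def closed_segment_eq_real_ivl)
  done

lemma contour_integral_rectpath:
  assumes y: "0 < y" "0 < L" and f: "continuous_on (rect_sides y L) f"
  shows "contour_integral (rectpath (Complex (- L) (- y)) (Complex L y)) f = rect_integral y L f"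
proof -
  have "f contour_integrable_on linepath (Complex (- L) (- y)) (Complex L (- y))"
    "f contour_integrable_on linepath (Complex L (- y)) (Complex L y)"
    "f contour_integrable_on linepath (Complex L y) (Complex (- L) y)"
    "f contour_integrable_on linepath (Complex (- L) y) (Complex (- L) (- y))"
    using rect_segments[OF y] continuous_on_subset[OF f] contour_integrable_continuous_linepath by blast+
  then show ?thesis by (simp add: rectpath_def rect_integral_def Let_def)
qed

text \<open>
  The weight \<open>1 / (1 + x\<^sup>2)\<close> is used as the measure of decay throughout because its primitive is bounded
  and explicit, uniformly in the length of the side.
\<close>

lemma norm_horizontal_integral_le:
  assumes pq: "p \<le> q" and f: "continuous_on (closed_segment (Complex p y) (Complex q y)) f"
    and bd: "\<And>x. x \<in> {p..q} \<Longrightarrow> norm (f (Complex x y)) \<le> B / (1 + x\<^sup>2)"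
  shows "norm (contour_integral (linepath (Complex p y) (Complex q y)) f) \<le> B * pi"
proof -
  have B0: "0 \<le> B"
  proof -
    have "0 \<le> B / (1 + p\<^sup>2)" by (rule order_trans[OF norm_ge_zero bd[of p]]) (use pq in simp)
    then show ?thesis using add_pos_nonneg[of 1 "p\<^sup>2"] by (simp add: zero_le_divide_iff)
  qed
  let ?w = "\<lambda>t. p + t * (q - p)"
  have l: "linepath (Complex p y) (Complex q y) t = Complex (?w t) y" for t
    by (simp add: linepath_def complex_eq_iff algebra_simps)
  have d: "Complex q y - Complex p y = of_real (q - p)" by (simp add: complex_eq_iff)
  have int: "f contour_integrable_on linepath (Complex p y) (Complex q y)"
    using f by (rule contour_integrable_continuous_linepath)
  have hi: "((\<lambda>t. f (Complex (?w t) y) * of_real (q - p)) has_integral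
      contour_integral (linepath (Complex p y) (Complex q y)) f) {0..1}"
    using has_contour_integral_integral[OF int] unfolding has_contour_integral_linepath l d .
  have rhs: "((\<lambda>t. B / (1 + (?w t)\<^sup>2) * (q - p)) has_integral (B * arctan (?w 1) - B * arctan (?w 0))) {0..1}"
  proof (rule fundamental_theorem_of_calculus)
    fix t :: real
    have "((\<lambda>t. B * arctan (?w t)) has_real_derivative B / (1 + (?w t)\<^sup>2) * (q - p)) (at t within {0..1})"
      by (auto intro!: derivative_eq_intros simp: field_simps)
    then show "((\<lambda>t. B * arctan (?w t)) has_vector_derivative B / (1 + (?w t)\<^sup>2) * (q - p)) (at t within {0..1})"
      by (simp add: has_real_derivative_iff_has_vector_derivative)
  qed simp
  have "norm (integral {0..1} (\<lambda>t. f (Complex (?w t) y) * of_real (q - p)))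
     \<le> integral {0..1} (\<lambda>t. B / (1 + (?w t)\<^sup>2) * (q - p))"
  proof (rule integral_norm_bound_integral)
    fix t :: real assume t: "t \<in> {0..1}"
    have "t * (q - p) \<le> 1 * (q - p)" using t pq by (intro mult_right_mono) auto
    then have "?w t \<in> {p..q}" using t pq by auto
    from bd[OF this] show "norm (f (Complex (?w t) y) * of_real (q - p)) \<le> B / (1 + (?w t)\<^sup>2) * (q - p)"
      unfolding norm_mult norm_of_real using pq mult_right_mono[of _ _ "q - p"] by fastforce
  qed (use hi rhs in \<open>blast intro: has_integral_integrable\<close>)+
  then have "norm (contour_integral (linepath (Complex p y) (Complex q y)) f) \<le> B * arctan q - B * arctan p"
    unfolding integral_unique[OF hi] integral_unique[OF rhs] by simp
  also have "\<dots> = B * (arctan q - arctan p)" by (simp add: algebra_simps)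
  also have "\<dots> \<le> B * pi"
    using B0 arctan_ubound[of q] arctan_lbound[of p] by (intro mult_left_mono) auto
  finally show ?thesis .
qed

lemma norm_rect_integral_le:
  assumes y: "0 < y" "0 < L" and f: "continuous_on (rect_sides y L) f"
    and H: "\<And>z. \<bar>Im z\<bar> = y \<Longrightarrow> \<bar>Re z\<bar> \<le> L \<Longrightarrow> norm (f z) \<le> B / (1 + (Re z)\<^sup>2)"
    and V: "\<And>z. \<bar>Re z\<bar> = L \<Longrightarrow> \<bar>Im z\<bar> \<le> y \<Longrightarrow> norm (f z) \<le> W" and "0 \<le> W"
  shows "norm (rect_integral y L f) \<le> 2 * pi * B + 4 * y * W"
proof -
  note c = rect_segments[OF y, THEN continuous_on_subset[OF f]]
  have 1: "norm (contour_integral (linepath (Complex (- L) (- y)) (Complex L (- y))) f) \<le> B * pi"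
    by (rule norm_horizontal_integral_le[OF _ c(1)]) (use H[of "Complex _ (- y)"] y in auto)
  have c3: "continuous_on (closed_segment (Complex (- L) y) (Complex L y)) f"
    using c(3) by (simp add: closed_segment_commute)
  have 3: "norm (contour_integral (linepath (Complex L y) (Complex (- L) y)) f) \<le> B * pi"
    unfolding contour_integral_reverse_linepath[OF c(3)] norm_minus_cancel
    by (rule norm_horizontal_integral_le[OF _ c3]) (use H[of "Complex _ y"] y in auto)
  have 2: "norm (contour_integral (linepath (Complex L (- y)) (Complex L y)) f) \<le> W * norm (Complex L y - Complex L (- y))"
    by (rule contour_integral_bound_linepath[OF contour_integrable_continuous_linepath[OF c(2)] \<open>0 \<le> W\<close>])
       (use V y in \<open>auto simp: closed_segment_same_Re closed_segment_eq_real_ivl\<close>)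
  have 4: "norm (contour_integral (linepath (Complex (- L) y) (Complex (- L) (- y))) f)
      \<le> W * norm (Complex (- L) (- y) - Complex (- L) y)"
    by (rule contour_integral_bound_linepath[OF contour_integrable_continuous_linepath[OF c(4)] \<open>0 \<le> W\<close>])
       (use V y in \<open>auto simp: closed_segment_same_Re closed_segment_eq_real_ivl\<close>)
  have n: "norm (Complex L y - Complex L (- y)) = 2 * y" "norm (Complex (- L) (- y) - Complex (- L) y) = 2 * y"
    using y by (simp_all add: cmod_def real_sqrt_mult)
  have "norm (rect_integral y L f) \<le> B * pi + W * (2 * y) + B * pi + W * (2 * y)"
    unfolding rect_integral_def using 1 2 3 4 unfolding n
    by (intro norm_triangle_le add_mono order_trans[OF norm_triangle_ineq])
  then show ?thesis by (simp add: algebra_simps)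
qed

lemma has_field_derivative_Cauchy_rect_integral:
  assumes y: "0 < y" "0 < L" and G: "continuous_on (rect_sides y L) G" and w: "w \<notin> rect_sides y L"
  shows "((\<lambda>w. rect_integral y L (\<lambda>u. G u / (u - w))) has_field_derivative
      rect_integral y L (\<lambda>u. G u / (u - w)\<^sup>2)) (at w)"
proof -
  have seg: "((\<lambda>w. contour_integral (linepath p q) (\<lambda>u. G u / (u - w))) has_field_derivative
      contour_integral (linepath p q) (\<lambda>u. G u / (u - w)\<^sup>2)) (at w)"
    if sub: "closed_segment p q \<subseteq> rect_sides y L" for p q
  proof -
    have c: "continuous_on (closed_segment p q) G" using continuous_on_subset[OF G sub] .
    have "((\<lambda>w. contour_integral (linepath p q) (\<lambda>u. G u / (u - w))) has_field_derivative
      (of_nat 1 * contour_integral (linepath p q) (\<lambda>u. G u / (u - w) ^ Suc 1))) (at w)"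
    proof (rule Cauchy_next_derivative(2)[where S = UNIV and B = "norm (q - p)"])
      show "((\<lambda>u. G u / (u - w) ^ 1) has_contour_integral contour_integral (linepath p q) (\<lambda>u. G u / (u - w))) (linepath p q)"
        if "w \<in> UNIV - path_image (linepath p q)" for w
        using that c by (auto intro!: has_contour_integral_integral contour_integrable_continuous_linepath continuous_intros)
    qed (use c w sub in auto)
    then show ?thesis by (simp add: power2_eq_square)
  qed
  show ?thesis unfolding rect_integral_def by (intro DERIV_add seg rect_segments y)
qed

lemma norm_sin_horizontal_ge: "sinh \<bar>Im z\<bar> \<le> norm (sin z)"
proof (rule power2_le_imp_le)
  have "(sinh \<bar>Im z\<bar>)\<^sup>2 = (sinh (Im z))\<^sup>2" by (simp add: abs_if)
  also have "\<dots> = (exp (2 * Im z) + inverse (exp (2 * Im z)) - 2) / 4"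
  proof -
    have "exp (Im z) * exp (- Im z) = 1" by (simp flip: exp_add)
    moreover have "exp (2 * Im z) = (exp (Im z))\<^sup>2" "inverse (exp (2 * Im z)) = (exp (- Im z))\<^sup>2"
      by (simp_all flip: exp_double exp_minus)
    ultimately show ?thesis by (simp add: sinh_def power2_eq_square algebra_simps)
  qed
  also have "\<dots> \<le> (norm (sin z))\<^sup>2" unfolding norm_sin_squared by simp
  finally show "(sinh \<bar>Im z\<bar>)\<^sup>2 \<le> (norm (sin z))\<^sup>2" .
qed simp

lemma norm_sin_vertical_ge:
  assumes "cos (2 * Re z) = -1" shows "1 \<le> norm (sin z)"
proof (rule power2_le_imp_le)
  define e where "e = exp (2 * Im z)"
  have e: "0 < e" by (simp add: e_def)
  have "0 \<le> (e - 1)\<^sup>2 / e" using e by simp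
  then have "2 \<le> e + inverse e" using e by (simp add: power2_eq_square field_simps)
  then show "1\<^sup>2 \<le> (norm (sin z))\<^sup>2" unfolding norm_sin_squared assms by (simp add: e_def)
qed simp

lemma sincS_node: "0 < h \<Longrightarrow> sincS j h (of_int i * h) = (if i = j then 1 else 0)"
proof -
  assume h: "0 < h"
  have "pi * (of_int i * h - of_int j * h) / h = of_int (i - j) * pi" using h by (simp add: field_simps)
  then have "i \<noteq> j \<Longrightarrow> sin (pi * (of_int i * h - of_int j * h) / h) = 0" by (simp only: sin_times_pi_eq_0 Ints_of_int)
  then show ?thesis using h by (simp add: sincS_def)
qed

lemma sincS_le_1: "\<bar>sincS j h x\<bar> \<le> 1"
proof -
  have "\<bar>sin v / v\<bar> \<le> 1" for v :: real using abs_sin_x_le_abs_x[of v] by (auto simp: abs_divide divide_le_eq_1)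
  from this[of "pi * (x - of_int j * h) / h"] show ?thesis by (simp add: sincS_def)
qed

text \<open>
  The truncated cardinal series, and its counterpart in which the Sinc functions are replaced by their
  primitives.
\<close>

abbreviation sinc_sum :: "real \<Rightarrow> nat \<Rightarrow> (complex \<Rightarrow> complex) \<Rightarrow> real \<Rightarrow> complex" where
  "sinc_sum h N F x \<equiv> \<Sum>j=-int N..int N. F (of_real (of_int j * h)) * of_real (sincS j h x)"

abbreviation sincJ_sum :: "real \<Rightarrow> nat \<Rightarrow> (complex \<Rightarrow> complex) \<Rightarrow> real \<Rightarrow> complex" where
  "sincJ_sum h N F x \<equiv> \<Sum>j=-int N..int N. F (of_real (of_int j * h)) * of_real (sincJ j h x)"

text \<open>
  Half-way between two zeros of \<open>sin (\<pi> z / h)\<close>: on vertical lines through such points the sine has modulus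
  at least \<open>1\<close>.
\<close>

definition half_node :: "real \<Rightarrow> nat \<Rightarrow> real" where "half_node h M = (real M + 1 / 2) * h"

lemma sin_scaled_zero_iff:
  fixes z :: complex
  assumes h: "0 < h"
  shows "sin (of_real (pi / h) * z) = 0 \<longleftrightarrow> (\<exists>n::int. z = of_real (of_int n * h))"
proof -
  have "of_real (pi / h) * z = of_real (of_int n * pi) \<longleftrightarrow> z = of_real (of_int n * h)" for n :: int
  proof -
    have "of_real (pi / h) \<noteq> (0::complex)" using h by simp
    moreover have "complex_of_real (of_int n * pi) = of_real (pi / h) * of_real (of_int n * h)"
      unfolding of_real_mult[symmetric] using h by simp
    ultimately show ?thesis by (metis mult_left_cancel)
  qed
  then show ?thesis unfolding sin_eq_0 by simp
qed

lemma sin_nonzero_rect_sides: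
  assumes h: "0 < h" "0 < y" and z: "z \<in> rect_sides y (half_node h M)"
  shows "sin (of_real (pi / h) * z) \<noteq> 0"
proof
  assume "sin (of_real (pi / h) * z) = 0"
  then obtain n :: int where n: "z = of_real (of_int n * h)" using sin_scaled_zero_iff[OF h(1)] by blast
  have "\<bar>of_int n * h\<bar> = (real M + 1 / 2) * h" using z h n by (auto simp: rect_sides_def half_node_def)
  then have "\<bar>real_of_int n\<bar> = real M + 1 / 2" using h by (simp add: abs_mult)
  then have "2 * \<bar>n\<bar> = 2 * int M + 1" by linarith
  then show False by presburger
qed

text \<open>
  Residue theorem for \<open>F(z) / (sin (\<pi> z / h) (z - x))\<close>. The pole at \<open>x\<close> yields \<open>F(x)\<close>, and the zeros \<open>j h\<close> of
  the sine yield the terms of the cardinal series. Multiplying by \<open>sin (\<pi> x / h)\<close> makes the formula valid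
  also when \<open>x\<close> is itself a node, where both sides vanish.
\<close>

lemma sinc_residue_formula:
  assumes h: "0 < h" and y: "0 < y" "y < d" and F: "F holomorphic_on strip d" and x: "\<bar>x\<bar> < half_node h M"
  shows "of_real (sin (pi * x / h)) *
      rect_integral y (half_node h M) (\<lambda>z. F z / sin (of_real (pi / h) * z) / (z - of_real x))
    = 2 * of_real pi * \<i> * (F (of_real x) - sinc_sum h M F x)"
proof (cases "\<exists>i::int. x = of_int i * h")
  case True
  then obtain i :: int where i: "x = of_int i * h" by blast
  have iM: "i \<in> {-int M..int M}"
  proof -
    have "\<bar>of_int i * h\<bar> < (real M + 1 / 2) * h" using x h by (simp add: i half_node_def)
    then have "\<bar>real_of_int i\<bar> < real M + 1 / 2" using h by (simp add: abs_mult)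
    then have "2 * \<bar>i\<bar> < 2 * int M + 1" by linarith
    then show ?thesis by auto
  qed
  have "pi * x / h = of_int i * pi" using h by (simp add: i)
  then have "sin (pi * x / h) = 0" by (simp only: sin_times_pi_eq_0 Ints_of_int)
  moreover have "sinc_sum h M F x =
      (\<Sum>j=-int M..int M. if i = j then F (of_real (of_int j * h)) else 0)"
    unfolding i by (intro sum.cong) (simp_all add: sincS_node[OF h])
  ultimately show ?thesis using iM by (simp add: i)
next
  case False
  define s where "s z = sin (complex_of_real (pi / h) * z)" for z
  define f where "f z = F z / s z / (z - of_real x)" for z
  define nodes where "nodes = (\<lambda>j. complex_of_real (of_int j * h)) ` {-int M..int M}"
  \<comment> \<open>Wide enough to contain the contour, yet free of the next zeros \<open>\<plusminus>(M + 1) h\<close> of the sine.\<close>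
  define S where "S = strip d \<inter> {z. \<bar>Re z\<bar> < (real M + 1) * h}"
  have S_eq: "S = {z. Im z < d} \<inter> {z. - d < Im z} \<inter> {z. Re z < (real M + 1) * h} \<inter> {z. - ((real M + 1) * h) < Re z}"
    by (auto simp: S_def strip_def)
  have openS: "open S" unfolding S_eq
    by (intro open_Int open_halfspace_Im_lt open_halfspace_Im_gt open_halfspace_Re_lt open_halfspace_Re_gt)
  have "convex S" unfolding S_eq
    by (intro convex_Int convex_halfspace_Im_lt convex_halfspace_Im_gt convex_halfspace_Re_lt convex_halfspace_Re_gt)
  then have connS: "connected S" by (rule convex_connected)
  have L: "0 < half_node h M" using h by (simp add: half_node_def)
  have midS: "half_node h M < (real M + 1) * h" using h by (simp add: half_node_def)
  have zero: "z \<in> nodes" if z: "z \<in> S" "s z = 0" for z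
  proof -
    obtain n :: int where n: "z = of_real (of_int n * h)"
      using z(2) sin_scaled_zero_iff[OF h] unfolding s_def by blast
    have "\<bar>of_int n * h\<bar> < (real M + 1) * h" using z(1) n by (simp add: S_def)
    then have "\<bar>real_of_int n\<bar> < real M + 1" using h by (simp add: abs_mult)
    then have "\<bar>n\<bar> \<le> int M" by linarith
    then show ?thesis unfolding nodes_def n by (intro imageI) auto
  qed
  have xn: "of_real x \<notin> nodes" using False unfolding nodes_def by (auto simp del: of_real_mult of_real_of_int_eq)
  have nodeS: "nodes \<subseteq> S"
  proof
    fix z assume "z \<in> nodes"
    then obtain j where j: "z = of_real (of_int j * h)" "j \<in> {-int M..int M}" unfolding nodes_def by blast
    have "\<bar>real_of_int j\<bar> \<le> real M" using j(2) by auto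
    then have "\<bar>of_int j * h\<bar> \<le> real M * h" using h by (simp add: abs_mult)
    also have "\<dots> < (real M + 1) * h" using h by simp
    finally show "z \<in> S" using j y by (simp add: S_def strip_def)
  qed
  have xS: "of_real x \<in> S" using x midS y by (simp add: S_def strip_def)
  have fin: "finite nodes" by (simp add: nodes_def)
  have s_hol: "s holomorphic_on A" for A unfolding s_def[abs_def] by (intro holomorphic_intros)
  have F_hol: "F holomorphic_on A" if "A \<subseteq> S" for A
    using F holomorphic_on_subset that unfolding S_def by blast
  have f_hol: "f holomorphic_on S - insert (of_real x) nodes"
    unfolding f_def[abs_def] by (intro holomorphic_intros F_hol s_hol) (use zero in auto)
  have sub: "rect_sides y (half_node h M) \<subseteq> S - insert (of_real x) nodes"
  proof
    fix z assume z: "z \<in> rect_sides y (half_node h M)"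
    have "z \<in> S" using z midS y by (auto simp: rect_sides_def S_def strip_def)
    moreover have "s z \<noteq> 0" unfolding s_def by (rule sin_nonzero_rect_sides[OF h y(1) z])
    moreover have "s z = 0" if "z \<in> nodes" using that sin_scaled_zero_iff[OF h] by (auto simp: nodes_def s_def)
    moreover have "z \<noteq> of_real x" using z x y by (auto simp: rect_sides_def)
    ultimately show "z \<in> S - insert (of_real x) nodes" by auto
  qed
  let ?R = "rectpath (Complex (- half_node h M) (- y)) (Complex (half_node h M) y)"
  have pathR: "path_image ?R \<subseteq> rect_sides y (half_node h M)"
    using L y by (subst path_image_rectpath) (auto simp: rect_sides_def)
  have "contour_integral ?R f = 2 * pi * \<i> * (\<Sum>p\<in>insert (of_real x) nodes. winding_number ?R p * residue f p)"
  proof (rule Residue_theorem[OF openS connS _ f_hol])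
    show "path_image ?R \<subseteq> S - insert (of_real x) nodes" using pathR sub by blast
    show "\<forall>z. z \<notin> S \<longrightarrow> winding_number ?R z = 0"
    proof (intro allI impI)
      fix z assume "z \<notin> S"
      then have "z \<notin> cbox (Complex (- half_node h M) (- y)) (Complex (half_node h M) y)"
        using y midS by (auto simp: S_def strip_def in_cbox_complex_iff)
      then show "winding_number ?R z = 0" using L y by (intro winding_number_rectpath_outside) auto
    qed
  qed (use fin in auto)
  also have "(\<Sum>p\<in>insert (of_real x) nodes. winding_number ?R p * residue f p) = (\<Sum>p\<in>insert (of_real x) nodes. residue f p)"
  proof (intro sum.cong refl)
    fix p assume p: "p \<in> insert (of_real x) nodes"
    have "\<exists>t. p = of_real t \<and> \<bar>t\<bar> < half_node h M"
    proof (cases "p = of_real x")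
      case True then show ?thesis using x by blast
    next
      case False
      then obtain j where j: "p = of_real (of_int j * h)" "j \<in> {-int M..int M}" using p unfolding nodes_def by blast
      have "\<bar>real_of_int j\<bar> \<le> real M" using j(2) by auto
      then have "\<bar>of_int j * h\<bar> \<le> real M * h" using h by (simp add: abs_mult)
      also have "\<dots> < half_node h M" using h by (simp add: half_node_def)
      finally show ?thesis using j by blast
    qed
    then have "p \<in> box (Complex (- half_node h M) (- y)) (Complex (half_node h M) y)"
      using y by (auto simp: in_box_complex_iff)
    then show "winding_number ?R p * residue f p = residue f p" by (simp add: winding_number_rectpath)
  qed
  also have "\<dots> = residue f (of_real x) + (\<Sum>p\<in>nodes. residue f p)" using fin xn by simp
  also have "residue f (of_real x) = F (of_real x) / s (of_real x)"
    unfolding f_def[abs_def]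
  proof (rule residue_simple)
    show "open (S - nodes)" using openS fin by (intro open_Diff finite_imp_closed)
    show "(\<lambda>w. F w / s w) holomorphic_on S - nodes"
      by (intro holomorphic_intros F_hol s_hol) (use zero in auto)
  qed (use xS xn in auto)
  also have "(\<Sum>p\<in>nodes. residue f p) =
    (\<Sum>j=-int M..int M. F (of_real (of_int j * h)) / (of_real (of_int j * h) - of_real x) * of_real (h / pi * cos (pi * of_int j)))"
    unfolding nodes_def
  proof (subst sum.reindex)
    show "inj_on (\<lambda>j::int. complex_of_real (of_int j * h)) {- int M..int M}"
      using h by (intro inj_onI) simp
    show "sum (residue f \<circ> (\<lambda>j::int. complex_of_real (of_int j * h))) {- int M..int M} =
      (\<Sum>j=-int M..int M. F (of_real (of_int j * h)) / (of_real (of_int j * h) - of_real x) * of_real (h / pi * cos (pi * of_int j)))"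
    proof (intro sum.cong refl)
      fix j assume j: "j \<in> {- int M..int M}"
      define p where "p = complex_of_real (of_int j * h)"
      have pn: "p \<in> nodes" using j unfolding nodes_def p_def by (intro imageI)
      have px: "p \<noteq> of_real x" using xn pn by auto
      have sp: "s p = 0" unfolding s_def sin_scaled_zero_iff[OF h] p_def by blast
      define c where "c = complex_of_real (pi / h * cos (pi * of_int j))"
      have c2: "cos (pi * of_int j) * cos (pi * of_int j) = (1::real)"
        using sin_cos_squared_add[of "pi * of_int j"] by (simp add: power2_eq_square)
      have cp: "complex_of_real (pi / h) * p = of_real (pi * of_int j)"
        unfolding p_def of_real_mult[symmetric] using h by simp
      have "(s has_field_derivative of_real (pi / h) * cos (of_real (pi / h) * p)) (at p)"
        unfolding s_def[abs_def] using h by (auto intro!: derivative_eq_intros)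
      then have ds: "(s has_field_derivative c) (at p)"
        unfolding cp c_def cos_of_real of_real_mult[symmetric] .
      have c0: "c \<noteq> 0" using c2 h unfolding c_def by auto
      have ic: "inverse c = of_real (h / pi * cos (pi * of_int j))"
      proof -
        have "c * of_real (h / pi * cos (pi * of_int j)) = of_real (cos (pi * of_int j) * cos (pi * of_int j))"
          unfolding c_def of_real_mult[symmetric] using h by simp
        then show ?thesis unfolding c2 using c0 by (simp add: field_simps)
      qed
      have "((\<lambda>z. (s z - s p) / (z - p)) \<longlongrightarrow> c) (at p)"
        using ds by (simp add: has_field_derivative_iff)
      then have "((\<lambda>z. inverse ((s z - s p) / (z - p))) \<longlongrightarrow> inverse c) (at p)"
        using c0 by (rule tendsto_inverse)
      then have 1: "((\<lambda>z. (z - p) / s z) \<longlongrightarrow> inverse c) (at p)" by (simp add: sp)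
      have "F holomorphic_on S" by (rule F_hol) simp
      then have "isCont F p"
        using openS nodeS pn holomorphic_on_imp_continuous_on continuous_on_eq_continuous_at by blast
      then have "((\<lambda>z. F z / (z - of_real x)) \<longlongrightarrow> F p / (p - of_real x)) (at p)"
        using px by (auto intro!: tendsto_eq_intros simp: isCont_def)
      from tendsto_mult[OF this 1] have lim: "((\<lambda>z. f z * (z - p)) \<longlongrightarrow> F p / (p - of_real x) * inverse c) (at p)"
        by (simp add: f_def field_simps)
      have "residue f p = F p / (p - of_real x) * inverse c"
      proof (rule residue_simple'[OF _ _ _ lim])
        show "open (S - (insert (of_real x) nodes - {p}))" using openS fin by (intro open_Diff finite_imp_closed) auto
        show "f holomorphic_on S - (insert (of_real x) nodes - {p}) - {p}"
          by (rule holomorphic_on_subset[OF f_hol]) auto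
      qed (use nodeS pn in auto)
      then show "(residue f \<circ> (\<lambda>j. complex_of_real (of_int j * h))) j =
        F (of_real (of_int j * h)) / (of_real (of_int j * h) - of_real x) * of_real (h / pi * cos (pi * of_int j))"
        unfolding ic o_def p_def .
    qed
  qed
  finally have main: "contour_integral ?R f = 2 * pi * \<i> * (F (of_real x) / s (of_real x) +
    (\<Sum>j=-int M..int M. F (of_real (of_int j * h)) / (of_real (of_int j * h) - of_real x) * of_real (h / pi * cos (pi * of_int j))))" .
  have sx: "s (of_real x) = of_real (sin (pi * x / h))"
    unfolding s_def by (simp flip: of_real_mult sin_of_real)
  have sx0: "s (of_real x) \<noteq> 0" using zero[OF xS] xn by blast
  have summand: "of_real (sin (pi * x / h)) * (F (of_real (of_int j * h)) / (of_real (of_int j * h) - of_real x) * of_real (h / pi * cos (pi * of_int j)))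
     = - (F (of_real (of_int j * h)) * of_real (sincS j h x))" for j :: int
  proof -
    have xj: "x \<noteq> of_int j * h" using False by blast
    have e: "pi * (x - of_int j * h) / h = pi * x / h - pi * of_int j" using h by (simp add: field_simps)
    have "sin (pi * x / h - pi * of_int j) = sin (pi * x / h) * cos (pi * of_int j)"
      by (simp add: sin_diff)
    then have "sincS j h x = sin (pi * x / h) * cos (pi * of_int j) / (pi * (x - of_int j * h) / h)"
      using xj e by (simp add: sincS_def)
    also have "\<dots> = - (sin (pi * x / h) * (1 / (of_int j * h - x) * (h / pi * cos (pi * of_int j))))"
      using xj h by (simp add: field_simps)
    finally have 1: "- sincS j h x = sin (pi * x / h) * (1 / (of_int j * h - x) * (h / pi * cos (pi * of_int j)))" by simp
    have "- (F (of_real (of_int j * h)) * of_real (sincS j h x)) = F (of_real (of_int j * h)) * of_real (- sincS j h x)" by simp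
    then show ?thesis unfolding 1 by (simp add: field_simps)
  qed
  have "rect_integral y (half_node h M) f = contour_integral ?R f"
    by (rule contour_integral_rectpath[symmetric, OF y(1) L])
       (use holomorphic_on_imp_continuous_on[OF f_hol] continuous_on_subset sub in blast)
  then have "of_real (sin (pi * x / h)) * rect_integral y (half_node h M) f =
     2 * pi * \<i> * (of_real (sin (pi * x / h)) * (F (of_real x) / s (of_real x)) +
    (\<Sum>j=-int M..int M. of_real (sin (pi * x / h)) * (F (of_real (of_int j * h)) / (of_real (of_int j * h) - of_real x) * of_real (h / pi * cos (pi * of_int j)))))"
    unfolding main sum_distrib_left[symmetric] by (simp add: algebra_simps)
  also have "\<dots> = 2 * of_real pi * \<i> * (F (of_real x) - sinc_sum h M F x)"
    unfolding summand sum_negf using sx sx0 by simp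
  finally show ?thesis unfolding f_def[abs_def] s_def .
qed

section \<open>Errors of Sinc interpolation and of Sinc indefinite integration\<close>

lemma sum_symmetric_Suc:
  fixes f :: "int \<Rightarrow> 'a::comm_monoid_add"
  shows "(\<Sum>j=-int (Suc M)..int (Suc M). f j) = (\<Sum>j=-int M..int M. f j) + (f (-int (Suc M)) + f (int (Suc M)))"
proof -
  have "{-int (Suc M)..int (Suc M)} = insert (-int (Suc M)) (insert (int (Suc M)) {-int M..int M})" by auto
  then show ?thesis by (simp add: add_ac)
qed

text \<open>
  Telescoping: \<open>exp (- \<beta> (M + 1)) \<le> (exp (- \<beta> M) - exp (- \<beta> (M + 1))) / \<beta>\<close>.
\<close>

lemma symmetric_tail_bound:
  fixes f :: "int \<Rightarrow> 'a::real_normed_vector"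
  assumes \<beta>: "0 < \<beta>" and f: "\<And>j. norm (f j) \<le> C * exp (- \<beta> * \<bar>of_int j\<bar>)" and NM: "N \<le> M"
  shows "norm ((\<Sum>j=-int M..int M. f j) - (\<Sum>j=-int N..int N. f j)) \<le> 2 * C / \<beta> * exp (- \<beta> * real N)"
proof -
  have "0 \<le> C * exp (- \<beta> * \<bar>of_int 0\<bar>)" using f[of 0] norm_ge_zero order_trans by blast
  then have C: "0 \<le> C" by simp
  have "norm ((\<Sum>j=-int M..int M. f j) - (\<Sum>j=-int N..int N. f j))
      \<le> 2 * C / \<beta> * (exp (- \<beta> * real N) - exp (- \<beta> * real M))"
    using NM
  proof (induction M rule: dec_induct)
    case base then show ?case by simp
  next
    case (step M)
    define r where "r = exp (- \<beta> * real (Suc M))"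
    have "r * (1 + \<beta>) \<le> r * exp \<beta>" unfolding r_def by (intro mult_left_mono exp_ge_add_one_self) auto
    also have "r * exp \<beta> = exp (- \<beta> * real M)" by (simp add: r_def algebra_simps flip: exp_add)
    finally have "\<beta> * r \<le> exp (- \<beta> * real M) - r" by (simp add: algebra_simps)
    then have "2 * C / \<beta> * (\<beta> * r) \<le> 2 * C / \<beta> * (exp (- \<beta> * real M) - r)"
      using C \<beta> by (intro mult_left_mono) auto
    then have r: "2 * C * r \<le> 2 * C / \<beta> * (exp (- \<beta> * real M) - r)" using \<beta> by simp
    have "norm (f (-int (Suc M))) \<le> C * r" "norm (f (int (Suc M))) \<le> C * r"
      using f[of "-int (Suc M)"] f[of "int (Suc M)"] by (simp_all add: r_def add.commute)
    then have "norm (f (-int (Suc M)) + f (int (Suc M))) \<le> 2 * C * r"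
      using norm_triangle_ineq[of "f (-int (Suc M))" "f (int (Suc M))"] by simp
    moreover have "norm ((\<Sum>j=-int (Suc M)..int (Suc M). f j) - (\<Sum>j=-int N..int N. f j))
        \<le> norm ((\<Sum>j=-int M..int M. f j) - (\<Sum>j=-int N..int N. f j)) + norm (f (-int (Suc M)) + f (int (Suc M)))"
      unfolding sum_symmetric_Suc by (rule order_trans[OF _ norm_triangle_ineq]) (simp add: algebra_simps)
    ultimately show ?case using step.IH r unfolding r_def by (simp add: right_diff_distrib)
  qed
  also have "\<dots> \<le> 2 * C / \<beta> * exp (- \<beta> * real N)" using C \<beta> by (intro mult_left_mono) auto
  finally show ?thesis .
qed

text \<open>
  Quartic decay leaves one factor \<open>1 / (1 + x\<^sup>2)\<close> to integrate over the horizontal sides after the other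
  one has been spent on the decay in \<open>x\<close> of the derivative of the Cauchy integral.
\<close>

locale decaying_strip_function =
  fixes F :: "complex \<Rightarrow> complex" and d B :: real
  assumes d_pos: "0 < d" and F_hol: "F holomorphic_on strip d"
    and F_bound: "\<And>z. z \<in> strip d \<Longrightarrow> norm (F z) \<le> B / (1 + (Re z)\<^sup>2)\<^sup>2"
begin

lemma B_nonneg: "0 \<le> B"
proof -
  have "0 \<in> strip d" using d_pos by (simp add: strip_def)
  then show ?thesis using order_trans[OF norm_ge_zero F_bound[of 0]] by simp
qed

text \<open>
  On the lines \<open>\<bar>Im z\<bar> = y\<close> the denominator has size \<open>sinh (\<pi> y / h)\<close>. This is the only source of the
  exponentially small factor in the discretization errors.
\<close>

definition csc_quotient :: "real \<Rightarrow> complex \<Rightarrow> complex" where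
  "csc_quotient h z = F z / sin (of_real (pi / h) * z)"

lemma csc_quotient_horizontal:
  assumes "0 < h" "0 < y" "y < d" "\<bar>Im z\<bar> = y"
  shows "norm (csc_quotient h z) \<le> B / sinh (pi * y / h) / (1 + (Re z)\<^sup>2)\<^sup>2"
proof -
  have "sinh (pi * y / h) = sinh \<bar>Im (of_real (pi / h) * z)\<bar>"
    unfolding assms(4)[symmetric] using assms(1) by (simp add: abs_mult)
  also have "\<dots> \<le> norm (sin (of_real (pi / h) * z))" by (rule norm_sin_horizontal_ge)
  finally have s: "sinh (pi * y / h) \<le> norm (sin (of_real (pi / h) * z))" .
  have s0: "0 < sinh (pi * y / h)" using assms by simp
  have "norm (F z) \<le> B / (1 + (Re z)\<^sup>2)\<^sup>2" using F_bound assms by (simp add: strip_def)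
  then have "norm (csc_quotient h z) \<le> B / (1 + (Re z)\<^sup>2)\<^sup>2 / sinh (pi * y / h)"
    unfolding csc_quotient_def norm_divide using s s0 B_nonneg by (intro frac_le) auto
  then show ?thesis by (simp add: mult.commute)
qed

lemma csc_quotient_vertical:
  assumes "0 < h" "0 < y" "y < d" "\<bar>Re z\<bar> = half_node h M" "\<bar>Im z\<bar> \<le> y"
  shows "norm (csc_quotient h z) \<le> B / half_node h M"
proof -
  have L: "0 < half_node h M" using assms by (simp add: half_node_def)
  have "cos (2 * Re (of_real (pi / h) * z)) = cos \<bar>2 * Re (of_real (pi / h) * z)\<bar>" by (rule cos_abs_real[symmetric])
  also have "\<bar>2 * Re (of_real (pi / h) * z)\<bar> = 2 * real M * pi + pi"
    using assms by (simp add: abs_mult half_node_def field_simps)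
  also have "cos (2 * real M * pi + pi) = -1" by (simp only: cos_periodic_pi cos_2npi)
  finally have "1 \<le> norm (sin (of_real (pi / h) * z))" by (rule norm_sin_vertical_ge)
  moreover have "norm (F z) \<le> B / (1 + (Re z)\<^sup>2)\<^sup>2" using F_bound assms by (simp add: strip_def)
  ultimately have "norm (csc_quotient h z) \<le> B / (1 + (Re z)\<^sup>2)\<^sup>2 / 1"
    unfolding csc_quotient_def norm_divide using B_nonneg by (intro frac_le) auto
  also have "(Re z)\<^sup>2 = (half_node h M)\<^sup>2" using assms(4) by (metis power2_abs)
  also have "B / (1 + (half_node h M)\<^sup>2)\<^sup>2 / 1 \<le> B / half_node h M"
  proof -
    define L where "L = half_node h M"
    have L: "0 < L" using L by (simp add: L_def)
    have "0 \<le> (L - 1)\<^sup>2" by simp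
    then have "L \<le> 1 + L\<^sup>2" using L by (simp add: power2_eq_square algebra_simps)
    also have "\<dots> \<le> (1 + L\<^sup>2)\<^sup>2" by (rule self_le_power) auto
    finally show ?thesis unfolding L_def[symmetric] div_by_1 using L B_nonneg by (intro frac_le) auto
  qed
  finally show ?thesis .
qed

lemma csc_quotient_continuous:
  assumes "0 < h" "0 < y" "y < d"
  shows "continuous_on (rect_sides y (half_node h M)) (csc_quotient h)"
proof -
  have "rect_sides y (half_node h M) \<subseteq> strip d" using assms by (auto simp: rect_sides_def strip_def)
  then have "continuous_on (rect_sides y (half_node h M)) F"
    using F_hol holomorphic_on_imp_continuous_on continuous_on_subset by blast
  then show ?thesis unfolding csc_quotient_def[abs_def]
    using sin_nonzero_rect_sides[OF assms(1,2)] by (intro continuous_intros) auto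
qed

text \<open>
  By the residue formula the interpolation error is this Cauchy integral times the oscillating factor
  \<open>sin (\<pi> x / h) / (2 \<pi> i)\<close>; the companion is its derivative.
\<close>

definition cauchy_transform :: "real \<Rightarrow> real \<Rightarrow> nat \<Rightarrow> complex \<Rightarrow> complex" where
  "cauchy_transform h y M w = rect_integral y (half_node h M) (\<lambda>z. csc_quotient h z / (z - w))"

definition cauchy_transform' :: "real \<Rightarrow> real \<Rightarrow> nat \<Rightarrow> complex \<Rightarrow> complex" where
  "cauchy_transform' h y M w = rect_integral y (half_node h M) (\<lambda>z. csc_quotient h z / (z - w)\<^sup>2)"

context
  fixes h y x :: real and M :: nat
  assumes h: "0 < h" and y: "0 < y" "y < d" and x: "\<bar>x\<bar> + 1 \<le> half_node h M"
begin

lemma L_pos: "0 < half_node h M" using x by simp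

lemma x_not_on_rect: "of_real x \<notin> rect_sides y (half_node h M)"
  using x y by (auto simp: rect_sides_def)

lemma norm_cauchy_transform_le:
  "norm (cauchy_transform h y M (of_real x)) \<le> 2 * pi * (B / (y * sinh (pi * y / h))) + 4 * y * (B / half_node h M)"
  unfolding cauchy_transform_def
proof (rule norm_rect_integral_le[OF y(1) L_pos])
  have s0: "0 < sinh (pi * y / h)" using h y by simp
  show "continuous_on (rect_sides y (half_node h M)) (\<lambda>z. csc_quotient h z / (z - of_real x))"
    using x_not_on_rect by (intro continuous_intros csc_quotient_continuous h y) auto
  show "norm (csc_quotient h z / (z - of_real x)) \<le> B / (y * sinh (pi * y / h)) / (1 + (Re z)\<^sup>2)" if "\<bar>Im z\<bar> = y" for z
  proof -
    have "y \<le> norm (z - of_real x)" using that abs_Im_le_cmod[of "z - of_real x"] by simp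
    then have "norm (csc_quotient h z / (z - of_real x)) \<le> B / sinh (pi * y / h) / (1 + (Re z)\<^sup>2)\<^sup>2 / y"
      unfolding norm_divide using csc_quotient_horizontal[OF h y that] s0 B_nonneg y by (intro frac_le) auto
    also have "\<dots> = B / (y * sinh (pi * y / h)) / (1 + (Re z)\<^sup>2)\<^sup>2" by simp
    also have "\<dots> \<le> B / (y * sinh (pi * y / h)) / (1 + (Re z)\<^sup>2)"
    proof (intro divide_left_mono)
      show "1 + (Re z)\<^sup>2 \<le> (1 + (Re z)\<^sup>2)\<^sup>2" by (rule self_le_power) auto
      show "0 < (1 + (Re z)\<^sup>2)\<^sup>2 * (1 + (Re z)\<^sup>2)" by (intro mult_pos_pos zero_less_power add_pos_nonneg) auto
    qed (use s0 B_nonneg y in auto)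
    finally show ?thesis .
  qed
  show "norm (csc_quotient h z / (z - of_real x)) \<le> B / half_node h M" if "\<bar>Re z\<bar> = half_node h M" "\<bar>Im z\<bar> \<le> y" for z
  proof -
    have "1 \<le> norm (z - of_real x)" using that x abs_Re_le_cmod[of "z - of_real x"] by simp
    then have "norm (csc_quotient h z / (z - of_real x)) \<le> B / half_node h M / 1"
      unfolding norm_divide using csc_quotient_vertical[OF h y that] B_nonneg L_pos by (intro frac_le) auto
    then show ?thesis by simp
  qed
  show "0 \<le> B / half_node h M" using B_nonneg L_pos by simp
qed

text \<open>
  Integrability in \<open>x\<close> is the point here. It comes from
  \<open>1 + x\<^sup>2 \<le> 2 (1 + t\<^sup>2) (1 + (t - x)\<^sup>2)\<close> and the decay of \<open>F\<close> in \<open>t = Re z\<close>.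
\<close>

lemma norm_cauchy_transform'_le:
  "norm (cauchy_transform' h y M (of_real x))
    \<le> 2 * pi * (2 * (1 + 1 / y\<^sup>2) * B / sinh (pi * y / h) / (1 + x\<^sup>2)) + 4 * y * (B / half_node h M)"
  unfolding cauchy_transform'_def
proof (rule norm_rect_integral_le[OF y(1) L_pos])
  have s0: "0 < sinh (pi * y / h)" using h y by simp
  show "continuous_on (rect_sides y (half_node h M)) (\<lambda>z. csc_quotient h z / (z - of_real x)\<^sup>2)"
    using x_not_on_rect by (intro continuous_intros csc_quotient_continuous h y) auto
  show "norm (csc_quotient h z / (z - of_real x)\<^sup>2) \<le> 2 * (1 + 1 / y\<^sup>2) * B / sinh (pi * y / h) / (1 + x\<^sup>2) / (1 + (Re z)\<^sup>2)"
    if z: "\<bar>Im z\<bar> = y" for z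
  proof -
    define t where "t = Re z"
    define n where "n = (norm (z - of_real x))\<^sup>2"
    have n: "n = (t - x)\<^sup>2 + y\<^sup>2" unfolding n_def cmod_power2 t_def using z by (metis Im_complex_of_real Re_complex_of_real diff_zero minus_complex.simps power2_abs)
    have p: "0 < 1 + t\<^sup>2" "0 < 1 + x\<^sup>2" by (simp_all add: add_pos_nonneg)
    have n0: "0 < n" using y unfolding n by (simp add: add_nonneg_pos)
    have "1 + x\<^sup>2 \<le> 2 * (1 + t\<^sup>2) * (1 + (t - x)\<^sup>2)"
    proof -
      have "0 \<le> (2 * t - x)\<^sup>2 + 1 + 2 * (t\<^sup>2 * (t - x)\<^sup>2)" by simp
      then show ?thesis by (simp add: power2_eq_square algebra_simps)
    qed
    also have "1 + (t - x)\<^sup>2 \<le> (1 + 1 / y\<^sup>2) * n"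
    proof -
      have "(1 + 1 / y\<^sup>2) * n = 1 + (t - x)\<^sup>2 + ((t - x)\<^sup>2 / y\<^sup>2 + y\<^sup>2)" using y unfolding n by (simp add: field_simps)
      then show ?thesis by simp
    qed
    finally have k: "1 + x\<^sup>2 \<le> 2 * (1 + t\<^sup>2) * ((1 + 1 / y\<^sup>2) * n)" using p by (simp add: mult_left_mono)
    have "norm (csc_quotient h z / (z - of_real x)\<^sup>2) = norm (csc_quotient h z) / n" by (simp add: norm_divide norm_power n_def)
    also have "\<dots> \<le> B / sinh (pi * y / h) / (1 + t\<^sup>2)\<^sup>2 / n"
      using csc_quotient_horizontal[OF h y z] n0 unfolding t_def by (intro divide_right_mono) auto
    also have "\<dots> = (B / sinh (pi * y / h) / (1 + t\<^sup>2)\<^sup>2) * (1 / n)" by simp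
    also have "\<dots> \<le> (B / sinh (pi * y / h) / (1 + t\<^sup>2)\<^sup>2) * (2 * (1 + t\<^sup>2) * (1 + 1 / y\<^sup>2) / (1 + x\<^sup>2))"
    proof (intro mult_left_mono)
      show "1 / n \<le> 2 * (1 + t\<^sup>2) * (1 + 1 / y\<^sup>2) / (1 + x\<^sup>2)"
        using k n0 p by (simp add: divide_le_eq le_divide_eq mult_ac)
    qed (use s0 B_nonneg in auto)
    also have "\<dots> = 2 * (1 + 1 / y\<^sup>2) * B / sinh (pi * y / h) / (1 + x\<^sup>2) / (1 + t\<^sup>2)"
    proof -
      have alg: "(B / S / T\<^sup>2) * (2 * T * c / X) = 2 * c * B / S / X / T" if "T \<noteq> 0" for S T c X :: real
        using that by (simp add: power2_eq_square mult_ac)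
      show ?thesis by (rule alg) (use p in simp)
    qed
    finally show ?thesis unfolding t_def .
  qed
  show "norm (csc_quotient h z / (z - of_real x)\<^sup>2) \<le> B / half_node h M" if "\<bar>Re z\<bar> = half_node h M" "\<bar>Im z\<bar> \<le> y" for z
  proof -
    have "1 \<le> norm (z - of_real x)" using that x abs_Re_le_cmod[of "z - of_real x"] by simp
    then have "1 \<le> (norm (z - of_real x))\<^sup>2" by (rule one_le_power)
    then have "norm (csc_quotient h z / (z - of_real x)\<^sup>2) \<le> B / half_node h M / 1"
      unfolding norm_divide norm_power using csc_quotient_vertical[OF h y that] B_nonneg L_pos by (intro frac_le) auto
    then show ?thesis by simp
  qed
  show "0 \<le> B / half_node h M" using B_nonneg L_pos by simp
qed

lemma cauchy_transform_has_derivative: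
  "((\<lambda>x. cauchy_transform h y M (of_real x)) has_vector_derivative cauchy_transform' h y M (of_real x)) (at x)"
  unfolding cauchy_transform_def cauchy_transform'_def
  by (rule has_vector_derivative_real_field
    [OF has_field_derivative_Cauchy_rect_integral[OF y(1) L_pos csc_quotient_continuous[OF h y] x_not_on_rect]])

lemma interpolation_error_formula:
  "F (of_real x) - sinc_sum h M F x
    = of_real (sin (pi * x / h)) * cauchy_transform h y M (of_real x) / (2 * of_real pi * \<i>)"
  unfolding cauchy_transform_def csc_quotient_def
  by (subst sinc_residue_formula[OF h y F_hol]) (use x in auto)

end

lemma half_node_tendsto: "0 < h \<Longrightarrow> filterlim (half_node h) at_top sequentially"
  unfolding half_node_def[abs_def] by real_asymp

lemma inverse_half_node_tendsto: "0 < h \<Longrightarrow> (\<lambda>M. c / half_node h M) \<longlonglongrightarrow> 0"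
  by (rule real_tendsto_divide_at_top[OF tendsto_const half_node_tendsto])

text \<open>
  \<open>F\<close> is only defined in the open strip, so the contours stay at height \<open>y < d\<close>, and the width is
  exhausted in the bounds afterwards.
\<close>

lemma continuity_in_width:
  assumes h: "0 < h" and f: "continuous (at_left d) f" and "\<And>y. 0 < y \<Longrightarrow> y < d \<Longrightarrow> (l::real) \<le> f y"
  shows "l \<le> f d"
proof (rule tendsto_lowerbound)
  show "(f \<longlongrightarrow> f d) (at_left d)" using f by (simp add: continuous_within)
  show "\<forall>\<^sub>F y in at_left d. l \<le> f y"
    using assms(3) d_pos eventually_at_left[of 0 d "\<lambda>y. l \<le> f y"] by auto
qed simp

text \<open>
  Discretization error from the contour integral plus the tail of the cardinal series. The rectangles
  grow first, then their height tends to \<open>d\<close>.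
\<close>

theorem sinc_interpolation_error:
  assumes h: "0 < h" and \<alpha>: "0 < \<alpha>" and F': "\<And>x. norm (F (of_real x)) \<le> B' * exp (- \<alpha> * \<bar>x\<bar>)"
  shows "norm (F (of_real x) - sinc_sum h N F x)
     \<le> B / (d * sinh (pi * d / h)) + 2 * B' / (\<alpha> * h) * exp (- \<alpha> * h * real N)"
    (is "?E \<le> _ + ?T")
proof -
  define f where "f j = F (of_real (of_int j * h)) * of_real (sincS j h x)" for j
  have "norm (f j) \<le> B' * exp (- (\<alpha> * h) * \<bar>of_int j\<bar>)" for j
  proof -
    have "norm (f j) \<le> B' * exp (- \<alpha> * \<bar>of_int j * h\<bar>) * 1"
      unfolding f_def norm_mult norm_of_real
      by (rule mult_mono[OF F' sincS_le_1]) (use F'[of "of_int j * h"] norm_ge_zero order_trans in blast, simp)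
    then show ?thesis using h by (simp add: abs_mult mult_ac)
  qed
  from symmetric_tail_bound[OF _ this, of N] \<alpha> h
  have tail: "norm ((\<Sum>j=-int M..int M. f j) - (\<Sum>j=-int N..int N. f j)) \<le> ?T" if "N \<le> M" for M
    using that by (simp add: mult_ac)
  have "?E - ?T \<le> B / (d * sinh (pi * d / h))"
  proof (rule continuity_in_width[OF h, of "\<lambda>y. B / (y * sinh (pi * y / h))"])
    have "d * sinh (pi * d / h) \<noteq> 0" using h d_pos by simp
    then show "continuous (at_left d) (\<lambda>y. B / (y * sinh (pi * y / h)))"
      unfolding continuous_within using h by (auto intro!: tendsto_eq_intros)
    fix y assume y: "0 < y" "y < d"
    have "?E - ?T \<le> B / (y * sinh (pi * y / h)) + 0"
    proof (rule tendsto_lowerbound)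
      show "(\<lambda>M. B / (y * sinh (pi * y / h)) + 2 * y / pi * B / half_node h M) \<longlonglongrightarrow> B / (y * sinh (pi * y / h)) + 0"
        by (intro tendsto_add tendsto_const inverse_half_node_tendsto h)
      have "\<forall>\<^sub>F M in sequentially. \<bar>x\<bar> + 1 \<le> half_node h M"
        using half_node_tendsto[OF h] by (simp add: filterlim_at_top)
      then show "\<forall>\<^sub>F M in sequentially. ?E - ?T \<le> B / (y * sinh (pi * y / h)) + 2 * y / pi * B / half_node h M"
        using eventually_ge_at_top[of N]
      proof eventually_elim
        case (elim M)
        have "norm (F (of_real x) - (\<Sum>j=-int M..int M. f j))
            \<le> 1 * norm (cauchy_transform h y M (of_real x)) / (2 * pi)"
          unfolding f_def interpolation_error_formula[OF h y elim(1)] norm_divide norm_mult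
          by (auto intro!: divide_right_mono mult_left_le_one_le)
        also have "\<dots> \<le> (2 * pi * (B / (y * sinh (pi * y / h))) + 4 * y * (B / half_node h M)) / (2 * pi)"
          using norm_cauchy_transform_le[OF h y elim(1)] by (simp add: divide_right_mono)
        also have "\<dots> = B / (y * sinh (pi * y / h)) + 2 * y / pi * B / half_node h M"
          by (simp add: add_divide_distrib)
        finally have "norm (F (of_real x) - (\<Sum>j=-int M..int M. f j)) \<le> B / (y * sinh (pi * y / h)) + 2 * y / pi * B / half_node h M" .
        moreover have "?E \<le> norm (F (of_real x) - (\<Sum>j=-int M..int M. f j)) + norm ((\<Sum>j=-int M..int M. f j) - (\<Sum>j=-int N..int N. f j))"
          unfolding f_def[symmetric] by (rule order_trans[OF _ norm_triangle_ineq]) simp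
        ultimately show ?case using tail[OF elim(2)] by simp
      qed
    qed simp
    then show "?E - ?T \<le> B / (y * sinh (pi * y / h))" by simp
  qed
  then show ?thesis by simp
qed

end

lemma sincJ_has_derivative:
  assumes "0 < h" shows "(sincJ j h has_real_derivative sincS j h x) (at x)"
proof -
  have "((\<lambda>x. Si (pi * (x - of_int j * h) / h)) has_real_derivative sinc (pi * (x - of_int j * h) / h) * (pi / h)) (at x)"
    by (rule DERIV_chain2[OF DERIV_Si]) (use assms in \<open>auto intro!: derivative_eq_intros\<close>)
  then have "((\<lambda>x. h * (1 / 2 + 1 / pi * Si (pi * (x - of_int j * h) / h))) has_real_derivative
      h * (0 + 1 / pi * (sinc (pi * (x - of_int j * h) / h) * (pi / h)))) (at x)"
    by (intro DERIV_cmult DERIV_add DERIV_const)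
  moreover have "h * (0 + 1 / pi * (sinc (pi * (x - of_int j * h) / h) * (pi / h))) = sincS j h x"
    using assms by (simp add: sincS_def)
  ultimately show ?thesis unfolding sincJ_def[abs_def] by simp
qed

lemma sincJ_bounded:
  obtains C where "0 \<le> C" "\<And>h j x. 0 < h \<Longrightarrow> \<bar>sincJ j h x\<bar> \<le> h * C"
proof -
  obtain B where B: "\<And>T. \<bar>Si T\<bar> \<le> B" using bounded_Si by blast
  have B0: "0 \<le> B" using B[of 0] by simp
  have "\<bar>sincJ j h x\<bar> \<le> h * (1 / 2 + B)" if h: "0 < h" for h j x
  proof -
    define S where "S = Si (pi * (x - of_int j * h) / h)"
    have "\<bar>1 / pi * S\<bar> = \<bar>S\<bar> / pi" by (simp add: abs_mult)
    also have "\<dots> \<le> B / 1" using B B0 pi_ge_two unfolding S_def by (intro frac_le) auto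
    finally have "\<bar>1 / 2 + 1 / pi * S\<bar> \<le> 1 / 2 + B" by linarith
    then show ?thesis using h unfolding sincJ_def S_def[symmetric] abs_mult by (simp add: mult_left_mono)
  qed
  then show ?thesis using that[of "1 / 2 + B"] B0 by simp
qed

lemma Si_at_bot: "(Si \<longlongrightarrow> - (pi / 2)) at_bot"
proof -
  have "((\<lambda>x. - Si (- x)) \<longlongrightarrow> - (pi / 2)) at_bot"
    by (intro tendsto_minus filterlim_compose[OF Si_at_top filterlim_uminus_at_top_at_bot])
  moreover have "\<forall>\<^sub>F x in at_bot. - Si (- x) = Si x"
  proof -
    have eq: "- Si (- x) = Si x" if "x \<le> 0" for x using Si_neg[of "- x"] that by simp
    show ?thesis by (rule eventually_mono[OF eventually_le_at_bot[of 0] eq])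
  qed
  ultimately show ?thesis by (rule Lim_transform_eventually)
qed

lemma sincJ_at_bot:
  assumes h: "0 < h" shows "(sincJ j h \<longlongrightarrow> 0) at_bot"
proof -
  have "filterlim (\<lambda>x. pi * (x - of_int j * h) / h) at_bot at_bot" using h by real_asymp
  from filterlim_compose[OF Si_at_bot this]
  have "((\<lambda>x. h * (1 / 2 + 1 / pi * Si (pi * (x - of_int j * h) / h))) \<longlongrightarrow> h * (1 / 2 + 1 / pi * - (pi / 2))) at_bot"
    by (intro tendsto_mult tendsto_add tendsto_const)
  then show ?thesis unfolding sincJ_def[abs_def] by simp
qed

context decaying_strip_function
begin

text \<open>
  Integrating the interpolation error \<open>sin (\<pi> x / h) m(x)\<close> over an unbounded range would not converge
  absolutely, as \<open>m\<close> in general decays only like \<open>1 / x\<close>. Integration by parts helps: it gains a factor \<open>h\<close> and replaces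
  \<open>m\<close> by \<open>m'\<close>, which is integrable. To avoid integrals altogether, the proof compares the derivative of
  \<open>Q - \<Sum> F(j h) J(j,h) + (h / \<pi>) cos (\<pi> x / h) m\<close> with that of a multiple of the arctangent on \<open>[-X, \<xi>]\<close>, and
  then lets \<open>X \<rightarrow> \<infinity>\<close>.
\<close>

theorem sinc_indefinite_integration_error:
  assumes h: "0 < h" and \<alpha>: "0 < \<alpha>" and F': "\<And>x. norm (F (of_real x)) \<le> B' * exp (- \<alpha> * \<bar>x\<bar>)"
    and Q: "\<And>x. (Q has_vector_derivative F (of_real x)) (at x)" and Q0: "(Q \<longlongrightarrow> 0) at_bot"
    and J: "\<And>j x. \<bar>sincJ j h x\<bar> \<le> h * C"
  shows "norm (Q \<xi> - sincJ_sum h N F \<xi>)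
     \<le> h * (2 / d + 2 * (1 + 1 / d\<^sup>2)) * B / sinh (pi * d / h) + 4 * B' * C / \<alpha> * exp (- \<alpha> * h * real N)"
    (is "?E \<le> _ + ?T")
proof -
  have C0: "0 \<le> h * C" using J[of 0 0] abs_ge_zero order_trans by blast
  define f where "f X j = F (of_real (of_int j * h)) * of_real (sincJ j h \<xi> - sincJ j h (- X))" for X j
  define E where "E X = norm (Q \<xi> - Q (- X) - (\<Sum>j=-int N..int N. f X j))" for X
  have fb: "norm (f X j) \<le> (B' * (2 * (h * C))) * exp (- (\<alpha> * h) * \<bar>of_int j\<bar>)" for X j
  proof -
    have "\<bar>sincJ j h \<xi> - sincJ j h (- X)\<bar> \<le> 2 * (h * C)" using J[of j \<xi>] J[of j "- X"] by linarith
    then have "norm (f X j) \<le> B' * exp (- \<alpha> * \<bar>of_int j * h\<bar>) * (2 * (h * C))"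
      unfolding f_def norm_mult norm_of_real
      by (rule mult_mono[OF F']) (use F'[of "of_int j * h"] norm_ge_zero order_trans in blast, simp)
    then show ?thesis using h by (simp add: abs_mult mult_ac)
  qed
  have tail: "norm ((\<Sum>j=-int M..int M. f X j) - (\<Sum>j=-int N..int N. f X j)) \<le> ?T" if "N \<le> M" for M X
  proof -
    have "norm ((\<Sum>j=-int M..int M. f X j) - (\<Sum>j=-int N..int N. f X j)) \<le> 2 * (B' * (2 * (h * C))) / (\<alpha> * h) * exp (- (\<alpha> * h) * real N)"
      by (rule symmetric_tail_bound[OF _ fb that]) (use \<alpha> h in simp)
    also have "\<dots> = ?T" using h by simp
    finally show ?thesis .
  qed
  have fixed: "E X - ?T \<le> h * (2 / y + 2 * (1 + 1 / y\<^sup>2)) * B / sinh (pi * y / h) + 0"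
    if y: "0 < y" "y < d" and X: "\<bar>\<xi>\<bar> < X" for y X
  proof (rule tendsto_lowerbound)
    define H where "H M = h * (2 / y + 2 * (1 + 1 / y\<^sup>2)) * B / sinh (pi * y / h) + h * (2 * y * (\<xi> + X + 2) * B) / half_node h M" for M
    have "(\<lambda>M. h * (2 * y * (\<xi> + X + 2) * B) / half_node h M) \<longlonglongrightarrow> 0" by (rule inverse_half_node_tendsto[OF h])
    then show "H \<longlonglongrightarrow> h * (2 / y + 2 * (1 + 1 / y\<^sup>2)) * B / sinh (pi * y / h) + 0"
      unfolding H_def[abs_def] by (intro tendsto_add tendsto_const)
    have "\<forall>\<^sub>F M in sequentially. X + 1 \<le> half_node h M"
      using half_node_tendsto[OF h] by (simp add: filterlim_at_top)
    then show "\<forall>\<^sub>F M in sequentially. E X - ?T \<le> H M"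
      using eventually_ge_at_top[of N]
    proof eventually_elim
      case (elim M)
      have xM: "\<bar>x\<bar> + 1 \<le> half_node h M" if "- X \<le> x" "x \<le> \<xi>" for x using that X elim(1) by auto
      define s where "s = sinh (pi * y / h)"
      have s0: "0 < s" using h y by (simp add: s_def)
      \<comment> \<open>The factor \<open>h / \<pi>\<close> comes from integrating \<open>sin (\<pi> x / h)\<close>.\<close>
      define k where "k = complex_of_real (h / pi) / (2 * of_real pi * \<i>)"
      have nk: "norm k = h / (2 * pi\<^sup>2)" using h by (simp add: k_def norm_divide norm_mult power2_eq_square)
      define W where "W = 4 * y * (B / half_node h M)"
      have W0: "0 \<le> W" using y B_nonneg elim X by (simp add: W_def)
      define c where "c = 2 * (1 + 1 / y\<^sup>2) * B / s"
      define P where "P x = Q x - sincJ_sum h M F x" for x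
      define R where "R x = of_real (cos (pi * x / h)) * cauchy_transform h y M (of_real x) * k" for x
      have dP: "(P has_vector_derivative F (of_real x) - sinc_sum h M F x) (at x)" for x
        unfolding P_def[abs_def]
      proof (intro has_vector_derivative_diff Q has_vector_derivative_sum)
        fix j
        have "((\<lambda>x. complex_of_real (sincJ j h x)) has_vector_derivative of_real (sincS j h x)) (at x)"
          using sincJ_has_derivative[OF h] by (intro has_vector_derivative_of_real) (simp add: has_real_derivative_iff_has_vector_derivative)
        then show "((\<lambda>x. F (of_real (of_int j * h)) * of_real (sincJ j h x)) has_vector_derivative
            F (of_real (of_int j * h)) * of_real (sincS j h x)) (at x)"
          by (rule has_vector_derivative_mult_right)
      qed
      have dR: "(R has_vector_derivative (of_real (cos (pi * x / h)) * cauchy_transform' h y M (of_real x)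
           + of_real (- sin (pi * x / h) * (pi / h)) * cauchy_transform h y M (of_real x)) * k) (at x)"
        if "- X \<le> x" "x \<le> \<xi>" for x
        unfolding R_def[abs_def]
      proof (intro has_vector_derivative_mult_left has_vector_derivative_mult cauchy_transform_has_derivative h y xM that)
        have "((\<lambda>x. cos (pi * x / h)) has_real_derivative - sin (pi * x / h) * (pi / h)) (at x)"
          using h by (auto intro!: derivative_eq_intros)
        then show "((\<lambda>x. complex_of_real (cos (pi * x / h))) has_vector_derivative of_real (- sin (pi * x / h) * (pi / h))) (at x)"
          by (intro has_vector_derivative_of_real) (simp add: has_real_derivative_iff_has_vector_derivative)
      qed
      have d: "((\<lambda>x. P x + R x) has_vector_derivative of_real (cos (pi * x / h)) * cauchy_transform' h y M (of_real x) * k) (at x)"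
        if x: "- X \<le> x" "x \<le> \<xi>" for x
      proof -
        have k: "of_real (pi / h) * k = 1 / (2 * of_real pi * \<i>)" using h by (simp add: k_def)
        have "F (of_real x) - sinc_sum h M F x
            + (of_real (cos (pi * x / h)) * cauchy_transform' h y M (of_real x)
             + of_real (- sin (pi * x / h) * (pi / h)) * cauchy_transform h y M (of_real x)) * k
            = of_real (cos (pi * x / h)) * cauchy_transform' h y M (of_real x) * k
             + of_real (sin (pi * x / h)) * cauchy_transform h y M (of_real x) * (1 / (2 * of_real pi * \<i>) - of_real (pi / h) * k)"
          unfolding interpolation_error_formula[OF h y xM[OF x]] by (simp add: algebra_simps)
        also have "\<dots> = of_real (cos (pi * x / h)) * cauchy_transform' h y M (of_real x) * k" unfolding k by simp
        finally show ?thesis using has_vector_derivative_add[OF dP dR[OF x]] by simp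
      qed
      have "norm ((P \<xi> + R \<xi>) - (P (- X) + R (- X)))
          \<le> h / (2 * pi\<^sup>2) * (2 * pi * c * arctan \<xi> + W * \<xi>) - h / (2 * pi\<^sup>2) * (2 * pi * c * arctan (- X) + W * (- X))"
      proof (rule differentiable_bound_general)
        show "- X < \<xi>" using X by simp
        show "continuous_on {- X..\<xi>} (\<lambda>x. P x + R x)"
          using d by (intro continuous_at_imp_continuous_on ballI) (auto intro: has_vector_derivative_continuous)
        show "continuous_on {- X..\<xi>} (\<lambda>x. h / (2 * pi\<^sup>2) * (2 * pi * c * arctan x + W * x))"
          by (intro continuous_intros)
        fix x assume x: "- X < x" "x < \<xi>"
        show "((\<lambda>x. P x + R x) has_vector_derivative of_real (cos (pi * x / h)) * cauchy_transform' h y M (of_real x) * k) (at x)"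
          using d x by simp
        have "((\<lambda>x. h / (2 * pi\<^sup>2) * (2 * pi * c * arctan x + W * x)) has_real_derivative
            h / (2 * pi\<^sup>2) * (2 * pi * (c / (1 + x\<^sup>2)) + W)) (at x)"
          by (auto intro!: derivative_eq_intros simp: field_simps)
        then show "((\<lambda>x. h / (2 * pi\<^sup>2) * (2 * pi * c * arctan x + W * x)) has_vector_derivative
            h / (2 * pi\<^sup>2) * (2 * pi * (c / (1 + x\<^sup>2)) + W)) (at x)"
          by (simp add: has_real_derivative_iff_has_vector_derivative)
        have "norm (of_real (cos (pi * x / h)) * cauchy_transform' h y M (of_real x) * k)
            \<le> 1 * norm (cauchy_transform' h y M (of_real x)) * (h / (2 * pi\<^sup>2))"
          unfolding norm_mult nk norm_of_real using h by (intro mult_right_mono abs_cos_le_one) auto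
        also have "\<dots> \<le> (2 * pi * (c / (1 + x\<^sup>2)) + W) * (h / (2 * pi\<^sup>2))"
          using norm_cauchy_transform'_le[OF h y xM[of x]] x h
          unfolding c_def W_def s_def mult_1 by (intro mult_right_mono) auto
        finally show "norm (of_real (cos (pi * x / h)) * cauchy_transform' h y M (of_real x) * k)
            \<le> h / (2 * pi\<^sup>2) * (2 * pi * (c / (1 + x\<^sup>2)) + W)" by (simp add: mult.commute)
      qed
      also have "\<dots> = h / (2 * pi\<^sup>2) * (2 * pi * c * (arctan \<xi> - arctan (- X)) + W * (\<xi> + X))"
        by (simp add: algebra_simps)
      also have "\<dots> \<le> h / (2 * pi\<^sup>2) * (2 * pi * c * pi + W * (\<xi> + X))"
        using h y s0 B_nonneg arctan_ubound[of \<xi>] arctan_lbound[of "- X"]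
        by (intro mult_left_mono add_right_mono) (auto simp: c_def)
      finally have PR: "norm ((P \<xi> + R \<xi>) - (P (- X) + R (- X))) \<le> h / (2 * pi\<^sup>2) * (2 * pi * c * pi + W * (\<xi> + X))" .
      have Rb: "norm (R x) \<le> h / (2 * pi\<^sup>2) * (2 * pi * (B / (y * s)) + W)" if x: "- X \<le> x" "x \<le> \<xi>" for x
      proof -
        have "norm (R x) \<le> 1 * norm (cauchy_transform h y M (of_real x)) * (h / (2 * pi\<^sup>2))"
          unfolding R_def norm_mult nk norm_of_real using h by (intro mult_right_mono abs_cos_le_one) auto
        also have "\<dots> \<le> (2 * pi * (B / (y * s)) + W) * (h / (2 * pi\<^sup>2))"
          using norm_cauchy_transform_le[OF h y xM[OF x]] h unfolding W_def s_def mult_1 by (intro mult_right_mono) auto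
        finally show ?thesis by (simp add: mult.commute)
      qed
      have PP: "P \<xi> - P (- X) = Q \<xi> - Q (- X) - (\<Sum>j=-int M..int M. f X j)"
        by (simp add: P_def f_def algebra_simps sum_subtractf sum.distrib)
      have "norm (P \<xi> - P (- X)) \<le> norm ((P \<xi> + R \<xi>) - (P (- X) + R (- X))) + (norm (R \<xi>) + norm (R (- X)))"
      proof -
        have "P \<xi> - P (- X) = ((P \<xi> + R \<xi>) - (P (- X) + R (- X))) + (R (- X) - R \<xi>)" by simp
        then show ?thesis using norm_triangle_ineq[of "(P \<xi> + R \<xi>) - (P (- X) + R (- X))" "R (- X) - R \<xi>"]
            norm_triangle_ineq4[of "R (- X)" "R \<xi>"] by simp
      qed
      also have "\<dots> \<le> h / (2 * pi\<^sup>2) * (2 * pi * c * pi + W * (\<xi> + X)) + 2 * (h / (2 * pi\<^sup>2) * (2 * pi * (B / (y * s)) + W))"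
        by (rule order_trans[OF add_mono[OF PR add_mono[OF Rb[of \<xi>] Rb[of "- X"]]]]) (use X in auto)
      also have "\<dots> = h * c + h * (2 / pi * (B / (y * s))) + h / (2 * pi\<^sup>2) * (W * (\<xi> + X + 2))"
        by (simp add: field_simps power2_eq_square)
      also have "\<dots> \<le> h * c + h * (2 * (B / (y * s))) + h / 2 * (W * (\<xi> + X + 2))"
      proof (intro add_mono mult_left_mono mult_right_mono order_refl)
        show "h / (2 * pi\<^sup>2) \<le> h / 2" using h pi_ge_two by (intro divide_left_mono) (auto simp: power2_eq_square intro!: mult_mono[of 1 pi 1 pi, simplified])
        show "2 / pi \<le> 2" using pi_ge_two by (simp add: divide_le_eq)
      qed (use h y s0 B_nonneg W0 X in auto)
      also have "\<dots> = H M"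
      proof -
        have "h * c + h * (2 * (B / (y * s))) = h * (2 / y + 2 * (1 + 1 / y\<^sup>2)) * B / s"
          unfolding c_def using y s0 by (simp add: field_simps)
        moreover have "h / 2 * (W * (\<xi> + X + 2)) = h * (2 * y * (\<xi> + X + 2) * B) / half_node h M"
          unfolding W_def by simp
        ultimately show ?thesis unfolding H_def s_def by simp
      qed
      finally have "norm (Q \<xi> - Q (- X) - (\<Sum>j=-int M..int M. f X j)) \<le> H M" unfolding PP .
      moreover have "E X \<le> norm (Q \<xi> - Q (- X) - (\<Sum>j=-int M..int M. f X j)) + norm ((\<Sum>j=-int M..int M. f X j) - (\<Sum>j=-int N..int N. f X j))"
        unfolding E_def by (rule order_trans[OF _ norm_triangle_ineq]) (simp add: algebra_simps)
      ultimately show ?case using tail[OF elim(2), of X] by linarith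
    qed
  qed simp
  have "?E - ?T \<le> h * (2 / y + 2 * (1 + 1 / y\<^sup>2)) * B / sinh (pi * y / h)" if y: "0 < y" "y < d" for y
  proof (rule tendsto_upperbound)
    have "((\<lambda>X. Q (- X)) \<longlongrightarrow> 0) at_top" by (rule filterlim_compose[OF Q0 filterlim_uminus_at_bot_at_top])
    moreover have "((\<lambda>X. sincJ j h (- X)) \<longlongrightarrow> 0) at_top" for j
      by (rule filterlim_compose[OF sincJ_at_bot[OF h] filterlim_uminus_at_bot_at_top])
    ultimately have "((\<lambda>X. E X - ?T) \<longlongrightarrow> norm (Q \<xi> - 0 - (\<Sum>j=-int N..int N. F (of_real (of_int j * h)) * of_real (sincJ j h \<xi> - 0))) - ?T) at_top"
      unfolding E_def f_def by (intro tendsto_diff tendsto_norm tendsto_const tendsto_sum tendsto_mult tendsto_of_real)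
    then show "((\<lambda>X. E X - ?T) \<longlongrightarrow> ?E - ?T) at_top" by simp
    show "\<forall>\<^sub>F X in at_top. E X - ?T \<le> h * (2 / y + 2 * (1 + 1 / y\<^sup>2)) * B / sinh (pi * y / h)"
      using eventually_gt_at_top[of "\<bar>\<xi>\<bar>"] by eventually_elim (use fixed[OF y] in simp)
  qed simp
  then have "?E - ?T \<le> h * (2 / d + 2 * (1 + 1 / d\<^sup>2)) * B / sinh (pi * d / h)"
  proof (rule continuity_in_width[OF h, rotated])
    have "sinh (pi * d / h) \<noteq> 0" using h d_pos by simp
    then show "continuous (at_left d) (\<lambda>y. h * (2 / y + 2 * (1 + 1 / y\<^sup>2)) * B / sinh (pi * y / h))"
      unfolding continuous_within using h d_pos by (auto intro!: tendsto_eq_intros)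
  qed
  then show ?thesis by simp
qed

end

section \<open>Discrete stability and the Lebesgue constant\<close>

lemma sum_times_exp_partial_sums_le:
  fixes p :: "nat \<Rightarrow> real"
  assumes "\<And>j. 0 \<le> p j"
  shows "(\<Sum>j<i. p j * exp (\<Sum>l<j. p l)) \<le> exp (\<Sum>j<i. p j) - 1"
proof (induction i)
  case (Suc i)
  define s where "s = (\<Sum>j<i. p j)"
  have "exp s * (1 + p i) \<le> exp s * exp (p i)" by (intro mult_left_mono exp_ge_add_one_self) auto
  then have "p i * exp s \<le> exp (s + p i) - exp s" by (simp add: exp_add algebra_simps)
  then show ?case using Suc by (simp add: s_def)
qed simp

text \<open>
  Strong induction; the sum of the exponential bounds telescopes because \<open>p exp s \<le> exp (s + p) - exp s\<close>.
\<close>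

lemma discrete_gronwall:
  fixes p y :: "nat \<Rightarrow> real"
  assumes p: "\<And>j. 0 \<le> p j" and \<eta>: "0 \<le> \<eta>"
    and y: "\<And>i. i < n \<Longrightarrow> y i \<le> \<eta> + (\<Sum>j<i. p j * y j)" and i: "i < n"
  shows "y i \<le> \<eta> * exp (\<Sum>j<i. p j)"
  using i
proof (induction i rule: less_induct)
  case (less i)
  have "y i \<le> \<eta> + (\<Sum>j<i. p j * y j)" using y less.prems by blast
  also have "\<dots> \<le> \<eta> + (\<Sum>j<i. p j * (\<eta> * exp (\<Sum>l<j. p l)))"
    using less p by (intro add_left_mono sum_mono mult_left_mono) auto
  also have "\<dots> = \<eta> + \<eta> * (\<Sum>j<i. p j * exp (\<Sum>l<j. p l))" by (simp add: sum_distrib_left mult_ac)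
  also have "\<dots> \<le> \<eta> + \<eta> * (exp (\<Sum>j<i. p j) - 1)"
    using \<eta> sum_times_exp_partial_sums_le[of p i] p by (intro add_left_mono mult_left_mono) auto
  finally show ?case by (simp add: algebra_simps)
qed

text \<open>
  The strictly lower part is absorbed by the Gronwall inequality and the remaining part by the smallness
  of its row sums, both in the maximum norm.
\<close>

lemma almost_lower_triangular_stability:
  fixes A :: "nat \<Rightarrow> nat \<Rightarrow> complex" and x f :: "nat \<Rightarrow> complex"
  assumes p: "\<And>j. 0 \<le> p j" "(\<Sum>j<n. p j) \<le> P"
    and low: "\<And>i j. j < i \<Longrightarrow> i < n \<Longrightarrow> norm (A i j) \<le> p j"
    and up: "\<And>i. i < n \<Longrightarrow> (\<Sum>j\<in>{i..<n}. norm (A i j)) \<le> \<rho>" and small: "exp P * \<rho> \<le> 1 / 2"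
    and eq: "\<And>i. i < n \<Longrightarrow> x i - (\<Sum>j<n. A i j * x j) = f i"
    and f: "\<And>i. i < n \<Longrightarrow> norm (f i) \<le> \<phi>" and i: "i < n"
  shows "norm (x i) \<le> 2 * exp P * \<phi>"
proof -
  \<comment> \<open>Rows are closed by bounding the perturbation through the maximum norm of \<open>x\<close>, which is absorbed at the end.\<close>
  define m where "m = Max ((\<lambda>i. norm (x i)) ` {..<n})"
  have m: "norm (x j) \<le> m" if "j < n" for j unfolding m_def using that by (intro Max_ge) auto
  have m0: "0 \<le> m" using m[OF i] norm_ge_zero order_trans by blast
  have \<rho>0: "0 \<le> \<rho>" using up[OF i] sum_nonneg[of "{i..<n}" "\<lambda>j. norm (A i j)"] by simp
  have \<phi>0: "0 \<le> \<phi>" using f[OF i] norm_ge_zero order_trans by blast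
  have step: "norm (x l) \<le> (\<phi> + \<rho> * m) + (\<Sum>j<l. p j * norm (x j))" if l: "l < n" for l
  proof -
    have "{..<n} = {..<l} \<union> {l..<n}" using l by auto
    then have "(\<Sum>j<n. A l j * x j) = (\<Sum>j<l. A l j * x j) + (\<Sum>j\<in>{l..<n}. A l j * x j)"
      by (simp add: sum.union_disjoint ivl_disj_int_one(2))
    then have "x l = f l + (\<Sum>j\<in>{l..<n}. A l j * x j) + (\<Sum>j<l. A l j * x j)" using eq[OF l] by (simp add: algebra_simps)
    then have "norm (x l) \<le> norm (f l) + norm (\<Sum>j\<in>{l..<n}. A l j * x j) + norm (\<Sum>j<l. A l j * x j)"
      using norm_triangle_ineq[of "f l + (\<Sum>j\<in>{l..<n}. A l j * x j)" "\<Sum>j<l. A l j * x j"]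
        norm_triangle_ineq[of "f l" "\<Sum>j\<in>{l..<n}. A l j * x j"] by simp
    moreover have "norm (\<Sum>j\<in>{l..<n}. A l j * x j) \<le> (\<Sum>j\<in>{l..<n}. norm (A l j) * m)"
      using m by (intro sum_norm_le) (auto simp: norm_mult intro!: mult_left_mono)
    moreover have "\<dots> \<le> \<rho> * m" unfolding sum_distrib_right[symmetric] using up[OF l] m0 by (intro mult_right_mono)
    moreover have "norm (\<Sum>j<l. A l j * x j) \<le> (\<Sum>j<l. p j * norm (x j))"
      using low l by (intro sum_norm_le) (auto simp: norm_mult intro!: mult_right_mono)
    ultimately show ?thesis using f[OF l] by linarith
  qed
  have bd: "norm (x l) \<le> (\<phi> + \<rho> * m) * exp P" if l: "l < n" for l
  proof -
    have "norm (x l) \<le> (\<phi> + \<rho> * m) * exp (\<Sum>j<l. p j)"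
      by (rule discrete_gronwall[where n = n]) (use p step l \<phi>0 \<rho>0 m0 in auto)
    also have "\<dots> \<le> (\<phi> + \<rho> * m) * exp P"
    proof (intro mult_left_mono)
      have "(\<Sum>j<l. p j) \<le> (\<Sum>j<n. p j)" using l p by (intro sum_mono2) auto
      then show "exp (\<Sum>j<l. p j) \<le> exp P" using p by simp
    qed (use \<phi>0 \<rho>0 m0 in auto)
    finally show ?thesis .
  qed
  have "m \<in> (\<lambda>i. norm (x i)) ` {..<n}" unfolding m_def using i by (intro Max_in) auto
  then have "m \<le> (\<phi> + \<rho> * m) * exp P" using bd by auto
  also have "\<dots> = exp P * \<phi> + (exp P * \<rho>) * m" by (simp add: algebra_simps)
  also have "\<dots> \<le> exp P * \<phi> + 1 / 2 * m" using small m0 by (intro add_left_mono mult_right_mono) auto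
  finally show ?thesis using m[OF i] by simp
qed

text \<open>
  At most \<open>2 \<surd>N + 1\<close> nodes lie within distance \<open>\<surd>N h\<close> of \<open>x\<close>, each contributing at most \<open>1\<close>, and each of the
  others contributes at most \<open>1 / (3 \<surd>N)\<close>. The true growth is logarithmic, but the convergence rate has a
  factor \<open>\<surd>N\<close> anyway.
\<close>

lemma sinc_lebesgue_constant:
  assumes h: "0 < h" and N: "1 \<le> N"
  shows "(\<Sum>j=-int N..int N. \<bar>sincS j h x\<bar>) \<le> 4 * sqrt (real N)"
proof -
  define y where "y = x / h"
  define r where "r = sqrt (real N)"
  have r: "1 \<le> r" "r * r = real N" using N by (simp_all add: r_def)
  have far: "\<bar>sincS j h x\<bar> \<le> 1 / (3 * r)" if j: "r < \<bar>y - of_int j\<bar>" for j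
  proof -
    define v where "v = pi * (x - of_int j * h) / h"
    have v: "v = pi * (y - of_int j)" using h by (simp add: v_def y_def field_simps)
    have v3: "3 * r \<le> \<bar>v\<bar>" unfolding v abs_mult using j r pi_gt3 by (intro mult_mono) auto
    have "sincS j h x = sin v / v" using j r h by (auto simp: sincS_def v_def y_def)
    then have "\<bar>sincS j h x\<bar> = \<bar>sin v\<bar> / \<bar>v\<bar>" by simp
    also have "\<dots> \<le> 1 / (3 * r)" using v3 r by (intro frac_le) auto
    finally show ?thesis .
  qed
  define near where "near = {\<lceil>y - r\<rceil>..\<lfloor>y + r\<rfloor>}"
  have near: "real (card near) \<le> 2 * r + 1"
  proof -
    have "real (card near) = real_of_int (max 0 (\<lfloor>y + r\<rfloor> - \<lceil>y - r\<rceil> + 1))" by (simp add: near_def)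
    then show ?thesis using r by linarith
  qed
  have "(\<Sum>j=-int N..int N. \<bar>sincS j h x\<bar>) \<le> (\<Sum>j=-int N..int N. (if j \<in> near then 1 else 0) + 1 / (3 * r))"
  proof (intro sum_mono)
    fix j assume "j \<in> {- int N..int N}"
    show "\<bar>sincS j h x\<bar> \<le> (if j \<in> near then 1 else 0) + 1 / (3 * r)"
    proof (cases "j \<in> near")
      case True then show ?thesis using sincS_le_1[of j h x] r by (simp add: add_increasing2)
    next
      case False
      then have "of_int j < y - r \<or> y + r < of_int j" by (auto simp: near_def ceiling_le_iff le_floor_iff)
      then have "r < \<bar>y - of_int j\<bar>" by linarith
      then show ?thesis using far False by simp
    qed
  qed
  also have "\<dots> = real (card ({-int N..int N} \<inter> near)) + real (2 * N + 1) * (1 / (3 * r))"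
    by (simp add: sum.distrib sum.If_cases)
  also have "\<dots> \<le> (2 * r + 1) + real (2 * N + 1) * (1 / (3 * r))"
  proof (intro add_right_mono order_trans[OF _ near])
    show "real (card ({-int N..int N} \<inter> near)) \<le> real (card near)"
      unfolding of_nat_le_iff by (intro card_mono) (auto simp: near_def)
  qed
  also have "real (2 * N + 1) * (1 / (3 * r)) \<le> (3 * (r * r)) * (1 / (3 * r))"
    unfolding r(2) using N r by (intro mult_right_mono) auto
  also have "\<dots> = r" using r(1) by simp
  finally show ?thesis using r(1) unfolding r_def by linarith
qed

text \<open>
  Translates between matrix positions \<open>0, \<dots>, 2N\<close> and Sinc indices \<open>-N, \<dots>, N\<close>.
\<close>

lemma sum_positions_eq:
  fixes f :: "int \<Rightarrow> 'a::comm_monoid_add"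
  shows "(\<Sum>q<2 * N + 1. f (int q - int N)) = (\<Sum>j=-int N..int N. f j)"
  by (rule sum.reindex_bij_witness[where i = "\<lambda>j. nat (j + int N)" and j = "\<lambda>q. int q - int N"]) auto

lemma sum_delta_matrix_row:
  fixes f :: "nat \<Rightarrow> 'a::comm_semiring_1"
  assumes "q < (n::nat)"
  shows "(\<Sum>l<n. f l * (if l = q then 1 else 0)) = f q"
  using assms by (simp add: if_distrib cong: if_cong)

section \<open>Analytic continuation of the solution\<close>

lemma exp_scale_le: "\<alpha> \<le> 1 \<Longrightarrow> 0 \<le> x \<Longrightarrow> exp (- x) \<le> exp (- \<alpha> * (x::real))"
  using mult_right_mono[of \<alpha> 1 x] by simp

lemma exp_decay_imp_quartic_decay:
  fixes \<alpha> x :: real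
  assumes "0 < \<alpha>"
  shows "exp (- \<alpha> * \<bar>x\<bar>) \<le> (max 1 (4 / \<alpha>)) ^ 4 / (1 + x\<^sup>2)\<^sup>2"
proof -
  define c where "c = max 1 (4 / \<alpha>)"
  \<comment> \<open>The quarter is chosen so that \<open>exp y\<close> to the fourth power is the given exponential.\<close>
  define y where "y = \<alpha> * \<bar>x\<bar> / 4"
  have c: "1 \<le> c" "4 / \<alpha> \<le> c" by (simp_all add: c_def)
  have y: "0 \<le> y" using assms by (simp add: y_def)
  have "\<bar>x\<bar> = 4 / \<alpha> * y" using assms by (simp add: y_def)
  also have "\<dots> \<le> c * y" using c y by (intro mult_right_mono)
  finally have x: "1 + \<bar>x\<bar> \<le> c * (1 + y)" using c by (simp add: algebra_simps)
  have "1 + x\<^sup>2 \<le> (1 + \<bar>x\<bar>)\<^sup>2" by (simp add: power2_eq_square algebra_simps)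
  then have "(1 + x\<^sup>2)\<^sup>2 \<le> ((1 + \<bar>x\<bar>)\<^sup>2)\<^sup>2" by (intro power_mono) auto
  also have "\<dots> = (1 + \<bar>x\<bar>) ^ 4" by simp
  also have "\<dots> \<le> (c * (1 + y)) ^ 4" using x by (intro power_mono) auto
  also have "\<dots> = c ^ 4 * (1 + y) ^ 4" by (rule power_mult_distrib)
  also have "\<dots> \<le> c ^ 4 * exp y ^ 4" using c y by (intro mult_left_mono power_mono exp_ge_add_one_self) auto
  also have "exp y ^ 4 = exp (\<alpha> * \<bar>x\<bar>)" by (simp add: y_def flip: exp_of_nat_mult)
  finally have le: "(1 + x\<^sup>2)\<^sup>2 \<le> c ^ 4 * exp (\<alpha> * \<bar>x\<bar>)" .
  have "0 < (1 + x\<^sup>2)\<^sup>2" by (intro zero_less_power add_pos_nonneg) auto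
  then show ?thesis using le unfolding c_def[symmetric] by (simp add: le_divide_eq exp_minus field_simps)
qed

locale volterra_problem = strip_image +
  fixes \<alpha> :: real and g :: "complex \<Rightarrow> complex" and k :: "complex \<Rightarrow> complex \<Rightarrow> complex" and u :: "real \<Rightarrow> complex"
  assumes alpha: "0 < \<alpha>" "\<alpha> \<le> 1"
    and k1: "\<And>z. z \<in> D \<Longrightarrow> (\<lambda>w. k z w) \<in> Hinf D"
    and k2: "\<And>w. w \<in> D \<Longrightarrow> (\<lambda>z. k z w) \<in> Hinf D"
    and gM: "g \<in> Malpha a b \<alpha> D"
    and kM: "uniformly_Malpha a b \<alpha> D k"
    and u_cont: "continuous_on {a..b} u"
    and u_eq: "\<And>t. t \<in> {a..b} \<Longrightarrow>
      u t - integral {a..t} (\<lambda>s. k (of_real t) (of_real s) * u s) = g (of_real t)"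
begin

definition R :: real where "R = (b - a) / \<kappa>"

lemma R_pos: "0 < R" using ab kappa_pos by (simp add: R_def)

lemma near_a:
  assumes "\<zeta> \<in> strip d"
  shows "norm (psi a b \<zeta> - of_real a) \<le> R * exp (Re \<zeta>)" "norm (psi a b \<zeta> - of_real a) \<le> R"
proof -
  have "norm (psi a b \<zeta> - of_real a) \<le> R * min 1 (exp (Re \<zeta>))" using norm_minus_a_le[OF assms] by (simp add: R_def)
  moreover have "R * min 1 (exp (Re \<zeta>)) \<le> R * 1" "R * min 1 (exp (Re \<zeta>)) \<le> R * exp (Re \<zeta>)"
    using R_pos by (intro mult_left_mono; simp)+
  ultimately show "norm (psi a b \<zeta> - of_real a) \<le> R * exp (Re \<zeta>)" "norm (psi a b \<zeta> - of_real a) \<le> R" by simp_all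
qed

lemma near_b:
  assumes "\<zeta> \<in> strip d"
  shows "norm (of_real b - psi a b \<zeta>) \<le> R * exp (- Re \<zeta>)" "norm (of_real b - psi a b \<zeta>) \<le> R"
proof -
  have "norm (of_real b - psi a b \<zeta>) \<le> R * min 1 (exp (- Re \<zeta>))" using norm_b_minus_le[OF assms] by (simp add: R_def)
  moreover have "R * min 1 (exp (- Re \<zeta>)) \<le> R * 1" "R * min 1 (exp (- Re \<zeta>)) \<le> R * exp (- Re \<zeta>)"
    using R_pos by (intro mult_left_mono; simp)+
  ultimately show "norm (of_real b - psi a b \<zeta>) \<le> R * exp (- Re \<zeta>)" "norm (of_real b - psi a b \<zeta>) \<le> R" by simp_all
qed

lemma D_bounds:
  assumes "z \<in> D" shows "norm (z - of_real a) \<le> R" "norm (of_real b - z) \<le> R"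
proof -
  obtain \<zeta> where "\<zeta> \<in> strip d" "z = psi a b \<zeta>" using assms unfolding D_def by blast
  then show "norm (z - of_real a) \<le> R" "norm (of_real b - z) \<le> R" using near_a(2) near_b(2) by blast+
qed

lemma powr_exp_bound:
  assumes "0 \<le> n" "n \<le> R * exp y" shows "n powr \<alpha> \<le> R powr \<alpha> * exp (\<alpha> * y)"
proof -
  have "n powr \<alpha> \<le> (R * exp y) powr \<alpha>" using assms alpha by (intro powr_mono2) auto
  also have "\<dots> = R powr \<alpha> * exp (\<alpha> * y)" using R_pos by (simp add: powr_mult exp_powr_real mult.commute)
  finally show ?thesis .
qed

lemma Hinf_holomorphic: "f \<in> Hinf S \<Longrightarrow> f holomorphic_on S"
  by (simp add: Hinf_def analytic_imp_holomorphic)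

lemma holomorphic_data:
  "g holomorphic_on D" "z \<in> D \<Longrightarrow> k z holomorphic_on D" "w \<in> D \<Longrightarrow> (\<lambda>z. k z w) holomorphic_on D"
proof -
  have "g \<in> Hinf D" using gM by (simp add: Malpha_def)
  then show "g holomorphic_on D" by (rule Hinf_holomorphic)
  show "k z holomorphic_on D" if "z \<in> D" using k1[OF that] by (rule Hinf_holomorphic)
  show "(\<lambda>z. k z w) holomorphic_on D" if "w \<in> D" using k2[OF that] by (rule Hinf_holomorphic)
qed

text \<open>
  Boundedness of \<open>k(z,\<cdot>)\<close> is given only separately for each \<open>z\<close>; the uniform Hoelder condition at \<open>b\<close> makes
  it uniform, since every \<open>k(z,w)\<close> differs from \<open>k(z\<^sub>0,w)\<close> by a bounded amount on the bounded set \<open>D\<close>.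
\<close>

lemma kernel_bounds:
  obtains K L where "0 \<le> K" "0 \<le> L"
    "\<And>z w. z \<in> D \<Longrightarrow> w \<in> D \<Longrightarrow> norm (k z w) \<le> K"
    "\<And>z z' w. z \<in> D \<Longrightarrow> z' \<in> D \<Longrightarrow> w \<in> D \<Longrightarrow> norm (k z w - k z' w)
      \<le> L * (norm (of_real b - z) powr \<alpha> + norm (of_real b - z') powr \<alpha>)"
    "\<And>z. z \<in> D \<Longrightarrow> norm (g z) \<le> K"
    "\<And>z. z \<in> D \<Longrightarrow> norm (g z - g (of_real a)) \<le> L * norm (z - of_real a) powr \<alpha>"
    "\<And>z. z \<in> D \<Longrightarrow> norm (g (of_real b) - g z) \<le> L * norm (of_real b - z) powr \<alpha>"
proof -
  obtain L1 where L1: "\<And>z w. z \<in> D \<Longrightarrow> w \<in> D \<Longrightarrow> norm (k (of_real b) w - k z w) \<le> L1 * norm (of_real b - z) powr \<alpha>"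
    using kM unfolding uniformly_Malpha_def by blast
  obtain L2 where L2: "\<And>z. z \<in> D \<Longrightarrow> norm (g z - g (of_real a)) \<le> L2 * norm (z - of_real a) powr \<alpha>"
    "\<And>z. z \<in> D \<Longrightarrow> norm (g (of_real b) - g z) \<le> L2 * norm (of_real b - z) powr \<alpha>"
    using gM unfolding Malpha_def by blast
  define L where "L = max 0 (max L1 L2)"
  have L: "0 \<le> L" "L1 \<le> L" "L2 \<le> L" by (simp_all add: L_def)
  have kd: "norm (k z w - k z' w) \<le> L * (norm (of_real b - z) powr \<alpha> + norm (of_real b - z') powr \<alpha>)"
    if "z \<in> D" "z' \<in> D" "w \<in> D" for z z' w
  proof -
    have m: "L1 * norm (of_real b - z) powr \<alpha> \<le> L * norm (of_real b - z) powr \<alpha>" for z :: complex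
      using L by (intro mult_right_mono) auto
    have "norm (k z w - k z' w) \<le> norm (k (of_real b) w - k z' w) + norm (k (of_real b) w - k z w)"
      using norm_triangle_ineq4[of "k (of_real b) w - k z' w" "k (of_real b) w - k z w"] by simp
    then show ?thesis using L1[OF that(1,3)] L1[OF that(2,3)] m[of z] m[of z'] by (simp add: distrib_left)
  qed
  have "0 \<in> strip d" using d0 by (simp add: strip_def)
  then obtain z0 where z0: "z0 \<in> D" by (auto simp: D_def)
  obtain K0 where K0: "\<And>w. w \<in> D \<Longrightarrow> norm (k z0 w) \<le> K0"
    using k1[OF z0] unfolding Hinf_def bounded_iff by auto
  obtain K1 where K1: "\<And>w. w \<in> D \<Longrightarrow> norm (g w) \<le> K1"
    using gM unfolding Malpha_def Hinf_def bounded_iff by auto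
  define K where "K = \<bar>K0\<bar> + \<bar>K1\<bar> + L * (R powr \<alpha> + R powr \<alpha>)"
  have LR: "0 \<le> L * (R powr \<alpha> + R powr \<alpha>)" using L by simp
  show ?thesis
  proof (rule that[of K L])
    show "norm (k z w) \<le> K" if "z \<in> D" "w \<in> D" for z w
    proof -
      have "norm (k z w - k z0 w) \<le> L * (norm (of_real b - z) powr \<alpha> + norm (of_real b - z0) powr \<alpha>)"
        by (rule kd) (use that z0 in auto)
      also have "\<dots> \<le> L * (R powr \<alpha> + R powr \<alpha>)"
        using D_bounds(2) that z0 L alpha by (intro mult_left_mono add_mono powr_mono2) auto
      finally have "norm (k z w - k z0 w) \<le> L * (R powr \<alpha> + R powr \<alpha>)" .
      moreover have "norm (k z w) \<le> norm (k z w - k z0 w) + norm (k z0 w)"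
        using norm_triangle_ineq[of "k z w - k z0 w" "k z0 w"] by simp
      ultimately show ?thesis using K0[OF that(2)] unfolding K_def by linarith
    qed
    show "norm (g z) \<le> K" if "z \<in> D" for z using K1[OF that] LR unfolding K_def by linarith
    show "0 \<le> K" using LR unfolding K_def by linarith
    show "norm (g z - g (of_real a)) \<le> L * norm (z - of_real a) powr \<alpha>" if "z \<in> D" for z
      using L2(1)[OF that] mult_right_mono[OF L(3), of "norm (z - of_real a) powr \<alpha>"] by simp
    show "norm (g (of_real b) - g z) \<le> L * norm (of_real b - z) powr \<alpha>" if "z \<in> D" for z
      using L2(2)[OF that] mult_right_mono[OF L(3), of "norm (of_real b - z) powr \<alpha>"] by simp
  qed (use L kd in auto)
qed

end

text \<open>
  Fixes constants as they are provided by \<open>kernel_bounds\<close>, so that later bounds can be explicit in them.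
\<close>

locale volterra_problem_bounds = volterra_problem +
  fixes K L :: real
  assumes K0: "0 \<le> K" and L0: "0 \<le> L"
    and k_le: "\<And>z w. z \<in> D \<Longrightarrow> w \<in> D \<Longrightarrow> norm (k z w) \<le> K"
    and k_diff: "\<And>z z' w. z \<in> D \<Longrightarrow> z' \<in> D \<Longrightarrow> w \<in> D \<Longrightarrow> norm (k z w - k z' w)
      \<le> L * (norm (of_real b - z) powr \<alpha> + norm (of_real b - z') powr \<alpha>)"
    and g_le: "\<And>z. z \<in> D \<Longrightarrow> norm (g z) \<le> K"
    and g_a: "\<And>z. z \<in> D \<Longrightarrow> norm (g z - g (of_real a)) \<le> L * norm (z - of_real a) powr \<alpha>"
    and g_b: "\<And>z. z \<in> D \<Longrightarrow> norm (g (of_real b) - g z) \<le> L * norm (of_real b - z) powr \<alpha>"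
begin

lemma volterra_kernel_D: "holomorphic_volterra_kernel (of_real a) D k K R"
proof unfold_locales
  show "of_real a + of_real s * (z - of_real a) \<in> D" if "z \<in> D" "0 < s" "s < 1" for z s
    using star_D[OF that(1,2)] that(3) by simp
  show "continuous_on D (k z)" if "z \<in> D" for z
    using holomorphic_data(2)[OF that] by (rule holomorphic_on_imp_continuous_on)
  show "norm (z - of_real a) \<le> R" if "z \<in> D" for z using that by (rule D_bounds(1))
qed (use open_D k_le holomorphic_data in blast)+

text \<open>
  The complex equation is solved first. Its solution, restricted to \<open>(a,b)\<close>, solves the real equation
  and so equals \<open>u\<close>.
\<close>

lemma solution_extension:
  obtains U M where "U holomorphic_on D" "0 \<le> M" "\<And>z. z \<in> D \<Longrightarrow> norm (U z) \<le> M"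
    "\<And>z. z \<in> D \<Longrightarrow> U z = g z + volterra (of_real a) k U z"
    "\<And>t. t \<in> {a<..<b} \<Longrightarrow> U (of_real t) = u t"
proof -
  interpret V: holomorphic_volterra_kernel "of_real a" D k K R by (rule volterra_kernel_D)
  obtain U M0 where U: "U holomorphic_on D" "\<And>z. z \<in> D \<Longrightarrow> norm (U z) \<le> M0"
      "\<And>z. z \<in> D \<Longrightarrow> U z = g z + volterra (of_real a) k U z"
    using V.volterra_solution_exists[OF holomorphic_data(1) g_le] by blast
  define X where "X = complex_of_real ` {a<..<b}"
  have XD: "X \<subseteq> D" using real_in_D by (auto simp: X_def)
  interpret r: volterra_kernel "of_real a" X k K
  proof unfold_locales
    show "of_real a + of_real s * (z - of_real a) \<in> X" if z: "z \<in> X" and s: "0 < s" "s < 1" for z s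
    proof -
      obtain t where t: "z = of_real t" "t \<in> {a<..<b}" using z by (auto simp: X_def)
      have "s * (t - a) < 1 * (t - a)" using s t by (intro mult_strict_right_mono) auto
      moreover have "0 < s * (t - a)" using s t by simp
      ultimately have "a + s * (t - a) \<in> {a<..<b}" using t by auto
      moreover have "of_real a + of_real s * (z - of_real a) = complex_of_real (a + s * (t - a))" by (simp add: t)
      ultimately show ?thesis unfolding X_def by blast
    qed
    show "continuous_on X (k z)" if "z \<in> X" for z
      using V.k_cont XD that continuous_on_subset by blast
    show "norm (k z w) \<le> K" if "z \<in> X" "w \<in> X" for z w using k_le XD that by blast
  qed
  have "compact (u ` {a..b})" using u_cont by (intro compact_continuous_image compact_Icc)
  then have "bounded (u ` {a..b})" by (rule compact_imp_bounded)
  then obtain B where "\<forall>x\<in>u ` {a..b}. norm x \<le> B" unfolding bounded_iff by blast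
  then have B: "norm (u t) \<le> B" if "t \<in> {a..b}" for t using that by simp
  have "U (of_real t) = u t" if t: "t \<in> {a<..<b}" for t
  proof -
    have "U (of_real t) = (\<lambda>z. u (Re z)) (of_real t)"
    proof (rule r.volterra_unique[where u = U and v = "\<lambda>z. u (Re z)" and g = g and P = M0 and Q = B and z = "of_real t"])
      show "continuous_on X U" using U(1) XD holomorphic_on_imp_continuous_on continuous_on_subset by blast
      show "continuous_on X (\<lambda>z. u (Re z))"
        by (rule continuous_on_compose2[OF u_cont]) (auto simp: X_def intro!: continuous_intros)
      show "u (Re z) = g z + volterra (of_real a) k (\<lambda>z. u (Re z)) z" if zX: "z \<in> X" for z
      proof -
        obtain s where s: "z = of_real s" "s \<in> {a<..<b}" using zX by (auto simp: X_def)
        then have "volterra (of_real a) k (\<lambda>z. u (Re z)) z = integral {a..s} (\<lambda>r. k (of_real s) (of_real r) * u r)"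
          using volterra_of_real[of a s k "\<lambda>z. u (Re z)"] by simp
        then show ?thesis using u_eq[of s] s by (simp add: algebra_simps)
      qed
      show "norm (u (Re z)) \<le> B" if "z \<in> X" for z using B that by (auto simp: X_def)
      show "of_real t \<in> X" using t by (auto simp: X_def)
    qed (use U XD in blast)+
    then show ?thesis by simp
  qed
  moreover have "0 \<le> max 0 M0" "\<And>z. z \<in> D \<Longrightarrow> norm (U z) \<le> max 0 M0" using U(2) by (auto simp: le_max_iff_disj)
  ultimately show ?thesis using that[of U "max 0 M0"] U by blast
qed

end

lemma (in strip_image) psi'_of_real: "psi' (of_real x) = of_real (deriv (psi a b) x)"
  and deriv_psi_le: "\<bar>deriv (psi a b) x\<bar> \<le> (b - a) / \<kappa>\<^sup>2 * exp (- \<bar>x\<bar>)"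
proof -
  have p: "1 + exp (- x) \<noteq> 0" using add_pos_pos[of 1 "exp (- x)"] by simp
  have "((\<lambda>x. a + (b - a) / (1 + exp (- x))) has_real_derivative (b - a) * exp (- x) / (1 + exp (- x))\<^sup>2) (at x)"
    using p by (auto intro!: derivative_eq_intros simp: power2_eq_square)
  then have "deriv (psi a b) x = (b - a) * exp (- x) / (1 + exp (- x))\<^sup>2"
    unfolding psi_real[abs_def] by (rule DERIV_imp_deriv)
  moreover have "exp (- complex_of_real x) = of_real (exp (- x))" by (simp flip: exp_of_real of_real_minus)
  ultimately show *: "psi' (of_real x) = of_real (deriv (psi a b) x)" unfolding psi'_def by simp
  have "\<bar>deriv (psi a b) x\<bar> = norm (psi' (of_real x))" unfolding * by simp
  also have "\<dots> \<le> (b - a) / \<kappa>\<^sup>2 * exp (- \<bar>x\<bar>)"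
    using norm_psi'_le[of "of_real x"] d0 by (simp add: strip_def)
  finally show "\<bar>deriv (psi a b) x\<bar> \<le> (b - a) / \<kappa>\<^sup>2 * exp (- \<bar>x\<bar>)" .
qed

text \<open>
  Fixes a continuation of \<open>u\<close> as it is provided by \<open>solution_extension\<close>.
\<close>

locale volterra_extension = volterra_problem_bounds +
  fixes U :: "complex \<Rightarrow> complex" and M :: real
  assumes U_hol: "U holomorphic_on D" and M0: "0 \<le> M"
    and U_le: "\<And>z. z \<in> D \<Longrightarrow> norm (U z) \<le> M"
    and U_eq: "\<And>z. z \<in> D \<Longrightarrow> U z = g z + volterra (of_real a) k U z"
    and U_real: "\<And>t. t \<in> {a<..<b} \<Longrightarrow> U (of_real t) = u t"
begin

interpretation V: holomorphic_volterra_kernel "of_real a" D k K R by (rule volterra_kernel_D)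

lemma constant_kernel:
  assumes "q holomorphic_on D" "\<And>w. w \<in> D \<Longrightarrow> norm (q w) \<le> B"
  shows "holomorphic_volterra_kernel (of_real a) D (\<lambda>_. q) B R"
proof unfold_locales
  show "of_real a + of_real s * (z - of_real a) \<in> D" if "z \<in> D" "0 < s" "s < 1" for z s using that by (rule V.star)
  show "continuous_on D q" using assms(1) by (rule holomorphic_on_imp_continuous_on)
  show "norm (z - of_real a) \<le> R" if "z \<in> D" for z using that by (rule D_bounds(1))
  show "norm (q w) \<le> B" if "w \<in> D" for w using that by (rule assms(2))
qed (use open_D assms(1) in simp_all)

text \<open>
  The primitive that vanishes at the boundary point \<open>a\<close>.
\<close>

definition primitive :: "(complex \<Rightarrow> complex) \<Rightarrow> complex \<Rightarrow> complex" where
  "primitive q = volterra (of_real a) (\<lambda>_. q) (\<lambda>_. 1)"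

context
  fixes q :: "complex \<Rightarrow> complex" and B :: real
  assumes q: "q holomorphic_on D" "\<And>w. w \<in> D \<Longrightarrow> norm (q w) \<le> B"
begin

lemma bound_nonneg: "0 \<le> B"
  using order_trans[OF norm_ge_zero q(2)[OF psi_in_D[OF real_in_strip[of 0]]]] .

lemma primitive_deriv: "z \<in> D \<Longrightarrow> (primitive q has_field_derivative q z) (at z)"
  unfolding primitive_def using q by (rule V.volterra_const_kernel_derivative)

lemma primitive_le: "z \<in> D \<Longrightarrow> norm (primitive q z) \<le> B * norm (z - of_real a)"
proof -
  interpret c: holomorphic_volterra_kernel "of_real a" D "\<lambda>_. q" B R by (rule constant_kernel[OF q])
  assume "z \<in> D"
  then show ?thesis unfolding primitive_def using c.volterra_bound[of "\<lambda>_. 1" 1 z] by simp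
qed

lemma primitive_psi_deriv:
  assumes "\<zeta> \<in> strip d"
  shows "((\<lambda>\<zeta>. primitive q (psi a b \<zeta>)) has_field_derivative q (psi a b \<zeta>) * psi' \<zeta>) (at \<zeta>)"
  by (rule DERIV_chain2[OF primitive_deriv[OF psi_in_D[OF assms]] psi_has_derivative[OF assms]])

text \<open>
  In the \<open>\<zeta>\<close>-plane the path from \<open>\<zeta>\<close> down to the real axis is a vertical segment, along which \<open>\<psi>'\<close> is of
  size \<open>exp (- \<bar>Re \<zeta>\<bar>)\<close>.
\<close>

lemma primitive_vertical:
  assumes \<zeta>: "\<zeta> \<in> strip d"
  shows "norm (primitive q (psi a b \<zeta>) - primitive q (psi a b (of_real (Re \<zeta>)))) \<le> B * ((b - a) / \<kappa>\<^sup>2 * exp (- \<bar>Re \<zeta>\<bar>)) * d"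
proof -
  define S where "S = closed_segment (of_real (Re \<zeta>)) \<zeta>"
  have S: "z \<in> strip d \<and> Re z = Re \<zeta>" if "z \<in> S" for z
  proof -
    have "Re z = Re \<zeta> \<and> Im z \<in> closed_segment 0 (Im \<zeta>)"
      using that unfolding S_def by (subst (asm) closed_segment_same_Re) auto
    then show ?thesis using \<zeta> by (auto simp: strip_def closed_segment_eq_real_ivl split: if_splits)
  qed
  have "norm (primitive q (psi a b \<zeta>) - primitive q (psi a b (of_real (Re \<zeta>))))
      \<le> B * ((b - a) / \<kappa>\<^sup>2 * exp (- \<bar>Re \<zeta>\<bar>)) * norm (\<zeta> - of_real (Re \<zeta>))"
  proof (rule field_differentiable_bound[where S = S and f = "\<lambda>\<zeta>. primitive q (psi a b \<zeta>)"])
    show "convex S" unfolding S_def by (rule convex_closed_segment)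
    fix z assume z: "z \<in> S"
    show "((\<lambda>\<zeta>. primitive q (psi a b \<zeta>)) has_field_derivative q (psi a b z) * psi' z) (at z within S)"
      using primitive_psi_deriv S[OF z] by (blast intro: has_field_derivative_at_within)
    have "norm (psi' z) \<le> (b - a) / \<kappa>\<^sup>2 * exp (- \<bar>Re \<zeta>\<bar>)" using norm_psi'_le[of z] S[OF z] by simp
    then show "norm (q (psi a b z) * psi' z) \<le> B * ((b - a) / \<kappa>\<^sup>2 * exp (- \<bar>Re \<zeta>\<bar>))"
      unfolding norm_mult using q(2)[OF psi_in_D] S[OF z] bound_nonneg by (intro mult_mono) auto
  qed (auto simp: S_def)
  also have "\<dots> \<le> B * ((b - a) / \<kappa>\<^sup>2 * exp (- \<bar>Re \<zeta>\<bar>)) * d"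
  proof (intro mult_left_mono)
    have "\<zeta> - of_real (Re \<zeta>) = Complex 0 (Im \<zeta>)" by (simp add: complex_eq_iff)
    then have "norm (\<zeta> - of_real (Re \<zeta>)) = \<bar>Im \<zeta>\<bar>" by (simp add: cmod_def)
    then show "norm (\<zeta> - of_real (Re \<zeta>)) \<le> d" using \<zeta> by (simp add: strip_def)
  qed (use bound_nonneg ab in auto)
  finally show ?thesis .
qed

lemma primitive_real:
  assumes "s \<in> {a<..<b}" "t \<in> {a<..<b}"
  shows "norm (primitive q (of_real s) - primitive q (of_real t)) \<le> B * \<bar>s - t\<bar>"
proof -
  define S where "S = complex_of_real ` {a<..<b}"
  have SD: "S \<subseteq> D" using real_in_D by (auto simp: S_def)
  have "norm (primitive q (of_real s) - primitive q (of_real t)) \<le> B * norm (complex_of_real s - of_real t)"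
  proof (rule field_differentiable_bound[where S = S])
    show "convex S" unfolding S_def by (intro convex_linear_image) (auto intro: linear_of_real)
    fix z assume z: "z \<in> S"
    show "(primitive q has_field_derivative q z) (at z within S)"
      using primitive_deriv SD z by (blast intro: has_field_derivative_at_within)
    show "norm (q z) \<le> B" using q(2) SD z by blast
  qed (use assms in \<open>auto simp: S_def\<close>)
  also have "norm (complex_of_real s - of_real t) = \<bar>s - t\<bar>" by (simp flip: of_real_diff)
  finally show ?thesis .
qed

end

lemma kernel_times_solution: 
  assumes "z \<in> D"
  shows "(\<lambda>w. k z w * U w) holomorphic_on D" "\<And>w. w \<in> D \<Longrightarrow> norm (k z w * U w) \<le> K * M"
    "volterra (of_real a) k U z = primitive (\<lambda>w. k z w * U w) z"
proof -
  show "(\<lambda>w. k z w * U w) holomorphic_on D" by (intro holomorphic_intros holomorphic_data(2) assms U_hol)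
  show "norm (k z w * U w) \<le> K * M" if "w \<in> D" for w
    unfolding norm_mult using k_le[OF assms that] U_le[OF that] K0 by (intro mult_mono) auto
  show "volterra (of_real a) k U z = primitive (\<lambda>w. k z w * U w) z"
    by (simp add: primitive_def volterra_def)
qed

text \<open>
  Two effects are separated: the change of the kernel in its first argument, measured by its Hoelder
  condition at \<open>b\<close>, and the change of the upper limit, measured by the primitive for the kernel frozen at
  \<open>z'\<close>.
\<close>

lemma U_diff:
  assumes z: "z \<in> D" "z' \<in> D"
  shows "norm (U z - U z') \<le> L * (norm (of_real b - z) powr \<alpha> + norm (of_real b - z') powr \<alpha>) * (1 + M * R)
     + norm (primitive (\<lambda>w. k z' w * U w) z - primitive (\<lambda>w. k z' w * U w) z')"
proof -
  define \<epsilon> where "\<epsilon> = L * (norm (of_real b - z) powr \<alpha> + norm (of_real b - z') powr \<alpha>)"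
  have \<epsilon>0: "0 \<le> \<epsilon>" using L0 by (simp add: \<epsilon>_def)
  have gd: "norm (g z - g z') \<le> \<epsilon>"
    using g_b[OF z(1)] g_b[OF z(2)] norm_triangle_ineq4[of "g (of_real b) - g z'" "g (of_real b) - g z"]
    unfolding \<epsilon>_def by (simp add: distrib_left)
  have U_cont: "continuous_on D U" using U_hol by (rule holomorphic_on_imp_continuous_on)
  let ?q = "\<lambda>w. k z w - k z' w"
  interpret c: holomorphic_volterra_kernel "of_real a" D "\<lambda>_. ?q" \<epsilon> R
    by (rule constant_kernel) (use holomorphic_data(2) z k_diff in \<open>auto simp: \<epsilon>_def intro!: holomorphic_intros\<close>)
  interpret cz': holomorphic_volterra_kernel "of_real a" D "\<lambda>_. k z'" K R
    by (rule constant_kernel) (use holomorphic_data(2) z k_le in auto)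
  have "volterra (of_real a) k U z - volterra (of_real a) (\<lambda>_. k z') U z = volterra (of_real a) (\<lambda>_. ?q) U z"
    unfolding volterra_def
    using integral_diff[OF V.integrand_integrable[OF z(1) U_cont U_le] cz'.integrand_integrable[OF z(1) U_cont U_le], symmetric]
    by (simp add: algebra_simps)
  moreover have "volterra (of_real a) (\<lambda>_. k z') U z = primitive (\<lambda>w. k z' w * U w) z"
    by (simp add: primitive_def volterra_def)
  ultimately have eq: "U z - U z' = (g z - g z') + volterra (of_real a) (\<lambda>_. ?q) U z
      + (primitive (\<lambda>w. k z' w * U w) z - primitive (\<lambda>w. k z' w * U w) z')"
    unfolding U_eq[OF z(1)] U_eq[OF z(2)] kernel_times_solution(3)[OF z(2)] by (simp add: algebra_simps)
  have "norm (volterra (of_real a) (\<lambda>_. ?q) U z) \<le> \<epsilon> * M * norm (z - of_real a)"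
    by (rule c.volterra_bound[OF U_cont U_le z(1)])
  also have "\<dots> \<le> \<epsilon> * M * R" using D_bounds(1)[OF z(1)] \<epsilon>0 M0 by (intro mult_left_mono) auto
  finally have vb: "norm (volterra (of_real a) (\<lambda>_. ?q) U z) \<le> \<epsilon> * M * R" .
  have "norm (U z - U z') \<le> norm (g z - g z') + norm (volterra (of_real a) (\<lambda>_. ?q) U z)
      + norm (primitive (\<lambda>w. k z' w * U w) z - primitive (\<lambda>w. k z' w * U w) z')"
    unfolding eq by (intro norm_triangle_le add_mono order_trans[OF norm_triangle_ineq]) auto
  then show ?thesis using gd vb unfolding \<epsilon>_def[symmetric] by (simp add: algebra_simps)
qed

lemma U_near_a:
  assumes \<zeta>: "\<zeta> \<in> strip d" "Re \<zeta> \<le> 0"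
  shows "norm (U (psi a b \<zeta>) - u a) \<le> (L * R powr \<alpha> + K * M * R) * exp (- \<alpha> * \<bar>Re \<zeta>\<bar>)"
proof -
  define z where "z = psi a b \<zeta>"
  have z: "z \<in> D" using psi_in_D[OF \<zeta>(1)] by (simp add: z_def)
  have e: "exp (\<alpha> * Re \<zeta>) = exp (- \<alpha> * \<bar>Re \<zeta>\<bar>)" using \<zeta>(2) by simp
  have ua: "u a = g (of_real a)" using u_eq[of a] ab by simp
  have "norm (g z - g (of_real a)) \<le> L * norm (z - of_real a) powr \<alpha>" by (rule g_a[OF z])
  also have "\<dots> \<le> L * (R powr \<alpha> * exp (\<alpha> * Re \<zeta>))"
    using powr_exp_bound[OF norm_ge_zero near_a(1)[OF \<zeta>(1)]] L0 unfolding z_def by (intro mult_left_mono) auto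
  finally have 1: "norm (g z - g (of_real a)) \<le> L * R powr \<alpha> * exp (- \<alpha> * \<bar>Re \<zeta>\<bar>)" unfolding e by simp
  have "norm (volterra (of_real a) k U z) \<le> K * M * norm (z - of_real a)"
    by (rule V.volterra_bound[OF holomorphic_on_imp_continuous_on[OF U_hol] U_le z])
  also have "\<dots> \<le> K * M * (R * exp (- \<alpha> * \<bar>Re \<zeta>\<bar>))"
  proof (intro mult_left_mono)
    have "norm (z - of_real a) \<le> R * exp (- \<bar>Re \<zeta>\<bar>)" using near_a(1)[OF \<zeta>(1)] \<zeta>(2) by (simp add: z_def)
    also have "\<dots> \<le> R * exp (- \<alpha> * \<bar>Re \<zeta>\<bar>)" using R_pos alpha by (intro mult_left_mono exp_scale_le) auto
    finally show "norm (z - of_real a) \<le> R * exp (- \<alpha> * \<bar>Re \<zeta>\<bar>)" .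
  qed (use K0 M0 in auto)
  finally have 2: "norm (volterra (of_real a) k U z) \<le> K * M * R * exp (- \<alpha> * \<bar>Re \<zeta>\<bar>)" by simp
  have "U z - u a = (g z - g (of_real a)) + volterra (of_real a) k U z" unfolding ua U_eq[OF z] by simp
  then have "norm (U z - u a) \<le> norm (g z - g (of_real a)) + norm (volterra (of_real a) k U z)"
    by (simp only: norm_triangle_ineq)
  then show ?thesis using 1 2 unfolding z_def by (simp add: distrib_right)
qed

text \<open>
  The estimate for two interior points passes to the limit \<open>z' \<rightarrow> b\<close> along the real interval because \<open>u\<close> is
  continuous there.
\<close>

lemma u_near_b:
  assumes t: "t \<in> {a<..<b}"
  shows "norm (u t - u b) \<le> L * norm (complex_of_real b - of_real t) powr \<alpha> * (1 + M * R) + K * M * (b - t)"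
proof (rule tendsto_le)
  have "((\<lambda>s. u s) \<longlongrightarrow> u b) (at_left b)" by (rule continuous_on_Icc_at_leftD[OF u_cont ab])
  then show "((\<lambda>s. norm (u t - u s)) \<longlongrightarrow> norm (u t - u b)) (at_left b)" by (intro tendsto_intros)
  have "((\<lambda>s. norm (complex_of_real b - of_real s) powr \<alpha>) \<longlongrightarrow> 0) (at_left b)"
    by (rule tendsto_zero_powrI[where b = \<alpha>]) (use alpha in \<open>auto intro!: tendsto_eq_intros\<close>)
  then show "((\<lambda>s. L * (norm (complex_of_real b - of_real t) powr \<alpha> + norm (complex_of_real b - of_real s) powr \<alpha>) * (1 + M * R) + K * M * \<bar>t - s\<bar>) 
      \<longlongrightarrow> L * norm (complex_of_real b - of_real t) powr \<alpha> * (1 + M * R) + K * M * (b - t)) (at_left b)"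
    using t alpha by (auto intro!: tendsto_eq_intros)
  have "\<forall>\<^sub>F s in at_left b. s \<in> {a<..<b}" using eventually_at_left[OF ab] ab by auto
  then show "\<forall>\<^sub>F s in at_left b. norm (u t - u s) \<le> L * (norm (complex_of_real b - of_real t) powr \<alpha> + norm (complex_of_real b - of_real s) powr \<alpha>) * (1 + M * R) + K * M * \<bar>t - s\<bar>"
  proof eventually_elim
    case (elim s)
    note tD = real_in_D[OF t] and sD = real_in_D[OF elim]
    have "norm (u t - u s) \<le> L * (norm (complex_of_real b - of_real t) powr \<alpha> + norm (complex_of_real b - of_real s) powr \<alpha>) * (1 + M * R)
      + norm (primitive (\<lambda>w. k (of_real s) w * U w) (of_real t) - primitive (\<lambda>w. k (of_real s) w * U w) (of_real s))"
      using U_diff[OF tD sD] unfolding U_real[OF t] U_real[OF elim] .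
    also have "norm (primitive (\<lambda>w. k (of_real s) w * U w) (of_real t) - primitive (\<lambda>w. k (of_real s) w * U w) (of_real s)) \<le> K * M * \<bar>t - s\<bar>"
      by (rule primitive_real[OF kernel_times_solution(1,2)[OF sD] t elim])
    finally show ?case by simp
  qed
qed simp

text \<open>
  From \<open>\<psi>(\<zeta>)\<close> one moves vertically, in the \<open>\<zeta>\<close>-plane, to a real point and then along the interval to \<open>b\<close>.
\<close>

lemma U_near_b:
  assumes \<zeta>: "\<zeta> \<in> strip d" "0 \<le> Re \<zeta>"
  shows "norm (U (psi a b \<zeta>) - u b) \<le> (3 * (L * R powr \<alpha> * (1 + M * R)) + K * M * ((b - a) / \<kappa>\<^sup>2 * d + R)) * exp (- \<alpha> * \<bar>Re \<zeta>\<bar>)"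
proof -
  define x where "x = Re \<zeta>"
  define E where "E = exp (- \<alpha> * \<bar>x\<bar>)"
  have x: "0 \<le> x" using \<zeta> by (simp add: x_def)
  have xs: "complex_of_real x \<in> strip d" by (rule real_in_strip)
  define t where "t = psi a b x"
  have t: "t \<in> {a<..<b}" unfolding t_def by (rule psi_in_interval)
  have pt: "psi a b (of_real x) = complex_of_real t" by (simp add: t_def psi_of_real)
  have tD: "of_real t \<in> D" by (rule real_in_D[OF t])
  have expx: "exp (- x) \<le> E" using exp_scale_le[of \<alpha> x] alpha x by (simp add: E_def)
  have ex: "exp (\<alpha> * - x) = E" using x by (simp add: E_def)
  have 1: "norm (of_real b - psi a b \<zeta>) powr \<alpha> \<le> R powr \<alpha> * E"
    using powr_exp_bound[OF norm_ge_zero near_b(1)[OF \<zeta>(1)]] ex by (simp add: x_def)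
  have 2: "norm (complex_of_real b - of_real t) powr \<alpha> \<le> R powr \<alpha> * E"
    using powr_exp_bound[OF norm_ge_zero near_b(1)[OF xs]] ex unfolding pt by simp
  have MR: "0 \<le> 1 + M * R" using M0 R_pos by simp
  have "norm (U (psi a b \<zeta>) - U (of_real t)) \<le> L * (R powr \<alpha> * E + R powr \<alpha> * E) * (1 + M * R) + K * M * ((b - a) / \<kappa>\<^sup>2 * E) * d"
  proof (rule order_trans[OF U_diff[OF psi_in_D[OF \<zeta>(1)] tD]], intro add_mono mult_right_mono mult_left_mono)
    have "norm (primitive (\<lambda>w. k (of_real t) w * U w) (psi a b \<zeta>) - primitive (\<lambda>w. k (of_real t) w * U w) (of_real t))
       \<le> K * M * ((b - a) / \<kappa>\<^sup>2 * exp (- \<bar>x\<bar>)) * d"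
      using primitive_vertical[OF kernel_times_solution(1,2)[OF tD] \<zeta>(1)] unfolding x_def[symmetric] pt .
    also have "\<dots> \<le> K * M * ((b - a) / \<kappa>\<^sup>2 * E) * d"
      using expx x K0 M0 ab d0 by (intro mult_right_mono mult_left_mono) auto
    finally show "norm (primitive (\<lambda>w. k (of_real t) w * U w) (psi a b \<zeta>) - primitive (\<lambda>w. k (of_real t) w * U w) (of_real t))
       \<le> K * M * ((b - a) / \<kappa>\<^sup>2 * E) * d" .
  qed (use 1 2 L0 MR in auto)
  moreover have "norm (U (of_real t) - u b) \<le> L * (R powr \<alpha> * E) * (1 + M * R) + K * M * (R * E)"
    unfolding U_real[OF t]
  proof (rule order_trans[OF u_near_b[OF t]], intro add_mono mult_right_mono mult_left_mono)
    have "b - t \<le> norm (complex_of_real b - of_real t)" by (simp flip: of_real_diff)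
    also have "\<dots> \<le> R * exp (- x)" using near_b(1)[OF xs] unfolding pt by simp
    also have "\<dots> \<le> R * E" using expx R_pos by (intro mult_left_mono) auto
    finally show "b - t \<le> R * E" .
  qed (use 2 L0 MR K0 M0 in auto)
  moreover have "norm (U (psi a b \<zeta>) - u b) \<le> norm (U (psi a b \<zeta>) - U (of_real t)) + norm (U (of_real t) - u b)"
    by (rule order_trans[OF _ norm_triangle_ineq]) simp
  ultimately have "norm (U (psi a b \<zeta>) - u b) \<le> L * (R powr \<alpha> * E + R powr \<alpha> * E) * (1 + M * R) + K * M * ((b - a) / \<kappa>\<^sup>2 * E) * d
     + (L * (R powr \<alpha> * E) * (1 + M * R) + K * M * (R * E))" by linarith
  also have "\<dots> = (3 * (L * R powr \<alpha> * (1 + M * R)) + K * M * ((b - a) / \<kappa>\<^sup>2 * d + R)) * E"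
    by (simp add: algebra_simps)
  finally show ?thesis unfolding E_def x_def .
qed

text \<open>
  What is left of the solution after its end values have been interpolated linearly, as a function on the
  strip. This is the part that the Sinc functions of the method have to approximate.
\<close>

definition end_remainder :: "complex \<Rightarrow> complex" where
  "end_remainder \<zeta> = U (psi a b \<zeta>) - u a * ((of_real b - psi a b \<zeta>) / of_real (b - a)) - u b * ((psi a b \<zeta> - of_real a) / of_real (b - a))"

lemma end_remainder_holomorphic: "end_remainder holomorphic_on strip d"
proof -
  have "(\<lambda>\<zeta>. U (psi a b \<zeta>)) holomorphic_on strip d"
    using holomorphic_on_compose_gen[OF holomorphic_psi U_hol] psi_in_D by (auto simp: o_def)
  then show ?thesis unfolding end_remainder_def[abs_def] using ab
    by (intro holomorphic_intros holomorphic_psi) auto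
qed

text \<open>
  The weights \<open>\<omega>\<^sub>a + \<omega>\<^sub>b = 1\<close> turn the remainder into \<open>(U - u(a)) \<omega>\<^sub>a + (U - u(b)) \<omega>\<^sub>b\<close>. On either side of the
  imaginary axis one summand is small by Hoelder continuity and the other because its weight is.
\<close>

lemma end_remainder_decay:
  obtains C where "0 \<le> C" "\<And>\<zeta>. \<zeta> \<in> strip d \<Longrightarrow> norm (end_remainder \<zeta>) \<le> C * exp (- \<alpha> * \<bar>Re \<zeta>\<bar>)"
proof -
  define C1 where "C1 = L * R powr \<alpha> + K * M * R"
  define C2 where "C2 = 3 * (L * R powr \<alpha> * (1 + M * R)) + K * M * ((b - a) / \<kappa>\<^sup>2 * d + R)"
  define C3 where "C3 = M + norm (u a) + norm (u b)"
  have C: "0 \<le> C1" "0 \<le> C2" "0 \<le> C3"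
    using L0 K0 M0 R_pos ab d0 by (auto simp: C1_def C2_def C3_def intro!: add_nonneg_nonneg mult_nonneg_nonneg)
  define C where "C = (C1 + C2 + C3) / \<kappa>"
  show thesis
  proof (rule that[of C])
    show "0 \<le> C" using C kappa_pos by (simp add: C_def)
    fix \<zeta> assume \<zeta>: "\<zeta> \<in> strip d"
    define z where "z = psi a b \<zeta>"
    define E where "E = exp (- \<alpha> * \<bar>Re \<zeta>\<bar>)"
    have z: "z \<in> D" using psi_in_D[OF \<zeta>] by (simp add: z_def)
    define wa where "wa = (of_real b - z) / of_real (b - a)"
    define wb where "wb = (z - of_real a) / of_real (b - a)"
    have nz: "complex_of_real (b - a) \<noteq> 0" using ab by simp
    have w1: "wa + wb = 1"
    proof -
      have "wa + wb = (of_real b - z + (z - of_real a)) / of_real (b - a)" unfolding wa_def wb_def by (rule add_divide_distrib[symmetric])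
      then show ?thesis using nz by simp
    qed
    have eq: "end_remainder \<zeta> = (U z - u a) * wa + (U z - u b) * wb"
    proof -
      have "U z * wa + U z * wb = U z" using w1 by (simp flip: distrib_left)
      then show ?thesis unfolding end_remainder_def z_def[symmetric] wa_def[symmetric] wb_def[symmetric] by (simp add: algebra_simps)
    qed
    have na: "norm wa = norm (of_real b - z) / (b - a)" and nb: "norm wb = norm (z - of_real a) / (b - a)"
      unfolding wa_def wb_def norm_divide norm_of_real using ab by auto
    have wa_le: "norm wa \<le> 1 / \<kappa>" "norm wa \<le> exp (- Re \<zeta>) / \<kappa>"
      using near_b[OF \<zeta>] ab unfolding na z_def R_def by (auto simp: divide_le_eq mult.commute)
    have wb_le: "norm wb \<le> 1 / \<kappa>" "norm wb \<le> exp (Re \<zeta>) / \<kappa>"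
      using near_a[OF \<zeta>] ab unfolding nb z_def R_def by (auto simp: divide_le_eq mult.commute)
    have UC: "norm (U z - u a) \<le> C3" "norm (U z - u b) \<le> C3"
      using U_le[OF z] norm_triangle_ineq4[of "U z" "u a"] norm_triangle_ineq4[of "U z" "u b"]
        norm_ge_zero[of "u a"] norm_ge_zero[of "u b"] unfolding C3_def by linarith+
    have n: "norm (end_remainder \<zeta>) \<le> norm (U z - u a) * norm wa + norm (U z - u b) * norm wb"
      unfolding eq norm_mult[symmetric] by (rule norm_triangle_ineq)
    have expE: "exp (- \<bar>Re \<zeta>\<bar>) \<le> E" using exp_scale_le[of \<alpha> "\<bar>Re \<zeta>\<bar>"] alpha by (simp add: E_def)
    have E0: "0 \<le> E" by (simp add: E_def)
    show "norm (end_remainder \<zeta>) \<le> C * exp (- \<alpha> * \<bar>Re \<zeta>\<bar>)"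
    proof (cases "Re \<zeta> \<le> 0")
      case True
      have "norm wb \<le> E / \<kappa>" using wb_le(2) expE True kappa_pos by (intro order_trans[OF wb_le(2)] divide_right_mono) auto
      then have "norm (end_remainder \<zeta>) \<le> (C1 * E) * (1 / \<kappa>) + C3 * (E / \<kappa>)"
        using U_near_a[OF \<zeta> True] wa_le(1) UC(2) C E0 unfolding z_def[symmetric] C1_def[symmetric] E_def[symmetric]
        by (intro order_trans[OF n] add_mono mult_mono) auto
      also have "\<dots> = (C1 + C3) / \<kappa> * E" by (simp add: add_divide_distrib algebra_simps)
      also have "\<dots> \<le> C * E" unfolding C_def using C E0 kappa_pos by (intro mult_right_mono divide_right_mono) auto
      finally show ?thesis unfolding E_def .
    next
      case False
      then have r: "0 \<le> Re \<zeta>" by simp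
      have "norm wa \<le> E / \<kappa>" using wa_le(2) expE r kappa_pos by (intro order_trans[OF wa_le(2)] divide_right_mono) auto
      then have "norm (end_remainder \<zeta>) \<le> C3 * (E / \<kappa>) + (C2 * E) * (1 / \<kappa>)"
        using U_near_b[OF \<zeta> r] wb_le(1) UC(1) C E0 unfolding z_def[symmetric] C2_def[symmetric] E_def[symmetric]
        by (intro order_trans[OF n] add_mono mult_mono) auto
      also have "\<dots> = (C2 + C3) / \<kappa> * E" by (simp add: add_divide_distrib algebra_simps)
      also have "\<dots> \<le> C * E" unfolding C_def using C E0 kappa_pos by (intro mult_right_mono divide_right_mono) auto
      finally show ?thesis unfolding E_def .
    qed
  qed
qed

text \<open>
  The defect of the exact solution in the discretized equation at the node \<open>t\<^sub>i\<close>.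
\<close>

abbreviation node_residual :: "real \<Rightarrow> nat \<Rightarrow> int \<Rightarrow> complex" where
  "node_residual h N i \<equiv> u (node a b h i) - g (of_real (node a b h i)) - (\<Sum>j=-int N..int N.
     k (of_real (node a b h i)) (of_real (node a b h j)) * u (node a b h j)
       * of_real (deriv (psi a b) (of_int j * h) * sincJ j h (of_int i * h)))"

text \<open>
  The Volterra integral at \<open>t\<^sub>i\<close> is the primitive of \<open>F = k(t\<^sub>i,\<psi>) U(\<psi>) \<psi>'\<close> evaluated at \<open>i h\<close>. Here \<open>\<psi>'\<close>
  supplies the decay \<open>exp (- \<bar>x\<bar>)\<close>, while \<open>k\<close> and \<open>U\<close> contribute a bounded factor.
\<close>

theorem collocation_residual_bound:
  obtains C where "0 \<le> C" "\<And>h N i. 0 < h \<Longrightarrow>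
    norm (node_residual h N i) \<le> C * (h / sinh (pi * d / h) + exp (- h * real N))"
proof -
  obtain CJ where CJ: "0 \<le> CJ" "\<And>h j x. 0 < h \<Longrightarrow> \<bar>sincJ j h x\<bar> \<le> h * CJ" by (rule sincJ_bounded) blast
  define B' where "B' = K * M * ((b - a) / \<kappa>\<^sup>2)"
  have B'0: "0 \<le> B'" using K0 M0 ab by (simp add: B'_def)
  define B where "B = B' * (max 1 (4 / 1)) ^ 4"
  have B0: "0 \<le> B" using B'0 by (simp add: B_def)
  define C where "C = (2 / d + 2 * (1 + 1 / d\<^sup>2)) * B + 4 * B' * CJ"
  have C0: "0 \<le> (2 / d + 2 * (1 + 1 / d\<^sup>2)) * B" "0 \<le> 4 * B' * CJ" using d0 B0 B'0 CJ by simp_all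
  show thesis
  proof (rule that[of C])
    show "0 \<le> C" using C0 by (simp add: C_def)
    fix h :: real and N :: nat and i :: int assume h: "0 < h"
    define t where "t j = node a b h j" for j
    have t_int: "t j \<in> {a<..<b}" for j unfolding t_def node_def by (rule psi_in_interval)
    have tD: "complex_of_real (t j) \<in> D" for j by (rule real_in_D[OF t_int])
    have psi_node: "psi a b (of_real (of_int j * h)) = complex_of_real (t j)" for j
      unfolding t_def node_def by (rule psi_of_real)
    define q where "q w = k (of_real (t i)) w * U w" for w
    have q: "q holomorphic_on D" "\<And>w. w \<in> D \<Longrightarrow> norm (q w) \<le> K * M"
      unfolding q_def[abs_def] by (rule kernel_times_solution(1)[OF tD], rule kernel_times_solution(2)[OF tD])
    define F where "F \<zeta> = q (psi a b \<zeta>) * psi' \<zeta>" for \<zeta>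
    have F_hol: "F holomorphic_on strip d"
    proof -
      have "(\<lambda>\<zeta>. q (psi a b \<zeta>)) holomorphic_on strip d"
        using holomorphic_on_compose_gen[OF holomorphic_psi q(1)] psi_in_D by (auto simp: o_def)
      then show ?thesis unfolding F_def[abs_def] by (intro holomorphic_intros holomorphic_psi')
    qed
    have F_exp: "norm (F \<zeta>) \<le> B' * exp (- 1 * \<bar>Re \<zeta>\<bar>)" if "\<zeta> \<in> strip d" for \<zeta>
    proof -
      have "norm (F \<zeta>) \<le> (K * M) * ((b - a) / \<kappa>\<^sup>2 * exp (- \<bar>Re \<zeta>\<bar>))"
        unfolding F_def norm_mult using q(2)[OF psi_in_D[OF that]] norm_psi'_le[OF that] K0 M0 by (intro mult_mono) auto
      then show ?thesis by (simp add: B'_def)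
    qed
    interpret F: decaying_strip_function F d B
    proof unfold_locales
      show "norm (F z) \<le> B / (1 + (Re z)\<^sup>2)\<^sup>2" if "z \<in> strip d" for z
        using order_trans[OF F_exp[OF that] mult_left_mono[OF exp_decay_imp_quartic_decay[of 1 "Re z"] B'0]]
        by (simp add: B_def)
    qed (use d0 F_hol in auto)
    define Q where "Q x = primitive q (psi a b (complex_of_real x))" for x
    have dQ: "(Q has_vector_derivative F (of_real x)) (at x)" for x
      unfolding Q_def[abs_def] F_def
      by (rule has_vector_derivative_real_field[OF primitive_psi_deriv[OF q real_in_strip]])
    have Q0: "(Q \<longlongrightarrow> 0) at_bot"
    proof (rule Lim_null_comparison)
      have "norm (Q x) \<le> K * M * (R * exp x)" for x
      proof -
        have "norm (Q x) \<le> K * M * norm (psi a b (complex_of_real x) - of_real a)"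
          unfolding Q_def by (rule primitive_le[OF q psi_in_D[OF real_in_strip]])
        also have "\<dots> \<le> K * M * (R * exp x)"
          using near_a(1)[OF real_in_strip[of x]] K0 M0 by (intro mult_left_mono) auto
        finally show ?thesis .
      qed
      then show "\<forall>\<^sub>F x in at_bot. norm (Q x) \<le> K * M * (R * exp x)" by simp
      have "((\<lambda>x. K * M * (R * exp x)) \<longlongrightarrow> K * M * (R * 0)) at_bot"
        by (intro tendsto_mult tendsto_const exp_at_bot)
      then show "((\<lambda>x. K * M * (R * exp x)) \<longlongrightarrow> 0) at_bot" by simp
    qed
    have F_node: "F (of_real (of_int j * h)) = k (of_real (t i)) (of_real (t j)) * u (t j) * of_real (deriv (psi a b) (of_int j * h))" for j
      unfolding F_def q_def psi_node psi'_of_real U_real[OF t_int] ..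
    have Q_node: "Q (of_int i * h) = u (t i) - g (of_real (t i))"
    proof -
      have "Q (of_int i * h) = volterra (of_real a) k U (of_real (t i))"
        unfolding Q_def psi_node kernel_times_solution(3)[OF tD] q_def ..
      then show ?thesis using U_eq[OF tD, of i] U_real[OF t_int] by simp
    qed
    have "norm (Q (of_int i * h) - sincJ_sum h N F (of_int i * h))
       \<le> h * (2 / d + 2 * (1 + 1 / d\<^sup>2)) * B / sinh (pi * d / h) + 4 * B' * CJ / 1 * exp (- 1 * h * real N)"
      by (rule F.sinc_indefinite_integration_error[OF h _ _ dQ Q0 CJ(2)[OF h]]) (use F_exp[OF real_in_strip] in auto)
    also have "\<dots> = (2 / d + 2 * (1 + 1 / d\<^sup>2)) * B * (h / sinh (pi * d / h)) + 4 * B' * CJ * exp (- h * real N)" by simp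
    also have "\<dots> \<le> C * (h / sinh (pi * d / h)) + C * exp (- h * real N)"
      unfolding C_def using C0 h d0 by (intro add_mono mult_right_mono) auto
    finally have le: "norm (Q (of_int i * h) - sincJ_sum h N F (of_int i * h))
      \<le> C * (h / sinh (pi * d / h)) + C * exp (- h * real N)" .
    have sum_eq: "sincJ_sum h N F (of_int i * h)
       = (\<Sum>j=-int N..int N. k (of_real (t i)) (of_real (t j)) * u (t j)
           * of_real (deriv (psi a b) (of_int j * h) * sincJ j h (of_int i * h)))"
      unfolding F_node unfolding of_real_mult mult.assoc ..
    show "norm (node_residual h N i) \<le> C * (h / sinh (pi * d / h) + exp (- h * real N))"
      using le unfolding sum_eq Q_node t_def distrib_left .
  qed
qed

theorem end_remainder_interpolation:
  obtains C where "0 \<le> C" "\<And>\<zeta>. \<zeta> \<in> strip d \<Longrightarrow> norm (end_remainder \<zeta>) \<le> C * exp (- \<alpha> * \<bar>Re \<zeta>\<bar>)"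
    "\<And>h N x. 0 < h \<Longrightarrow> norm (end_remainder (of_real x) -
       sinc_sum h N end_remainder x)
    \<le> C * (1 / sinh (pi * d / h) + exp (- \<alpha> * h * real N) / h)"
proof -
  obtain B' where B': "0 \<le> B'" "\<And>\<zeta>. \<zeta> \<in> strip d \<Longrightarrow> norm (end_remainder \<zeta>) \<le> B' * exp (- \<alpha> * \<bar>Re \<zeta>\<bar>)"
    by (rule end_remainder_decay) blast
  define B where "B = B' * (max 1 (4 / \<alpha>)) ^ 4"
  have B0: "0 \<le> B" using B' by (simp add: B_def)
  interpret F: decaying_strip_function end_remainder d B
  proof unfold_locales
    show "norm (end_remainder z) \<le> B / (1 + (Re z)\<^sup>2)\<^sup>2" if "z \<in> strip d" for z
      using order_trans[OF B'(2)[OF that] mult_left_mono[OF exp_decay_imp_quartic_decay[of \<alpha> "Re z"] B'(1)]] alpha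
      by (simp add: B_def)
  qed (use d0 end_remainder_holomorphic in auto)
  define C where "C = B' + B / d + 2 * B' / \<alpha>"
  have C: "0 \<le> B / d" "0 \<le> 2 * B' / \<alpha>" using B0 d0 B' alpha by auto
  show thesis
  proof (rule that[of C])
    show "0 \<le> C" using C B' by (simp add: C_def)
    show "norm (end_remainder \<zeta>) \<le> C * exp (- \<alpha> * \<bar>Re \<zeta>\<bar>)" if "\<zeta> \<in> strip d" for \<zeta>
      by (rule order_trans[OF B'(2)[OF that] mult_right_mono]) (use C in \<open>auto simp: C_def\<close>)
    fix h x :: real and N :: nat assume h: "0 < h"
    have "norm (end_remainder (of_real x) - sinc_sum h N end_remainder x)
      \<le> B / (d * sinh (pi * d / h)) + 2 * B' / (\<alpha> * h) * exp (- \<alpha> * h * real N)"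
      by (rule F.sinc_interpolation_error[OF h alpha(1)]) (use B'(2)[OF real_in_strip] in auto)
    also have "\<dots> = B / d * (1 / sinh (pi * d / h)) + 2 * B' / \<alpha> * (exp (- \<alpha> * h * real N) / h)" by simp
    also have "\<dots> \<le> C * (1 / sinh (pi * d / h)) + C * (exp (- \<alpha> * h * real N) / h)"
      unfolding C_def using C B' h d0 by (intro add_mono mult_right_mono) auto
    finally show "norm (end_remainder (of_real x) - sinc_sum h N end_remainder x)
      \<le> C * (1 / sinh (pi * d / h) + exp (- \<alpha> * h * real N) / h)" by (simp add: distrib_left)
  qed
qed

end

section \<open>The collocation matrices\<close>

lemma sincJ_at_node: "0 < h \<Longrightarrow> sincJ j h (of_int i * h) = h * delta_m1 (i - j)"
proof -
  assume h: "0 < h"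
  then have "pi * (of_int i * h - of_int j * h) / h = pi * of_int (i - j)" by (simp add: field_simps)
  then show ?thesis by (simp add: sincJ_def delta_m1_def)
qed

lemma delta_m1_tendsto_0: "(\<lambda>m. delta_m1 (- int m)) \<longlonglongrightarrow> 0"
proof -
  have "filterlim (\<lambda>m. pi * of_int (- int m)) at_bot sequentially" by simp real_asymp
  from filterlim_compose[OF Si_at_bot this]
  have "(\<lambda>m. 1 / 2 + 1 / pi * Si (pi * of_int (- int m))) \<longlonglongrightarrow> 1 / 2 + 1 / pi * - (pi / 2)"
    by (intro tendsto_intros)
  then show ?thesis by (simp add: delta_m1_def)
qed

lemma delta_m1_bounded: obtains C where "0 \<le> C" "\<And>m. \<bar>delta_m1 m\<bar> \<le> C"
proof -
  obtain C where C: "0 \<le> C" "\<And>h j x. 0 < h \<Longrightarrow> \<bar>sincJ j h x\<bar> \<le> h * C" by (rule sincJ_bounded) blast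
  have "\<bar>delta_m1 m\<bar> \<le> C" for m using C(2)[of 1 0 "of_int m * 1"] sincJ_at_node[of 1 0 m] by simp
  then show ?thesis using that C(1) by blast
qed

lemma sum_exp_decay_le:
  fixes h :: real
  assumes "0 < h" shows "(\<Sum>j=-int N..int N. h * exp (- h * \<bar>of_int j\<bar>)) \<le> h + 2"
proof -
  have "norm ((\<Sum>j=-int N..int N. exp (- h * \<bar>of_int j\<bar>)) - (\<Sum>j=-int 0..int 0. exp (- h * \<bar>of_int j\<bar>))) \<le> 2 * 1 / h * exp (- h * real 0)"
    by (rule symmetric_tail_bound) (use assms in auto)
  then have "(\<Sum>j=-int N..int N. exp (- h * \<bar>of_int j\<bar>)) \<le> 1 + 2 / h" by (simp add: abs_le_iff)
  then have "h * (\<Sum>j=-int N..int N. exp (- h * \<bar>of_int j\<bar>)) \<le> h * (1 + 2 / h)" using assms by (intro mult_left_mono) auto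
  then show ?thesis using assms by (simp add: sum_distrib_left distrib_left)
qed

lemma invertible_mat_if_injective:
  fixes A :: "complex mat"
  assumes A: "A \<in> carrier_mat n n"
    and inj: "\<And>v. v \<in> carrier_vec n \<Longrightarrow> A *\<^sub>v v = 0\<^sub>v n \<Longrightarrow> v = 0\<^sub>v n"
  shows "invertible_mat A"
    and "\<And>b. b \<in> carrier_vec n \<Longrightarrow> (THE c. c \<in> carrier_vec n \<and> A *\<^sub>v c = b) \<in> carrier_vec n
      \<and> A *\<^sub>v (THE c. c \<in> carrier_vec n \<and> A *\<^sub>v c = b) = b"
proof -
  have "det A \<noteq> 0" using inj unfolding det_0_iff_vec_prod_zero_field[OF A] by blast
  from det_non_zero_imp_unit[OF A this, of "()"]
  obtain B where B: "B \<in> carrier_mat n n" "B * A = 1\<^sub>m n" "A * B = 1\<^sub>m n"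
    unfolding Units_def ring_mat_def by auto
  then show "invertible_mat A" using A unfolding invertible_mat_def inverts_mat_def by auto
  fix b :: "complex Matrix.vec" assume b: "b \<in> carrier_vec n"
  show "(THE c. c \<in> carrier_vec n \<and> A *\<^sub>v c = b) \<in> carrier_vec n
      \<and> A *\<^sub>v (THE c. c \<in> carrier_vec n \<and> A *\<^sub>v c = b) = b"
  proof (rule theI)
    have "A *\<^sub>v (B *\<^sub>v b) = b"
      using assoc_mult_mat_vec[OF A B(1) b] b unfolding B(3) by simp
    then show "B *\<^sub>v b \<in> carrier_vec n \<and> A *\<^sub>v (B *\<^sub>v b) = b" using B(1) b by simp
    fix c assume c: "c \<in> carrier_vec n \<and> A *\<^sub>v c = b"
    then have "B *\<^sub>v b = c"
      using assoc_mult_mat_vec[OF B(1) A, of c] unfolding B(2) by auto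
    then show "c = B *\<^sub>v b" by simp
  qed
qed

context strip_image
begin

lemma psi_less: "x < y \<Longrightarrow> psi a b x < psi a b (y::real)"
proof -
  assume "x < y"
  then have "(b - a) / (1 + exp (- x)) < (b - a) / (1 + exp (- y))"
    using ab by (intro divide_strict_left_mono) (auto simp: add_pos_pos)
  then show ?thesis by (simp add: psi_real)
qed

lemma phi_psi: "phi a b (psi a b x) = x"
proof -
  have "inj (psi a b :: real \<Rightarrow> real)"
    by (rule linorder_injI) (use psi_less in \<open>auto simp: less_le\<close>)
  then show ?thesis unfolding phi_def by (rule inv_into_f_f) simp
qed

lemma psi_ln: 
  assumes "t \<in> {a<..<b}" shows "psi a b (ln ((t - a) / (b - t))) = t"
proof -
  have t: "0 < t - a" "0 < b - t" using assms by auto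
  have "exp (- ln ((t - a) / (b - t))) = (b - t) / (t - a)" using t by (simp add: exp_minus)
  moreover have "1 + (b - t) / (t - a) = (b - a) / (t - a)" using t by (simp add: field_simps)
  ultimately show ?thesis unfolding psi_real using ab t by simp
qed

lemma phi_eq_ln: "t \<in> {a<..<b} \<Longrightarrow> phi a b t = ln ((t - a) / (b - t))"
  using phi_psi[of "ln ((t - a) / (b - t))"] psi_ln by simp

lemma psi_phi: "t \<in> {a<..<b} \<Longrightarrow> psi a b (phi a b t) = t"
  using psi_ln phi_eq_ln by simp

lemma phi_at_a: "filterlim (phi a b) at_bot (at a within {a<..<b})"
proof -
  have "filterlim (\<lambda>t. (t - a) / (b - t)) (at_right 0) (at a within {a<..<b})"
    unfolding filterlim_at
  proof
    show "((\<lambda>t. (t - a) / (b - t)) \<longlongrightarrow> 0) (at a within {a<..<b})" using ab by (auto intro!: tendsto_eq_intros)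
    show "\<forall>\<^sub>F t in at a within {a<..<b}. (t - a) / (b - t) \<in> {0<..} \<and> (t - a) / (b - t) \<noteq> 0"
      unfolding eventually_at_filter by (intro always_eventually) auto
  qed
  from filterlim_compose[OF ln_at_0 this]
  show ?thesis
  proof (rule filterlim_cong[THEN iffD1, rotated 3])
    show "\<forall>\<^sub>F t in at a within {a<..<b}. ln ((t - a) / (b - t)) = phi a b t"
      unfolding eventually_at_filter using phi_eq_ln by (intro always_eventually) auto
  qed auto
qed

lemma phi_at_b: "filterlim (phi a b) at_top (at b within {a<..<b})"
proof -
  have "filterlim (\<lambda>t. (b - t) / (t - a)) (at_right 0) (at b within {a<..<b})"
    unfolding filterlim_at
  proof
    show "((\<lambda>t. (b - t) / (t - a)) \<longlongrightarrow> 0) (at b within {a<..<b})" using ab by (auto intro!: tendsto_eq_intros)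
    show "\<forall>\<^sub>F t in at b within {a<..<b}. (b - t) / (t - a) \<in> {0<..} \<and> (b - t) / (t - a) \<noteq> 0"
      unfolding eventually_at_filter by (intro always_eventually) auto
  qed
  from filterlim_compose[OF filterlim_uminus_at_top_at_bot filterlim_compose[OF ln_at_0 this]]
  show ?thesis
  proof (rule filterlim_cong[THEN iffD1, rotated 3])
    have "- ln ((b - t) / (t - a)) = phi a b t" if "t \<in> {a<..<b}" for t
      unfolding phi_eq_ln[OF that] using that by (simp add: ln_div)
    then show "\<forall>\<^sub>F t in at b within {a<..<b}. - ln ((b - t) / (t - a)) = phi a b t"
      unfolding eventually_at_filter by (intro always_eventually) auto
  qed auto
qed

lemma comp_phi_psi: "comp_phi a b F (psi a b x) = F x"
  using psi_in_interval[of x] by (simp add: comp_phi_def phi_psi)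

lemma sincS_tendsto_0:
  assumes "0 < h" shows "(sincS j h \<longlongrightarrow> 0) at_top" "(sincS j h \<longlongrightarrow> 0) at_bot"
proof -
  have bd: "norm (sincS j h x) \<le> 1 / \<bar>pi * (x - of_int j * h) / h\<bar>" if "x \<noteq> of_int j * h" for x
    using that assms unfolding sincS_def by (simp add: abs_mult divide_right_mono mult_right_mono)
  have "\<forall>\<^sub>F x in at_top. norm (sincS j h x) \<le> 1 / \<bar>pi * (x - of_int j * h) / h\<bar>"
    using eventually_gt_at_top[of "of_int j * h"] by eventually_elim (rule bd, simp)
  moreover have "((\<lambda>x. 1 / \<bar>pi * (x - of_int j * h) / h\<bar>) \<longlongrightarrow> 0) at_top" using assms by real_asymp
  ultimately show "(sincS j h \<longlongrightarrow> 0) at_top" by (rule Lim_null_comparison)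
  have "\<forall>\<^sub>F x in at_bot. norm (sincS j h x) \<le> 1 / \<bar>pi * (x - of_int j * h) / h\<bar>"
    using eventually_gt_at_bot[of "of_int j * h"] by eventually_elim (rule bd, simp)
  moreover have "((\<lambda>x. 1 / \<bar>pi * (x - of_int j * h) / h\<bar>) \<longlongrightarrow> 0) at_bot" using assms by real_asymp
  ultimately show "(sincS j h \<longlongrightarrow> 0) at_bot" by (rule Lim_null_comparison)
qed

text \<open>
  \<open>\<phi>\<close> tends to \<open>\<mp>\<infinity>\<close> at the endpoints, where the Sinc functions vanish.
\<close>

lemma comp_phi_sincS_endpoints:
  assumes h: "0 < h"
  shows "comp_phi a b (sincS j h) a = 0" "comp_phi a b (sincS j h) b = 0"
proof -
  have "Lim (at a within {a<..<b}) (\<lambda>s. sincS j h (phi a b s)) = 0"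
    by (rule tendsto_Lim[OF _ filterlim_compose[OF sincS_tendsto_0(2)[OF h] phi_at_a]])
       (use ab in \<open>simp add: trivial_limit_within islimpt_greaterThanLessThan1\<close>)
  then show "comp_phi a b (sincS j h) a = 0" by (simp add: comp_phi_def)
  have "Lim (at b within {a<..<b}) (\<lambda>s. sincS j h (phi a b s)) = 0"
    by (rule tendsto_Lim[OF _ filterlim_compose[OF sincS_tendsto_0(1)[OF h] phi_at_b]])
       (use ab in \<open>simp add: trivial_limit_within islimpt_greaterThanLessThan2\<close>)
  then show "comp_phi a b (sincS j h) b = 0" by (simp add: comp_phi_def)
qed

definition row_node :: "real \<Rightarrow> nat \<Rightarrow> nat \<Rightarrow> real" where
  "row_node h N p = node a b h (int p - int N)"

text \<open>
  The matrix of the discretized integral operator acting on nodal values, in contrast to the method's own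
  coefficients.
\<close>

definition nystrom :: "(complex \<Rightarrow> complex \<Rightarrow> complex) \<Rightarrow> real \<Rightarrow> nat \<Rightarrow> nat \<Rightarrow> nat \<Rightarrow> complex" where
  "nystrom k h N p q = k (of_real (row_node h N p)) (of_real (row_node h N q)) *
     of_real (deriv (psi a b) (of_int (int q - int N) * h) * (h * delta_m1 (int p - int q)))"

definition interp_mat :: "real \<Rightarrow> nat \<Rightarrow> nat \<Rightarrow> nat \<Rightarrow> complex" where
  "interp_mat h N p q = (if q = 0 then of_real (omega_a a b (row_node h N p))
     else if q = 2 * N then of_real (omega_b a b (row_node h N p)) else if p = q then 1 else 0)"

lemma E_RZ_entry: "p < 2 * N + 1 \<Longrightarrow> q < 2 * N + 1 \<Longrightarrow> E_RZ a b h N $$ (p, q) = interp_mat h N p q"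
  unfolding E_RZ_def interp_mat_def row_node_def by (auto simp: Let_def)

lemma VN_at_node:
  assumes h: "0 < h"
  shows "VN a b k h N f (row_node h N p) = (\<Sum>l<2 * N + 1. nystrom k h N p l * of_real (f (row_node h N l)))"
proof -
  have "VN a b k h N f (row_node h N p) = (\<Sum>j=-int N..int N. k (of_real (row_node h N p)) (of_real (node a b h j)) *
     of_real (f (node a b h j) * deriv (psi a b) (of_int j * h) * (h * delta_m1 (int p - int N - j))))"
    unfolding VN_def row_node_def node_def comp_phi_psi sincJ_at_node[OF h] by simp
  also have "\<dots> = (\<Sum>l<2 * N + 1. k (of_real (row_node h N p)) (of_real (node a b h (int l - int N))) *
     of_real (f (node a b h (int l - int N)) * deriv (psi a b) (of_int (int l - int N) * h) * (h * delta_m1 (int p - int N - (int l - int N)))))"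
    by (rule sum_positions_eq[symmetric])
  finally show ?thesis by (simp add: nystrom_def row_node_def mult_ac)
qed

text \<open>
  The factorization \<open>V = A E\<close>, with \<open>A\<close> the matrix acting on nodal values and \<open>E\<close> the interpolation matrix.
\<close>

lemma V_RZ_entry:
  assumes h: "0 < h" and N: "1 \<le> N" and p: "p < 2 * N + 1" and q: "q < 2 * N + 1"
  shows "V_RZ a b k h N $$ (p, q) = (\<Sum>l<2 * N + 1. nystrom k h N p l * interp_mat h N l q)"
proof -
  consider "q = 0" | "q = 2 * N" "q \<noteq> 0" | "q \<noteq> 0" "q \<noteq> 2 * N" by blast
  then show ?thesis
  proof cases
    case 1
    then have "V_RZ a b k h N $$ (p, q) = VN a b k h N (omega_a a b) (row_node h N p)"
      using p q by (simp add: V_RZ_def Let_def row_node_def)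
    then show ?thesis unfolding VN_at_node[OF h] using 1 by (simp add: interp_mat_def)
  next
    case 2
    then have "V_RZ a b k h N $$ (p, q) = VN a b k h N (omega_b a b) (row_node h N p)"
      using p q N by (simp add: V_RZ_def Let_def row_node_def)
    then show ?thesis unfolding VN_at_node[OF h] using 2 by (simp add: interp_mat_def)
  next
    case 3
    then have "V_RZ a b k h N $$ (p, q) = nystrom k h N p q"
      using p q by (simp add: V_RZ_def Let_def row_node_def nystrom_def mult.assoc)
    also have "\<dots> = (\<Sum>l<2 * N + 1. nystrom k h N p l * (if l = q then 1 else 0))"
      using q by (rule sum_delta_matrix_row[symmetric])
    finally show ?thesis using 3 by (simp add: interp_mat_def)
  qed
qed

lemma collocation_row:
  assumes h: "0 < h" and N: "1 \<le> N" and p: "p < 2 * N + 1" and c: "c \<in> carrier_vec (2 * N + 1)"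
  defines "x \<equiv> \<lambda>l. \<Sum>q<2 * N + 1. interp_mat h N l q * vec_index c q"
  shows "vec_index ((E_RZ a b h N - V_RZ a b k h N) *\<^sub>v c) p = x p - (\<Sum>l<2 * N + 1. nystrom k h N p l * x l)"
proof -
  have E: "E_RZ a b h N \<in> carrier_mat (2 * N + 1) (2 * N + 1)" by (simp add: E_RZ_def)
  have V: "V_RZ a b k h N \<in> carrier_mat (2 * N + 1) (2 * N + 1)" by (simp add: V_RZ_def)
  have "vec_index ((E_RZ a b h N - V_RZ a b k h N) *\<^sub>v c) p
     = (\<Sum>q<2 * N + 1. (E_RZ a b h N $$ (p, q) - V_RZ a b k h N $$ (p, q)) * vec_index c q)"
    using E V p c by (simp add: scalar_prod_def lessThan_atLeast0)
  also have "\<dots> = (\<Sum>q<2 * N + 1. (interp_mat h N p q - (\<Sum>l<2 * N + 1. nystrom k h N p l * interp_mat h N l q)) * vec_index c q)"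
    by (intro sum.cong refl) (simp add: E_RZ_entry[OF p] V_RZ_entry[OF h N p] del: sum.lessThan_Suc)
  also have "\<dots> = x p - (\<Sum>q<2 * N + 1. \<Sum>l<2 * N + 1. nystrom k h N p l * (interp_mat h N l q * vec_index c q))"
    unfolding x_def by (simp add: left_diff_distrib sum_subtractf sum_distrib_right mult.assoc del: sum.lessThan_Suc)
  also have "(\<Sum>q<2 * N + 1. \<Sum>l<2 * N + 1. nystrom k h N p l * (interp_mat h N l q * vec_index c q))
      = (\<Sum>l<2 * N + 1. nystrom k h N p l * x l)"
    unfolding x_def sum_distrib_left by (rule sum.swap)
  finally show ?thesis .
qed

lemma interp_row:
  assumes N: "1 \<le> N" and p: "p < 2 * N + 1"
  shows "(\<Sum>q<2 * N + 1. interp_mat h N p q * c q) = of_real (omega_a a b (row_node h N p)) * c 0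
     + of_real (omega_b a b (row_node h N p)) * c (2 * N) + (if p = 0 \<or> p = 2 * N then 0 else c p)"
proof -
  have "{..<2 * N + 1} = insert 0 (insert (2 * N) {0<..<2 * N})" using N by auto
  then have "(\<Sum>q<2 * N + 1. interp_mat h N p q * c q) = interp_mat h N p 0 * c 0 + (interp_mat h N p (2 * N) * c (2 * N)
     + (\<Sum>q\<in>{0<..<2 * N}. interp_mat h N p q * c q))" using N by simp
  also have "(\<Sum>q\<in>{0<..<2 * N}. interp_mat h N p q * c q) = (\<Sum>q\<in>{0<..<2 * N}. if q = p then c p else 0)"
    by (intro sum.cong refl) (auto simp: interp_mat_def)
  also have "\<dots> = (if p = 0 \<or> p = 2 * N then 0 else c p)" using p by auto
  finally show ?thesis using N by (simp add: interp_mat_def add.assoc)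
qed

end

section \<open>Convergence\<close>

lemma inverse_sinh_le: "1 \<le> s \<Longrightarrow> 1 / sinh s \<le> 4 * exp (- (s::real))"
proof -
  assume s: "1 \<le> s"
  have "exp s * exp (- s) = 1" by (simp flip: exp_add)
  have e: "2 \<le> exp s" using exp_ge_add_one_self[of s] s by linarith
  have "exp (- s) \<le> 1 / 2" using e by (simp add: exp_minus field_simps)
  then have "exp s / 4 \<le> sinh s" using e by (simp add: sinh_def)
  then have "1 / sinh s \<le> 1 / (exp s / 4)" by (intro divide_left_mono mult_pos_pos) (use s in auto)
  then show ?thesis by (simp add: exp_minus field_simps)
qed

lemma mesh_eq: "1 \<le> N \<Longrightarrow> mesh d \<alpha> N = sqrt (pi * d / \<alpha>) / sqrt (real N)"
  by (simp add: mesh_def real_sqrt_divide real_sqrt_mult)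

context strip_image
begin

lemma omega_psi:
  "omega_a a b (psi a b x) = 1 / (1 + exp x)" "omega_b a b (psi a b x) = 1 / (1 + exp (- x))"
proof -
  have p: "1 + exp (- x) \<noteq> 0" "1 + exp x \<noteq> 0" using add_pos_pos[of 1 "exp (- x)"] add_pos_pos[of 1 "exp x"] by simp_all
  show b: "omega_b a b (psi a b x) = 1 / (1 + exp (- x))" using ab by (simp add: omega_b_def psi_real)
  have "omega_a a b t + omega_b a b t = 1" for t using ab by (simp add: omega_a_def omega_b_def flip: add_divide_distrib)
  then have "omega_a a b (psi a b x) = 1 - 1 / (1 + exp (- x))" unfolding b[symmetric] by (simp add: eq_diff_eq)
  also have "\<dots> = exp (- x) / (1 + exp (- x))" using p by (simp add: field_simps)
  also have "\<dots> = 1 / (1 + exp x)"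
  proof -
    have "exp (- x) * (1 + exp x) = 1 + exp (- x)" by (simp add: distrib_left flip: exp_add)
    then show ?thesis using p by (simp add: field_simps)
  qed
  finally show "omega_a a b (psi a b x) = 1 / (1 + exp x)" .
qed

lemma omega_bounds:
  assumes "t \<in> {a..b}"
  shows "0 \<le> omega_a a b t" "0 \<le> omega_b a b t" "omega_a a b t + omega_b a b t = 1" "omega_a a b t \<le> 1" "omega_b a b t \<le> 1"
  using assms ab by (auto simp: omega_a_def omega_b_def divide_le_eq simp flip: add_divide_distrib)

lemma row_node_in_interval: "row_node h N p \<in> {a<..<b}"
  unfolding row_node_def node_def by (rule psi_in_interval)

text \<open>
  The coefficients are recovered stably from the nodal values. Rows \<open>0\<close> and \<open>2N\<close> only involve the end
  coefficients, through a symmetric matrix with rows \<open>(1 - \<epsilon>, \<epsilon>)\<close> and \<open>(\<epsilon>, 1 - \<epsilon>)\<close>, where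
  \<open>\<epsilon> = 1 / (1 + exp (N h)) \<le> 1 / 4\<close>.
\<close>

lemma coefficient_bound:
  fixes c :: "nat \<Rightarrow> complex"
  assumes N: "1 \<le> N" and big: "3 \<le> exp (real N * h)"
    and \<eta>: "\<And>p. p < 2 * N + 1 \<Longrightarrow> norm (\<Sum>q<2 * N + 1. interp_mat h N p q * c q) \<le> \<eta>" and q: "q < 2 * N + 1"
  shows "norm (c q) \<le> 4 * \<eta>"
proof -
  define \<epsilon> where "\<epsilon> = 1 / (1 + exp (real N * h))"
  define y where "y p = (\<Sum>q<2 * N + 1. interp_mat h N p q * c q)" for p
  have \<epsilon>: "0 \<le> \<epsilon>" "\<epsilon> \<le> 1 / 4" using big by (auto simp: \<epsilon>_def field_simps)
  have y: "norm (y p) \<le> \<eta>" if "p < 2 * N + 1" for p using \<eta>[OF that] by (simp add: y_def)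
  have p0: "row_node h N 0 = psi a b (- (real N * h))" and pN: "row_node h N (2 * N) = psi a b (real N * h)"
    by (simp_all add: row_node_def node_def)
  have s: "1 / (1 + exp (- (real N * h))) = 1 - \<epsilon>"
  proof -
    define e where "e = exp (real N * h)"
    have "0 < e" by (simp add: e_def)
    then show ?thesis unfolding \<epsilon>_def exp_minus e_def[symmetric] by (simp add: field_simps)
  qed
  have y_row: "y p = of_real (omega_a a b (row_node h N p)) * c 0 + of_real (omega_b a b (row_node h N p)) * c (2 * N)
      + (if p = 0 \<or> p = 2 * N then 0 else c p)" if "p < 2 * N + 1" for p
    unfolding y_def by (rule interp_row[OF N that])
  have y0: "y 0 = of_real (1 - \<epsilon>) * c 0 + of_real \<epsilon> * c (2 * N)"
    using y_row[of 0] unfolding p0 omega_psi minus_minus s \<epsilon>_def[symmetric] by simp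
  have y2: "y (2 * N) = of_real \<epsilon> * c 0 + of_real (1 - \<epsilon>) * c (2 * N)"
    using y_row[of "2 * N"] unfolding pN omega_psi s \<epsilon>_def[symmetric] by simp
  have sum: "c 0 + c (2 * N) = y 0 + y (2 * N)" unfolding y0 y2 by (simp add: algebra_simps)
  have "of_real (1 - 2 * \<epsilon>) * (c 0 - c (2 * N)) = y 0 - y (2 * N)" unfolding y0 y2 by (simp add: algebra_simps)
  then have "norm (complex_of_real (1 - 2 * \<epsilon>)) * norm (c 0 - c (2 * N)) = norm (y 0 - y (2 * N))"
    unfolding norm_mult[symmetric] by simp
  then have "(1 - 2 * \<epsilon>) * norm (c 0 - c (2 * N)) = norm (y 0 - y (2 * N))" unfolding norm_of_real using \<epsilon> by simp
  moreover have "1 / 2 * norm (c 0 - c (2 * N)) \<le> (1 - 2 * \<epsilon>) * norm (c 0 - c (2 * N))"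
    using \<epsilon> by (intro mult_right_mono) auto
  ultimately have diff: "norm (c 0 - c (2 * N)) \<le> 2 * (2 * \<eta>)"
    using norm_triangle_ineq4[of "y 0" "y (2 * N)"] y[of 0] y[of "2 * N"] by simp
  have sum': "norm (c 0 + c (2 * N)) \<le> 2 * \<eta>"
    unfolding sum using norm_triangle_ineq[of "y 0" "y (2 * N)"] y[of 0] y[of "2 * N"] by simp
  have "2 * norm (c 0) = norm ((c 0 + c (2 * N)) + (c 0 - c (2 * N)))" by (simp flip: norm_mult)
  then have c0: "norm (c 0) \<le> 3 * \<eta>" using norm_triangle_ineq[of "c 0 + c (2 * N)" "c 0 - c (2 * N)"] diff sum' by simp
  have "2 * norm (c (2 * N)) = norm ((c 0 + c (2 * N)) - (c 0 - c (2 * N)))" by (simp flip: norm_mult)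
  then have c2: "norm (c (2 * N)) \<le> 3 * \<eta>" using norm_triangle_ineq4[of "c 0 + c (2 * N)" "c 0 - c (2 * N)"] diff sum' by simp
  have \<eta>0: "0 \<le> \<eta>" using order_trans[OF norm_ge_zero y[of 0]] by simp
  show ?thesis
  proof (cases "q = 0 \<or> q = 2 * N")
    case True then show ?thesis using c0 c2 \<eta>0 by auto
  next
    case False
    have "c q = y q - (of_real (omega_a a b (row_node h N q)) * c 0 + of_real (omega_b a b (row_node h N q)) * c (2 * N))"
      using y_row[OF q] False by simp
    then have "norm (c q) \<le> norm (y q) + (norm (of_real (omega_a a b (row_node h N q)) * c 0) + norm (of_real (omega_b a b (row_node h N q)) * c (2 * N)))"
      using norm_triangle_ineq4[of "y q"] norm_triangle_ineq order_trans add_left_mono by metis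
    also have "\<dots> \<le> \<eta> + (omega_a a b (row_node h N q) * (3 * \<eta>) + omega_b a b (row_node h N q) * (3 * \<eta>))"
      using y[OF q] c0 c2 omega_bounds[of "row_node h N q"] row_node_in_interval[of h N q]
      unfolding norm_mult norm_of_real by (intro add_mono mult_mono) auto
    also have "\<dots> = \<eta> + (omega_a a b (row_node h N q) + omega_b a b (row_node h N q)) * (3 * \<eta>)" by (simp add: algebra_simps)
    also have "\<dots> = 4 * \<eta>" using omega_bounds(3)[of "row_node h N q"] row_node_in_interval[of h N q] by simp
    finally show ?thesis .
  qed
qed

end

context volterra_extension
begin

lemma nystrom_bound:
  assumes h: "0 < h" and \<delta>: "\<bar>delta_m1 (int p - int q)\<bar> \<le> \<delta>"
  shows "norm (nystrom k h N p q) \<le> K * ((b - a) / \<kappa>\<^sup>2) * \<delta> * (h * exp (- h * \<bar>of_int (int q - int N)\<bar>))"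
proof -
  let ?x = "of_int (int q - int N) * h"
  have "norm (nystrom k h N p q) = norm (k (of_real (row_node h N p)) (of_real (row_node h N q))) * (\<bar>deriv (psi a b) ?x\<bar> * (h * \<bar>delta_m1 (int p - int q)\<bar>))"
    unfolding nystrom_def norm_mult norm_of_real abs_mult using h by simp
  also have "\<dots> \<le> K * (((b - a) / \<kappa>\<^sup>2 * exp (- \<bar>?x\<bar>)) * (h * \<delta>))"
    using k_le[OF real_in_D[OF row_node_in_interval] real_in_D[OF row_node_in_interval]] deriv_psi_le[of ?x] K0 h \<delta> ab
    by (intro mult_mono) auto
  also have "exp (- \<bar>?x\<bar>) = exp (- h * \<bar>of_int (int q - int N)\<bar>)" using h by (simp add: abs_mult mult.commute)
  finally show ?thesis by (simp add: mult_ac)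
qed

lemma sum_weights_le:
  fixes h :: real
  assumes "0 < h" shows "(\<Sum>q<2 * N + 1. h * exp (- h * \<bar>of_int (int q - int N)\<bar>)) \<le> h + 2"
  using sum_exp_decay_le[OF assms, of N] unfolding sum_positions_eq[where f = "\<lambda>j. h * exp (- h * \<bar>of_int j\<bar>)"] .

text \<open>
  On and above the diagonal the entries contain \<open>\<delta>\<^sub>m\<close> with \<open>m \<le> 0\<close>, which tends to \<open>0\<close> as \<open>m \<rightarrow> -\<infinity>\<close>. So all but
  \<open>m\<^sub>0\<close> entries of a row carry a factor \<open>\<epsilon>\<close>, and the exceptional ones are each of order \<open>h\<close>.
\<close>

lemma nystrom_upper_row_sum:
  assumes h: "0 < h" and C: "0 \<le> C" "\<And>m. \<bar>delta_m1 m\<bar> \<le> C"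
    and \<epsilon>: "0 \<le> \<epsilon>" "\<And>m. m0 \<le> m \<Longrightarrow> \<bar>delta_m1 (- int m)\<bar> \<le> \<epsilon>"
  shows "(\<Sum>q\<in>{p..<2 * N + 1}. norm (nystrom k h N p q))
     \<le> K * ((b - a) / \<kappa>\<^sup>2) * (\<epsilon> * (h + 2) + C * h * real m0)"
proof -
  define A where "A = K * ((b - a) / \<kappa>\<^sup>2)"
  have A: "0 \<le> A" using K0 ab by (simp add: A_def)
  define w where "w q = h * exp (- h * \<bar>real_of_int (int q - int N)\<bar>)" for q
  have w: "0 \<le> w q" "w q \<le> h" for q using h by (auto simp: w_def mult_le_cancel_left1)
  have "(\<Sum>q\<in>{p..<2 * N + 1}. norm (nystrom k h N p q))
      \<le> (\<Sum>q\<in>{p..<2 * N + 1}. A * (\<epsilon> * w q) + (if q < p + m0 then A * (C * h) else 0))"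
  proof (intro sum_mono)
    fix q assume q: "q \<in> {p..<2 * N + 1}"
    show "norm (nystrom k h N p q) \<le> A * (\<epsilon> * w q) + (if q < p + m0 then A * (C * h) else 0)"
    proof (cases "q < p + m0")
      case True
      have "norm (nystrom k h N p q) \<le> A * C * w q" using nystrom_bound[OF h C(2)] unfolding A_def w_def .
      also have "\<dots> \<le> A * C * h" using w A C by (intro mult_left_mono) auto
      also have "\<dots> \<le> A * (\<epsilon> * w q) + A * (C * h)" using A \<epsilon>(1) w(1)[of q] by simp
      finally show ?thesis using True by simp
    next
      case False
      have "int p - int q = - int (q - p)" using q by auto
      then have "\<bar>delta_m1 (int p - int q)\<bar> \<le> \<epsilon>" using \<epsilon>(2)[of "q - p"] False by simp
      from nystrom_bound[OF h this] show ?thesis using False unfolding A_def w_def by (simp add: mult.assoc)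
    qed
  qed
  also have "\<dots> = A * (\<epsilon> * (\<Sum>q\<in>{p..<2 * N + 1}. w q)) + real (card ({p..<2 * N + 1} \<inter> {q. q < p + m0})) * (A * (C * h))"
    by (simp add: sum.distrib sum_distrib_left sum.If_cases del: sum.op_ivl_Suc)
  also have "\<dots> \<le> A * (\<epsilon> * (h + 2)) + real m0 * (A * (C * h))"
  proof (intro add_mono mult_left_mono mult_right_mono)
    have "(\<Sum>q\<in>{p..<2 * N + 1}. w q) \<le> (\<Sum>q<2 * N + 1. w q)" by (intro sum_mono2) (use w in auto)
    also have "\<dots> \<le> h + 2" unfolding w_def by (rule sum_weights_le[OF h])
    finally show "(\<Sum>q\<in>{p..<2 * N + 1}. w q) \<le> h + 2" .
    have "card ({p..<2 * N + 1} \<inter> {q. q < p + m0}) \<le> card {p..<p + m0}" by (intro card_mono) auto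
    then show "real (card ({p..<2 * N + 1} \<inter> {q. q < p + m0})) \<le> real m0" by simp
  qed (use A C h \<epsilon> in auto)
  finally show ?thesis unfolding A_def by (simp add: distrib_left mult_ac)
qed

lemma nystrom_residual:
  assumes "0 < h" and C: "\<And>i. norm (node_residual h N i) \<le> \<phi>"
  shows "norm (u (row_node h N p) - g (of_real (row_node h N p)) - (\<Sum>q<2 * N + 1. nystrom k h N p q * u (row_node h N q))) \<le> \<phi>"
proof -
  let ?i = "int p - int N"
  have "(\<Sum>q<2 * N + 1. nystrom k h N p q * u (row_node h N q)) = (\<Sum>q<2 * N + 1.
      k (of_real (node a b h ?i)) (of_real (node a b h (int q - int N))) * u (node a b h (int q - int N))
        * of_real (deriv (psi a b) (of_int (int q - int N) * h) * sincJ (int q - int N) h (of_int ?i * h)))"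
    unfolding sincJ_at_node[OF assms(1)] by (intro sum.cong refl) (simp add: nystrom_def row_node_def mult_ac)
  also have "\<dots> = (\<Sum>j=-int N..int N.
      k (of_real (node a b h ?i)) (of_real (node a b h j)) * u (node a b h j)
        * of_real (deriv (psi a b) (of_int j * h) * sincJ j h (of_int ?i * h)))"
    by (rule sum_positions_eq)
  finally show ?thesis using C[of ?i] unfolding row_node_def by simp
qed

lemma solution_eq_end_remainder:
  "u (psi a b x) = end_remainder (of_real x) + u a * of_real (omega_a a b (psi a b x)) + u b * of_real (omega_b a b (psi a b x))"
  unfolding end_remainder_def psi_of_real U_real[OF psi_in_interval] omega_a_def omega_b_def by simp

end

context volterra_extension
begin

context
  fixes h :: real and N :: nat and P \<rho> :: real and w :: "nat \<Rightarrow> real"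
  assumes h: "0 < h" and N: "1 \<le> N" and big: "3 \<le> exp (real N * h)"
    and w: "\<And>q. 0 \<le> w q" "(\<Sum>q<2 * N + 1. w q) \<le> P" "\<And>p q. norm (nystrom k h N p q) \<le> w q"
    and up: "\<And>p. (\<Sum>q\<in>{p..<2 * N + 1}. norm (nystrom k h N p q)) \<le> \<rho>" and small: "exp P * \<rho> \<le> 1 / 2"
begin

lemma nystrom_stability:
  assumes "\<And>p. p < 2 * N + 1 \<Longrightarrow> norm (x p - (\<Sum>q<2 * N + 1. nystrom k h N p q * x q)) \<le> \<phi>" "p < 2 * N + 1"
  shows "norm (x p) \<le> 2 * exp P * \<phi>"
proof (rule almost_lower_triangular_stability[where n = "2 * N + 1" and A = "nystrom k h N" and p = w and \<rho> = \<rho>])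
  show "norm (nystrom k h N i j) \<le> w j" for i j by (rule w(3))
  show "x i - (\<Sum>j<2 * N + 1. nystrom k h N i j * x j) = x i - (\<Sum>q<2 * N + 1. nystrom k h N i q * x q)" for i ..
  show "norm (x i - (\<Sum>q<2 * N + 1. nystrom k h N i q * x q)) \<le> \<phi>" if "i < 2 * N + 1" for i
    using that by (rule assms(1))
  show "(\<Sum>j\<in>{i..<2 * N + 1}. norm (nystrom k h N i j)) \<le> \<rho>" for i by (rule up)
  show "exp P * \<rho> \<le> 1 / 2" by (rule small)
  show "p < 2 * N + 1" by (rule assms(2))
qed (rule w(1), rule w(2))

lemma collocation_matrix_carrier: "E_RZ a b h N - V_RZ a b k h N \<in> carrier_mat (2 * N + 1) (2 * N + 1)"
  by (rule minus_carrier_mat) (simp add: V_RZ_def)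

lemma collocation_matrix_injective:
  assumes v: "v \<in> carrier_vec (2 * N + 1)" and 0: "(E_RZ a b h N - V_RZ a b k h N) *\<^sub>v v = 0\<^sub>v (2 * N + 1)"
  shows "v = 0\<^sub>v (2 * N + 1)"
proof (rule eq_vecI)
  define x where "x l = (\<Sum>q<2 * N + 1. interp_mat h N l q * vec_index v q)" for l
  have row: "x p - (\<Sum>q<2 * N + 1. nystrom k h N p q * x q) = 0" if "p < 2 * N + 1" for p
    using collocation_row[OF h N that v, of k] that unfolding 0 x_def by simp
  have x0: "norm (x p) \<le> 2 * exp P * 0" if "p < 2 * N + 1" for p
    by (rule nystrom_stability[OF _ that]) (simp only: row norm_zero order_refl)
  have "norm (vec_index v q) \<le> 4 * 0" if "q < 2 * N + 1" for q
    by (rule coefficient_bound[OF N big _ that]) (use x0 in \<open>simp add: x_def\<close>)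
  then show "vec_index v q = vec_index (0\<^sub>v (2 * N + 1)) q" if "q < dim_vec (0\<^sub>v (2 * N + 1))" for q
    using that by simp
qed (use v in simp)

lemma collocation_matrix_invertible: "invertible_mat (E_RZ a b h N - V_RZ a b k h N)"
  using collocation_matrix_carrier collocation_matrix_injective by (rule invertible_mat_if_injective)

text \<open>
  The computed coefficients are compared with \<open>u(a)\<close>, \<open>u(b)\<close> and the values of the end remainder at the
  interior nodes. Stability controls the difference of the nodal values, hence of the coefficients;
  what remains is the interpolation error of the end remainder. The first and last Sinc functions are
  missing from the method, which costs at most \<open>2 \<tau>\<close>.
\<close>

lemma collocation_error:
  assumes \<phi>: "\<And>p. norm (u (row_node h N p) - g (of_real (row_node h N p)) - (\<Sum>q<2 * N + 1. nystrom k h N p q * u (row_node h N q))) \<le> \<phi>"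
    and \<tau>: "norm (end_remainder (of_real (of_int (int N) * h))) \<le> \<tau>" "norm (end_remainder (of_real (of_int (- int N) * h))) \<le> \<tau>"
    and \<iota>: "\<And>x. norm (end_remainder (of_real x) - sinc_sum h N end_remainder x) \<le> \<iota>"
    and t: "t \<in> {a..b}"
  shows "norm (u t - w_RZ a b g k h N t) \<le> \<iota> + 2 * \<tau> + 4 * (2 * exp P * \<phi> + \<tau>) * (2 + 4 * sqrt (real N))"
proof -
  define c where "c = vec_index (c_RZ a b g k h N)"
  have "c_RZ a b g k h N \<in> carrier_vec (2 * N + 1)
      \<and> (E_RZ a b h N - V_RZ a b k h N) *\<^sub>v c_RZ a b g k h N = g_RZ a b g h N"
    unfolding c_RZ_def
    by (rule invertible_mat_if_injective(2)[OF collocation_matrix_carrier collocation_matrix_injective]) (auto simp: g_RZ_def)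
  then have c_carrier: "c_RZ a b g k h N \<in> carrier_vec (2 * N + 1)"
    and c_eq: "(E_RZ a b h N - V_RZ a b k h N) *\<^sub>v c_RZ a b g k h N = g_RZ a b g h N" by auto
  define f where "f j = end_remainder (of_real (of_int j * h))" for j :: int
  define x where "x p = (\<Sum>q<2 * N + 1. interp_mat h N p q * c q)" for p
  have x_eq: "x p - (\<Sum>q<2 * N + 1. nystrom k h N p q * x q) = g (of_real (row_node h N p))" if "p < 2 * N + 1" for p
    using collocation_row[OF h N that c_carrier, of k] that unfolding c_eq x_def c_def
    by (simp add: g_RZ_def row_node_def)
  have nodal: "norm (x p - u (row_node h N p)) \<le> 2 * exp P * \<phi>" if "p < 2 * N + 1" for p
  proof (rule nystrom_stability[OF _ that])
    fix p assume p: "p < 2 * N + 1"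
    have "(\<Sum>q<2 * N + 1. nystrom k h N p q * (x q - u (row_node h N q)))
       = (\<Sum>q<2 * N + 1. nystrom k h N p q * x q) - (\<Sum>q<2 * N + 1. nystrom k h N p q * u (row_node h N q))"
      by (simp only: right_diff_distrib sum_subtractf)
    then have "x p - u (row_node h N p) - (\<Sum>q<2 * N + 1. nystrom k h N p q * (x q - u (row_node h N q)))
      = - (u (row_node h N p) - g (of_real (row_node h N p)) - (\<Sum>q<2 * N + 1. nystrom k h N p q * u (row_node h N q)))"
      using x_eq[OF p] by (simp add: algebra_simps)
    then show "norm (x p - u (row_node h N p) - (\<Sum>q<2 * N + 1. nystrom k h N p q * (x q - u (row_node h N q)))) \<le> \<phi>"
      using \<phi>[of p] by (simp only: norm_minus_cancel)
  qed
  define c' where "c' q = (if q = 0 then u a else if q = 2 * N then u b else f (int q - int N))" for q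
  define \<Gamma> where "\<Gamma> = 4 * (2 * exp P * \<phi> + \<tau>)"
  have \<tau>0: "0 \<le> \<tau>" by (rule order_trans[OF norm_ge_zero \<tau>(1)])
  have coeff: "norm (c q - c' q) \<le> \<Gamma>" if q: "q < 2 * N + 1" for q
    unfolding \<Gamma>_def
  proof (rule coefficient_bound[OF N big _ q])
    fix p assume p: "p < 2 * N + 1"
    have "u (row_node h N p) = f (int p - int N) + u a * of_real (omega_a a b (row_node h N p)) + u b * of_real (omega_b a b (row_node h N p))"
      unfolding row_node_def node_def f_def by (rule solution_eq_end_remainder)
    then have "(\<Sum>q<2 * N + 1. interp_mat h N p q * c' q) = u (row_node h N p) - (if p = 0 \<or> p = 2 * N then f (int p - int N) else 0)"
      unfolding interp_row[OF N p] using N by (auto simp: c'_def mult.commute)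
    then have "(\<Sum>q<2 * N + 1. interp_mat h N p q * (c q - c' q))
       = (x p - u (row_node h N p)) + (if p = 0 \<or> p = 2 * N then f (int p - int N) else 0)"
      unfolding x_def right_diff_distrib sum_subtractf by simp
    moreover have "norm (if p = 0 \<or> p = 2 * N then f (int p - int N) else 0) \<le> \<tau>"
      using \<tau> \<tau>0 by (auto simp: f_def)
    ultimately show "norm (\<Sum>q<2 * N + 1. interp_mat h N p q * (c q - c' q)) \<le> 2 * exp P * \<phi> + \<tau>"
      using nodal[OF p] by (simp only:) (intro norm_triangle_le add_mono; assumption)
  qed
  have \<Gamma>0: "0 \<le> \<Gamma>" using order_trans[OF norm_ge_zero coeff[of 0]] by simp
  define I where "I = {- int N + 1..int N - 1}"
  define s where "s j = comp_phi a b (sincS j h) t" for j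
  \<comment> \<open>The value \<open>0\<close> at the endpoints is the limit of the remainder there.\<close>
  define ft where "ft = (if t \<in> {a<..<b} then end_remainder (of_real (phi a b t)) else 0)"
  define \<gamma> where "\<gamma> q = c q - c' q" for q
  have endpoints: "t = a \<or> t = b" if "t \<notin> {a<..<b}" using t that by auto
  have s_in: "s j = sincS j h (phi a b t)" if "t \<in> {a<..<b}" for j using that by (simp add: s_def comp_phi_def)
  have s_out: "s j = 0" if "t \<notin> {a<..<b}" for j
    using endpoints[OF that] comp_phi_sincS_endpoints[OF h] unfolding s_def by auto
  have ut: "u t = ft + u a * of_real (omega_a a b t) + u b * of_real (omega_b a b t)"
  proof (cases "t \<in> {a<..<b}")
    case True then show ?thesis using solution_eq_end_remainder[of "phi a b t"] by (simp add: psi_phi ft_def)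
  next
    case False then show ?thesis using endpoints[OF False] ab by (auto simp: ft_def omega_a_def omega_b_def)
  qed
  have full: "(\<Sum>j=-int N..int N. F j) = F (- int N) + (F (int N) + (\<Sum>j\<in>I. F j))" for F :: "int \<Rightarrow> 'c::comm_monoid_add"
  proof -
    have "{-int N..int N} = insert (- int N) (insert (int N) I)" unfolding I_def using N by auto
    then show ?thesis using N by (simp add: I_def)
  qed
  have "w_RZ a b g k h N t = c 0 * of_real (omega_a a b t) + (\<Sum>j\<in>I. c (nat (j + int N)) * of_real (s j)) + c (2 * N) * of_real (omega_b a b t)"
  proof -
    have "nat (int N + int N) = 2 * N" by simp
    then show ?thesis unfolding w_RZ_def Let_def c_def s_def I_def by simp
  qed
  also have "(\<Sum>j\<in>I. c (nat (j + int N)) * of_real (s j)) = (\<Sum>j\<in>I. f j * of_real (s j)) + (\<Sum>j\<in>I. \<gamma> (nat (j + int N)) * of_real (s j))"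
    unfolding sum.distrib[symmetric]
  proof (intro sum.cong refl)
    fix j assume "j \<in> I"
    then have "c' (nat (j + int N)) = f j" unfolding I_def c'_def by auto
    then show "c (nat (j + int N)) * of_real (s j) = f j * of_real (s j) + \<gamma> (nat (j + int N)) * of_real (s j)"
      unfolding \<gamma>_def by (simp add: algebra_simps)
  qed
  finally have wt: "w_RZ a b g k h N t = (u a + \<gamma> 0) * of_real (omega_a a b t) + ((\<Sum>j\<in>I. f j * of_real (s j)) + (\<Sum>j\<in>I. \<gamma> (nat (j + int N)) * of_real (s j)))
      + (u b + \<gamma> (2 * N)) * of_real (omega_b a b t)" using N by (simp add: \<gamma>_def c'_def)
  have split: "u t - w_RZ a b g k h N t = (ft - (\<Sum>j\<in>I. f j * of_real (s j)))
      - (\<gamma> 0 * of_real (omega_a a b t) + (\<Sum>j\<in>I. \<gamma> (nat (j + int N)) * of_real (s j)) + \<gamma> (2 * N) * of_real (omega_b a b t))"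
    unfolding wt by (subst ut) (simp add: algebra_simps)
  have \<iota>0: "0 \<le> \<iota>" by (rule order_trans[OF norm_ge_zero \<iota>[of 0]])
  have part1: "norm (ft - (\<Sum>j\<in>I. f j * of_real (s j))) \<le> \<iota> + 2 * \<tau>"
  proof (cases "t \<in> {a<..<b}")
    case True
    define y where "y = phi a b t"
    have "ft - (\<Sum>j\<in>I. f j * of_real (s j)) = (end_remainder (of_real y) - (\<Sum>j=-int N..int N. f j * of_real (sincS j h y)))
        + (f (- int N) * of_real (sincS (- int N) h y) + f (int N) * of_real (sincS (int N) h y))"
      unfolding full s_in[OF True] y_def[symmetric] using True by (simp add: ft_def y_def)
    also have "norm \<dots> \<le> \<iota> + (\<tau> * 1 + \<tau> * 1)"
    proof (rule norm_triangle_le[OF add_mono])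
      show "norm (end_remainder (of_real y) - (\<Sum>j=-int N..int N. f j * of_real (sincS j h y))) \<le> \<iota>" unfolding f_def by (rule \<iota>)
      show "norm (f (- int N) * of_real (sincS (- int N) h y) + f (int N) * of_real (sincS (int N) h y)) \<le> \<tau> * 1 + \<tau> * 1"
        using \<tau> \<tau>0 sincS_le_1 unfolding f_def[symmetric]
        by (intro norm_triangle_le add_mono) (auto simp: norm_mult simp del: mult_1_right intro!: mult_mono)
    qed
    finally show ?thesis by simp
  next
    case False
    then have "ft = 0" unfolding ft_def by (rule if_not_P)
    then show ?thesis using \<iota>0 \<tau>0 by (simp add: s_out[OF False])
  qed
  have lebesgue: "(\<Sum>j\<in>I. \<bar>s j\<bar>) \<le> 4 * sqrt (real N)"
  proof (cases "t \<in> {a<..<b}")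
    case True
    have "(\<Sum>j\<in>I. \<bar>s j\<bar>) \<le> (\<Sum>j=-int N..int N. \<bar>sincS j h (phi a b t)\<bar>)"
      unfolding s_in[OF True] by (intro sum_mono2) (auto simp: I_def)
    also have "\<dots> \<le> 4 * sqrt (real N)" by (rule sinc_lebesgue_constant[OF h N])
    finally show ?thesis .
  qed (simp add: s_out)
  have "norm (\<Sum>j\<in>I. \<gamma> (nat (j + int N)) * of_real (s j)) \<le> (\<Sum>j\<in>I. \<Gamma> * \<bar>s j\<bar>)"
  proof (rule sum_norm_le)
    fix j assume "j \<in> I"
    then have "nat (j + int N) < 2 * N + 1" by (auto simp: I_def)
    then show "norm (\<gamma> (nat (j + int N)) * of_real (s j)) \<le> \<Gamma> * \<bar>s j\<bar>"
      unfolding norm_mult norm_of_real \<gamma>_def by (intro mult_right_mono coeff) auto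
  qed
  also have "\<dots> \<le> \<Gamma> * (4 * sqrt (real N))" unfolding sum_distrib_left[symmetric] using lebesgue \<Gamma>0 by (rule mult_left_mono)
  finally have inner: "norm (\<Sum>j\<in>I. \<gamma> (nat (j + int N)) * of_real (s j)) \<le> \<Gamma> * (4 * sqrt (real N))" .
  have ends: "norm (\<gamma> 0 * of_real (omega_a a b t)) \<le> \<Gamma> * 1" "norm (\<gamma> (2 * N) * of_real (omega_b a b t)) \<le> \<Gamma> * 1"
  proof -
    have "norm (\<gamma> 0) \<le> \<Gamma>" "norm (\<gamma> (2 * N)) \<le> \<Gamma>" unfolding \<gamma>_def by (rule coeff, simp)+
    moreover have "\<bar>omega_a a b t\<bar> \<le> 1" "\<bar>omega_b a b t\<bar> \<le> 1" using omega_bounds[OF t] by auto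
    ultimately show "norm (\<gamma> 0 * of_real (omega_a a b t)) \<le> \<Gamma> * 1" "norm (\<gamma> (2 * N) * of_real (omega_b a b t)) \<le> \<Gamma> * 1"
      unfolding norm_mult norm_of_real using \<Gamma>0 by (auto simp del: mult_1_right intro!: mult_mono)
  qed
  have part2: "norm (\<gamma> 0 * of_real (omega_a a b t) + (\<Sum>j\<in>I. \<gamma> (nat (j + int N)) * of_real (s j)) + \<gamma> (2 * N) * of_real (omega_b a b t))
     \<le> \<Gamma> * 1 + \<Gamma> * (4 * sqrt (real N)) + \<Gamma> * 1"
    by (intro norm_triangle_le add_mono order_trans[OF norm_triangle_ineq] ends inner)
  have "norm (u t - w_RZ a b g k h N t) \<le> (\<iota> + 2 * \<tau>) + (\<Gamma> * 1 + \<Gamma> * (4 * sqrt (real N)) + \<Gamma> * 1)"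
    unfolding split by (rule order_trans[OF norm_triangle_ineq4 add_mono[OF part1 part2]])
  then show ?thesis unfolding \<Gamma>_def[symmetric] by (simp add: algebra_simps)
qed

end

text \<open>
  The mesh balances discretization against truncation: with \<open>H = \<surd>(\<pi> d / \<alpha>)\<close> and \<open>h = H / \<surd>N\<close> both exponents
  \<open>\<pi> d / h\<close> and \<open>\<alpha> N h\<close> equal \<open>\<surd>(\<pi> d \<alpha> N)\<close>. The factor \<open>\<surd>N\<close> stems from the tail of the cardinal series, which
  is divided by \<open>h\<close>, and from the Lebesgue constant.
\<close>

theorem convergence:
  "\<exists>N0>0.
    (\<forall>N\<ge>N0. invertible_mat (E_RZ a b (mesh d \<alpha> N) N - V_RZ a b k (mesh d \<alpha> N) N)) \<and>
    (\<exists>C. \<forall>N\<ge>N0.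
       unif_norm a b (\<lambda>t. u t - w_RZ a b g k (mesh d \<alpha> N) N t)
         \<le> C * sqrt (real N) * exp (- sqrt (pi * d * \<alpha> * real N)))"
proof -
  define H where "H = sqrt (pi * d / \<alpha>)"
  define s where "s N = sqrt (pi * d * \<alpha>) * sqrt (real N)" for N
  have H: "0 < H" using d0 alpha by (simp add: H_def)
  have sH: "sqrt (pi * d * \<alpha>) = \<alpha> * H"
  proof -
    have "sqrt (\<alpha>\<^sup>2 * (pi * d / \<alpha>)) = sqrt (\<alpha>\<^sup>2) * H" unfolding H_def by (rule real_sqrt_mult)
    then have "\<alpha> * H = sqrt (\<alpha>\<^sup>2 * (pi * d / \<alpha>))" using alpha by simp
    also have "\<alpha>\<^sup>2 * (pi * d / \<alpha>) = pi * d * \<alpha>" using alpha by (simp add: power2_eq_square)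
    finally show ?thesis by simp
  qed
  have piH: "pi * d = \<alpha> * H * H"
  proof -
    have "H * H = pi * d / \<alpha>" using alpha d0 by (simp add: H_def)
    then show ?thesis using alpha by (simp add: mult.assoc)
  qed
  have mesh: "mesh d \<alpha> N = H / sqrt (real N)" if "1 \<le> N" for N using mesh_eq[OF that] by (simp add: H_def)
  obtain CJ where CJ: "0 \<le> CJ" "\<And>m. \<bar>delta_m1 m\<bar> \<le> CJ" by (rule delta_m1_bounded) blast
  obtain C1 where C1: "0 \<le> C1" "\<And>h N i. 0 < h \<Longrightarrow>
    norm (node_residual h N i) \<le> C1 * (h / sinh (pi * d / h) + exp (- h * real N))" by (rule collocation_residual_bound) blast
  obtain C2 where C2: "0 \<le> C2" "\<And>\<zeta>. \<zeta> \<in> strip d \<Longrightarrow> norm (end_remainder \<zeta>) \<le> C2 * exp (- \<alpha> * \<bar>Re \<zeta>\<bar>)"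
    "\<And>h N x. 0 < h \<Longrightarrow> norm (end_remainder (of_real x) -
       sinc_sum h N end_remainder x)
    \<le> C2 * (1 / sinh (pi * d / h) + exp (- \<alpha> * h * real N) / h)" by (rule end_remainder_interpolation) blast
  define A where "A = K * ((b - a) / \<kappa>\<^sup>2)"
  have A: "0 \<le> A" using K0 ab by (simp add: A_def)
  define P where "P = A * CJ * (H + 2)"
  \<comment> \<open>The largest perturbation that the stability lemma tolerates.\<close>
  define \<rho> where "\<rho> = exp (- P) / 2"
  have \<rho>: "0 < \<rho>" "exp P * \<rho> \<le> 1 / 2" by (simp_all add: \<rho>_def exp_minus)
  \<comment> \<open>Both contributions to the upper row sums will be at most \<open>\<rho> / 2\<close>; the summand \<open>1\<close> only avoids division by \<open>0\<close>.\<close>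
  define \<epsilon> where "\<epsilon> = \<rho> / 2 / (A * (H + 2) + 1)"
  have den: "0 < A * (H + 2) + 1" using A H by (intro add_nonneg_pos mult_nonneg_nonneg) auto
  have \<epsilon>: "0 < \<epsilon>" unfolding \<epsilon>_def using \<rho>(1) den by simp
  obtain m0 where m0: "\<And>m. m0 \<le> m \<Longrightarrow> \<bar>delta_m1 (- int m)\<bar> \<le> \<epsilon>"
    using LIMSEQ_D[OF delta_m1_tendsto_0 \<epsilon>] by (metis diff_zero less_imp_le real_norm_def)
  have lim1: "(\<lambda>N. A * CJ * real m0 * H / sqrt (real N)) \<longlonglongrightarrow> 0" by real_asymp
  have lim2: "filterlim (\<lambda>N. H * sqrt (real N)) at_top sequentially" using H by real_asymp
  have lim3: "filterlim s at_top sequentially" unfolding s_def[abs_def] using d0 alpha by real_asymp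
  have "\<forall>\<^sub>F N in sequentially. 1 \<le> N \<and> A * CJ * real m0 * H / sqrt (real N) < \<rho> / 2 \<and> 2 \<le> H * sqrt (real N) \<and> 1 \<le> s N"
  proof (intro eventually_conj)
    show "\<forall>\<^sub>F N in sequentially. A * CJ * real m0 * H / sqrt (real N) < \<rho> / 2"
      using \<rho>(1) by (intro order_tendstoD(2)[OF lim1]) simp
    show "\<forall>\<^sub>F N in sequentially. 2 \<le> H * sqrt (real N)" using lim2 unfolding filterlim_at_top by blast
    show "\<forall>\<^sub>F N in sequentially. 1 \<le> s N" using lim3 unfolding filterlim_at_top by blast
  qed (rule eventually_ge_at_top)
  then obtain N0 where N0: "\<And>N. N0 \<le> N \<Longrightarrow> 1 \<le> N \<and> A * CJ * real m0 * H / sqrt (real N) < \<rho> / 2 \<and> 2 \<le> H * sqrt (real N) \<and> 1 \<le> s N"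
    unfolding eventually_sequentially by blast
  define G where "G = 4 * (2 * exp P * (C1 * (4 * H + 1)) + C2)"
  have G: "0 \<le> G" using C1 C2 H by (simp add: G_def)
  have main: "invertible_mat (E_RZ a b (mesh d \<alpha> N) N - V_RZ a b k (mesh d \<alpha> N) N) \<and>
      (\<forall>t\<in>{a..b}. norm (u t - w_RZ a b g k (mesh d \<alpha> N) N t) \<le> (6 * C2 + C2 / H + 6 * G) * sqrt (real N) * exp (- s N))"
    if "N0 \<le> N" for N
  proof -
    define h where "h = mesh d \<alpha> N"
    define r where "r = sqrt (real N)"
    have N: "1 \<le> N" and m0h: "A * CJ * real m0 * H / r < \<rho> / 2" and Hr: "2 \<le> H * r" and s1: "1 \<le> s N"
      using N0[OF that] by (auto simp: r_def)
    have r: "1 \<le> r" "r * r = real N" using N by (simp_all add: r_def)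
    have hr: "h = H / r" using mesh[OF N] by (simp add: h_def r_def)
    have h: "0 < h" "h \<le> H" using H r(1) by (simp_all add: hr divide_le_eq)
    have hN: "h * real N = H * r" unfolding hr r(2)[symmetric] using r(1) by simp
    have sr: "s N = \<alpha> * (H * r)" by (simp add: s_def sH r_def)
    have pdh: "pi * d / h = s N" unfolding sr hr piH using H r(1) by simp
    have big: "3 \<le> exp (real N * h)"
    proof -
      have "3 \<le> 1 + H * r" using Hr by simp
      also have "\<dots> \<le> exp (H * r)" by (rule exp_ge_add_one_self)
      finally show ?thesis by (simp add: hN mult.commute[of "real N"])
    qed
    define w where "w q = A * CJ * (h * exp (- h * \<bar>of_int (int q - int N)\<bar>))" for q
    have w0: "0 \<le> w q" for q using A CJ h by (simp add: w_def)
    have wP: "(\<Sum>q<2 * N + 1. w q) \<le> P"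
    proof -
      have "(\<Sum>q<2 * N + 1. w q) = A * CJ * (\<Sum>q<2 * N + 1. h * exp (- h * \<bar>of_int (int q - int N)\<bar>))"
        unfolding w_def sum_distrib_left ..
      also have "\<dots> \<le> A * CJ * (h + 2)" using A CJ sum_weights_le[OF h(1), of N] by (intro mult_left_mono) auto
      also have "\<dots> \<le> P" unfolding P_def using A CJ h by (intro mult_left_mono) auto
      finally show ?thesis .
    qed
    have nw: "norm (nystrom k h N p q) \<le> w q" for p q
      using nystrom_bound[OF h(1) CJ(2)] unfolding w_def A_def .
    have up: "(\<Sum>q\<in>{p..<2 * N + 1}. norm (nystrom k h N p q)) \<le> \<rho>" for p
    proof -
      have "(\<Sum>q\<in>{p..<2 * N + 1}. norm (nystrom k h N p q)) \<le> A * (\<epsilon> * (h + 2) + CJ * h * real m0)"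
        unfolding A_def by (rule nystrom_upper_row_sum[OF h(1) CJ]) (use \<epsilon> m0 in auto)
      also have "\<dots> = \<epsilon> * (A * (h + 2)) + A * CJ * real m0 * H / r" by (simp add: hr algebra_simps)
      also have "\<dots> \<le> \<epsilon> * (A * (H + 2) + 1) + \<rho> / 2"
      proof (intro add_mono mult_left_mono)
        have "A * (h + 2) \<le> A * (H + 2)" using A h by (intro mult_left_mono) auto
        then show "A * (h + 2) \<le> A * (H + 2) + 1" by simp
      qed (use m0h \<epsilon> in auto)
      also have "\<dots> = \<rho>"
      proof -
        define Z where "Z = A * (H + 2) + 1"
        have "Z \<noteq> 0" using den unfolding Z_def by simp
        then show ?thesis unfolding \<epsilon>_def Z_def[symmetric] by simp
      qed
      finally show ?thesis .
    qed
    define e where "e = exp (- s N)"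
    have e0: "0 \<le> e" by (simp add: e_def)
    have e1: "exp (- \<alpha> * h * real N) = e" by (simp add: e_def sr mult.assoc hN)
    have e2: "exp (- h * real N) \<le> e"
    proof -
      have "\<alpha> * (H * r) \<le> 1 * (H * r)" using alpha H r by (intro mult_right_mono) auto
      then show ?thesis by (simp add: e_def sr hN)
    qed
    have e3: "1 / sinh (pi * d / h) \<le> 4 * e" unfolding pdh e_def by (rule inverse_sinh_le[OF s1])
    have phi: "norm (u (row_node h N p) - g (of_real (row_node h N p)) - (\<Sum>q<2 * N + 1. nystrom k h N p q * u (row_node h N q))) \<le> C1 * (4 * H + 1) * e" for p
    proof (rule nystrom_residual[OF h(1)])
      fix i
      have "h * (1 / sinh (pi * d / h)) \<le> H * (4 * e)" using e3 h H pdh s1 by (intro mult_mono) auto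
      then have "h / sinh (pi * d / h) + exp (- h * real N) \<le> (4 * H + 1) * e" using e2 by (simp add: algebra_simps)
      then have "C1 * (h / sinh (pi * d / h) + exp (- h * real N)) \<le> C1 * ((4 * H + 1) * e)" using C1(1) by (rule mult_left_mono)
      from order_trans[OF C1(2)[OF h(1)] this]
      show "norm (node_residual h N i) \<le> C1 * (4 * H + 1) * e"
        by (simp add: mult.assoc)
    qed
    have tau: "norm (end_remainder (of_real (of_int j * h))) \<le> C2 * e" if "\<bar>j\<bar> = int N" for j
    proof -
      have "\<bar>real_of_int j\<bar> = real N" using that by linarith
      then have "\<bar>of_int j * h\<bar> = h * real N" using h by (simp add: abs_mult)
      then show ?thesis using C2(2)[OF real_in_strip, of "of_int j * h"] e1 by (simp add: mult.assoc)
    qed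
    have iota: "norm (end_remainder (of_real x) - sinc_sum h N end_remainder x)
       \<le> C2 * (4 * e + e * r / H)" for x
    proof (rule order_trans[OF C2(3)[OF h(1)] mult_left_mono[OF add_mono C2(1)]])
      show "exp (- \<alpha> * h * real N) / h \<le> e * r / H" unfolding e1 by (simp add: hr)
    qed (rule e3)
    have inv: "invertible_mat (E_RZ a b h N - V_RZ a b k h N)"
      by (rule collocation_matrix_invertible[OF h(1) N big w0 wP nw up \<rho>(2)])
    have "norm (u t - w_RZ a b g k h N t) \<le> (6 * C2 + C2 / H + 6 * G) * r * e" if t: "t \<in> {a..b}" for t
    proof -
      have "norm (u t - w_RZ a b g k h N t) \<le> C2 * (4 * e + e * r / H) + 2 * (C2 * e) + 4 * (2 * exp P * (C1 * (4 * H + 1) * e) + C2 * e) * (2 + 4 * r)"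
        unfolding r_def
        by (rule collocation_error[OF h(1) N big w0 wP nw up \<rho>(2) phi _ _ iota[unfolded r_def] t]) (rule tau, simp)+
      also have "\<dots> = (6 * C2 * 1 + C2 / H * r + G * (2 * 1 + 4 * r)) * e"
        unfolding G_def by (simp add: algebra_simps)
      also have "\<dots> \<le> (6 * C2 * r + C2 / H * r + G * (2 * r + 4 * r)) * e"
        using C2(1) G r(1) e0 by (intro mult_right_mono add_mono mult_left_mono) auto
      also have "\<dots> = (6 * C2 + C2 / H + 6 * G) * r * e" by (simp add: algebra_simps)
      finally show ?thesis .
    qed
    then show ?thesis using inv unfolding h_def e_def r_def by blast
  qed
  have sN: "s N = sqrt (pi * d * \<alpha> * real N)" for N by (simp add: s_def real_sqrt_mult)
  show ?thesis
  proof (rule exI[of _ N0], intro conjI)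
    show "0 < N0" using N0[of N0] by simp
    show "\<forall>N\<ge>N0. invertible_mat (E_RZ a b (mesh d \<alpha> N) N - V_RZ a b k (mesh d \<alpha> N) N)" using main by blast
    have "unif_norm a b (\<lambda>t. u t - w_RZ a b g k (mesh d \<alpha> N) N t)
         \<le> (6 * C2 + C2 / H + 6 * G) * sqrt (real N) * exp (- sqrt (pi * d * \<alpha> * real N))" if "N0 \<le> N" for N
      unfolding unif_norm_def sN[symmetric] using main[OF that] ab by (intro cSUP_least) auto
    then show "\<exists>C. \<forall>N\<ge>N0. unif_norm a b (\<lambda>t. u t - w_RZ a b g k (mesh d \<alpha> N) N t)
         \<le> C * sqrt (real N) * exp (- sqrt (pi * d * \<alpha> * real N))" by blast
  qed
qed

end

text \<open>
  The constants bounding the data and the analytic continuation of \<open>u\<close> are obtained here and handed to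
  the locales in which the estimates were carried out.
\<close>

theorem theorem4p4:
  fixes a b \<alpha> d :: real
    and D :: "complex set"
    and g :: "complex \<Rightarrow> complex"
    and k :: "complex \<Rightarrow> complex \<Rightarrow> complex"
    and u :: "real \<Rightarrow> complex"
  assumes "a < b"
    and "0 < \<alpha>" and "\<alpha> \<le> 1" and "0 < d" and "d < pi"
    and "D = psi a b ` strip d"
    and "continuous_on {a..b} (\<lambda>t. g (of_real t))"
    and "continuous_on ({a..b} \<times> {a..b}) (\<lambda>(t, s). k (of_real t) (of_real s))"
    and "g \<in> Hinf D"
    and "\<And>z. z \<in> D \<Longrightarrow> (\<lambda>w. k z w) \<in> Hinf D"
    and "\<And>w. w \<in> D \<Longrightarrow> (\<lambda>z. k z w) \<in> Hinf D"
    and "\<And>t. t \<in> {a..b} \<Longrightarrow> continuous_on {a..b} (\<lambda>s. k (of_real t) (of_real s))"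
    and "\<And>s. s \<in> {a..b} \<Longrightarrow> continuous_on {a..b} (\<lambda>t. k (of_real t) (of_real s))"
    and "g \<in> Malpha a b \<alpha> D"
    and "uniformly_Malpha a b \<alpha> D k"
    and "continuous_on {a..b} u"
    and "\<And>t. t \<in> {a..b} \<Longrightarrow>
      u t - integral {a..t} (\<lambda>s. k (of_real t) (of_real s) * u s) = g (of_real t)"
  shows "\<exists>N0>0.
    (\<forall>N\<ge>N0. invertible_mat (E_RZ a b (mesh d \<alpha> N) N - V_RZ a b k (mesh d \<alpha> N) N)) \<and>
    (\<exists>C. \<forall>N\<ge>N0.
       unif_norm a b (\<lambda>t. u t - w_RZ a b g k (mesh d \<alpha> N) N t)
         \<le> C * sqrt (real N) * exp (- sqrt (pi * d * \<alpha> * real N)))"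
proof -
  interpret S: strip_image a b d by unfold_locales (use assms in auto)
  have D: "S.D = D" unfolding S.D_def assms(6) ..
  interpret V: volterra_problem a b d \<alpha> g k u
    by unfold_locales (use assms in \<open>simp_all add: D\<close>)
  obtain K L where KL: "volterra_problem_bounds a b d \<alpha> g k u K L"
  proof (rule V.kernel_bounds)
    fix K L
    assume "0 \<le> K" "0 \<le> L"
      "\<And>z w. z \<in> S.D \<Longrightarrow> w \<in> S.D \<Longrightarrow> norm (k z w) \<le> K"
      "\<And>z z' w. z \<in> S.D \<Longrightarrow> z' \<in> S.D \<Longrightarrow> w \<in> S.D \<Longrightarrow> norm (k z w - k z' w)
        \<le> L * (norm (of_real b - z) powr \<alpha> + norm (of_real b - z') powr \<alpha>)"
      "\<And>z. z \<in> S.D \<Longrightarrow> norm (g z) \<le> K"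
      "\<And>z. z \<in> S.D \<Longrightarrow> norm (g z - g (of_real a)) \<le> L * norm (z - of_real a) powr \<alpha>"
      "\<And>z. z \<in> S.D \<Longrightarrow> norm (g (of_real b) - g z) \<le> L * norm (of_real b - z) powr \<alpha>"
    then have "volterra_problem_bounds a b d \<alpha> g k u K L" by unfold_locales
    then show ?thesis by (rule that)
  qed
  interpret B: volterra_problem_bounds a b d \<alpha> g k u K L by (rule KL)
  obtain U M where UM: "volterra_extension a b d \<alpha> g k u K L U M"
  proof (rule B.solution_extension)
    fix U M
    assume "U holomorphic_on S.D" "0 \<le> M" "\<And>z. z \<in> S.D \<Longrightarrow> norm (U z) \<le> M"
      "\<And>z. z \<in> S.D \<Longrightarrow> U z = g z + volterra (of_real a) k U z"
      "\<And>t. t \<in> {a<..<b} \<Longrightarrow> U (of_real t) = u t"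
    then have "volterra_extension a b d \<alpha> g k u K L U M" by unfold_locales
    then show ?thesis by (rule that)
  qed
  interpret E: volterra_extension a b d \<alpha> g k u K L U M by (rule UM)
  show ?thesis by (rule E.convergence)
qed

end
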